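(* Let $n\geq 2$, let $V\subset\mathbb{R}^n$ be a nonempty open set, and let $F\in(\mathcal{E}'(\mathbb{R}^n))^n$ be such that $(\mathrm{d}F)_{ij}\in\mathcal{A}_V$ for all $i,j=1,\dots,n$. If $X_1F=0$ on all lines intersecting $V$, then $F=\mathrm{d}\phi$ for some $\phi\in\mathcal{E}'(\mathbb{R}^n)$.
   Context: All functions and distributions are complex valued. $\mathcal{E}'(\mathbb{R}^n)$ is the space of compactly supported distributions; $F\in(\mathcal{E}'(\mathbb{R}^n))^n$ means $F=(F_1,\dots,F_n)$ with each $F_i\in\mathcal{E}'(\mathbb{R}^n)$. For a vector-valued distribution $F$, the exterior derivative (curl) is the matrix with components $(\mathrm{d}F)_{ij}=\partial_iF_j-\partial_jF_i$; for a scalar distribution $\phi$, $\mathrm{d}\phi$ is its distributional gradient. For $r\in\mathbb{R}$, $H^r(\mathbb{R}^n)=\{f\in\mathscr{S}'(\mathbb{R}^n):(1+|\cdot|^2)^{r/2}\hat f\in L^2(\mathbb{R}^n)\}$, and $H^{-\infty}(\mathbb{R}^n)=\bigcup_{r\in\mathbb{R}}H^r(\mathbb{R}^n)$. $\mathcal{P}$ is the set of all nonzero polynomials on $\mathbb{R}^n$ with complex coefficients; $P(\xi)=\sum_{|\alpha|\leq m}a_\alpha\xi^\alpha\in\mathcal{P}$ induces the constant coefficient operator $P(D)=\sum_{|\alpha|\leq m}a_\alpha D^\alpha$, $D^\alpha=D_1^{\alpha_1}\cdots D_n^{\alpha_n}$, $D_j=-i\partial_j$, acting on distributions. For a nonempty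 open set $V\subset\mathbb{R}^n$ the set of admissible functions is $$\mathcal{A}_V=\{f\in H^{-\infty}(\mathbb{R}^n): P(D)f|_V=0\text{ for some }P\in\mathcal{P}\},$$ where $|_V$ denotes restriction of distributions to $V$ (the polynomial may depend on the component $(\mathrm{d}F)_{ij}$). Oriented lines are parametrized by $\Gamma=\{(z,\theta):\theta\in S^{n-1},\ z\in\theta^\perp\}$, where $(z,\theta)$ corresponds to the line $\{z+s\theta:s\in\mathbb{R}\}$. The X-ray transform of vector fields is $X_1F(z,\theta)=\int_{\mathbb{R}}F(z+s\theta)\cdot\theta\,ds$ for $F\in(C_c^\infty(\mathbb{R}^n))^n$. With $(X_1^*\psi)_i(x)=\int_{S^{n-1}}\theta_i\psi(x-(x\cdot\theta)\theta,\theta)\,d\theta$ for $\psi\in C^\infty(\Gamma)$, it is defined on $F\in(\mathcal{E}'(\mathbb{R}^n))^n$ as $X_1F\in\mathcal{E}'(\Gamma)$ by $\langle X_1F,\varphi\rangle=\langle F,X_1^*\varphi\rangle=\sum_i\langle F_i,(X_1^*\varphi)_i\rangle$ for all $\varphi\in C^\infty(\Gamma)$. "$X_1F=0$ on all lines intersecting $V$" means that the distribution $X_1F$ vanishes on the open subset of $\Gamma$ consisting of the lines meeting $V$, i.e. $\langle X_1F,\varphi\rangle=0$ for all $\varphi\in C_c^\infty(\Gamma)$ supported in that open set. *)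

theory Defs
  imports "HOL-Analysis.Analysis" "HOL-Library.Poly_Mapping"
begin

section \<open>Smooth functions\<close>

primrec iter_deriv ::
  "'a::real_normed_vector list \<Rightarrow> ('a \<Rightarrow> complex) \<Rightarrow> 'a \<Rightarrow> complex" where
  "iter_deriv [] f = f"
| "iter_deriv (v # vs) f = (\<lambda>x. frechet_derivative (iter_deriv vs f) (at x) v)"

definition smooth_on :: "'a::euclidean_space set \<Rightarrow> ('a \<Rightarrow> complex) \<Rightarrow> bool" where
  "smooth_on U f \<longleftrightarrow> open U \<and>
     (\<forall>vs. set vs \<subseteq> Basis \<longrightarrow> (\<forall>x\<in>U. iter_deriv vs f differentiable (at x)))"

abbreviation smooth :: "('a::euclidean_space \<Rightarrow> complex) \<Rightarrow> bool" where
  "smooth \<equiv> smooth_on UNIV"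

text \<open>Smoothness on an arbitrary subset of a Euclidean space: local extendability to a smooth
  function on an ambient neighbourhood. On an embedded submanifold this is the usual notion.\<close>

definition smooth_on_subset :: "'a::euclidean_space set \<Rightarrow> ('a \<Rightarrow> complex) \<Rightarrow> bool" where
  "smooth_on_subset S f \<longleftrightarrow>
     (\<forall>p\<in>S. \<exists>U g. p \<in> U \<and> smooth_on U g \<and> (\<forall>q\<in>S \<inter> U. f q = g q))"

definition partial :: "'n::finite \<Rightarrow> (real^'n \<Rightarrow> complex) \<Rightarrow> real^'n \<Rightarrow> complex" where
  "partial j f x = frechet_derivative f (at x) (axis j 1)"

definition test_function_on :: "'a::euclidean_space set \<Rightarrow> ('a \<Rightarrow> complex) \<Rightarrow> bool" where
  "test_function_on V f \<longleftrightarrow> smooth f \<and>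
     compact (closure (support_on UNIV f)) \<and> closure (support_on UNIV f) \<subseteq> V"

definition smooth_seminorm :: "nat \<Rightarrow> ('a::euclidean_space \<Rightarrow> complex) \<Rightarrow> real" where
  "smooth_seminorm k f =
     (SUP (x, vs)\<in>cball 0 (real k) \<times> {vs. set vs \<subseteq> Basis \<and> length vs \<le> k}.
        norm (iter_deriv vs f x))"

definition schwartz :: "('a::euclidean_space \<Rightarrow> complex) \<Rightarrow> bool" where
  "schwartz f \<longleftrightarrow> smooth f \<and>
     (\<forall>k vs. set vs \<subseteq> Basis \<longrightarrow> bounded (range (\<lambda>x. (1 + norm x) ^ k *\<^sub>R iter_deriv vs f x)))"

definition schwartz_seminorm :: "nat \<Rightarrow> ('a::euclidean_space \<Rightarrow> complex) \<Rightarrow> real" where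
  "schwartz_seminorm k f =
     (SUP (x, vs)\<in>UNIV \<times> {vs. set vs \<subseteq> Basis \<and> length vs \<le> k}.
        (1 + norm x) ^ k * norm (iter_deriv vs f x))"


section \<open>Distributions\<close>

text \<open>A distribution is a functional on a space of smooth functions. It is encoded as a total
  HOL function on all functions; only its values on the relevant test space are meaningful, and
  no definition below refers to any other values. In particular a functional on
  \<open>C\<^sup>\<infinity>\<close> is at the same time a functional on the Schwartz space and on \<open>C\<^sub>c\<^sup>\<infinity>\<close>, so the inclusion
  of compactly supported distributions into tempered distributions is implicit.\<close>

type_synonym 'a functional = "('a \<Rightarrow> complex) \<Rightarrow> complex"

definition linear_functional_on :: "('a \<Rightarrow> complex) set \<Rightarrow> 'a functional \<Rightarrow> bool" where
  "linear_functional_on X u \<longleftrightarrow>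
     (\<forall>f\<in>X. \<forall>g\<in>X. u (\<lambda>x. f x + g x) = u f + u g) \<and>
     (\<forall>c. \<forall>f\<in>X. u (\<lambda>x. c * f x) = c * u f)"

text \<open>The compactly supported distributions \<open>\<E>'\<close>, realised as the continuous dual of the Frechet
  space \<open>\<E> = C\<^sup>\<infinity>\<close>, so that they pair with smooth functions of arbitrary support.\<close>

definition compact_distribution :: "'a::euclidean_space functional \<Rightarrow> bool" where
  "compact_distribution u \<longleftrightarrow> linear_functional_on {f. smooth f} u \<and>
     (\<exists>k C. \<forall>f. smooth f \<longrightarrow> norm (u f) \<le> C * smooth_seminorm k f)"

definition tempered_distribution :: "'a::euclidean_space functional \<Rightarrow> bool" where
  "tempered_distribution u \<longleftrightarrow> linear_functional_on {f. schwartz f} u \<and>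
     (\<exists>k C. \<forall>f. schwartz f \<longrightarrow> norm (u f) \<le> C * schwartz_seminorm k f)"

definition eq_compact_distribution ::
  "'a::euclidean_space functional \<Rightarrow> 'a functional \<Rightarrow> bool" where
  "eq_compact_distribution u v \<longleftrightarrow> (\<forall>f. smooth f \<longrightarrow> u f = v f)"

definition restriction_zero :: "'a::euclidean_space set \<Rightarrow> 'a functional \<Rightarrow> bool" where
  "restriction_zero V u \<longleftrightarrow> (\<forall>f. test_function_on V f \<longrightarrow> u f = 0)"

definition dist_partial :: "'n::finite \<Rightarrow> (real^'n) functional \<Rightarrow> (real^'n) functional" where
  "dist_partial j u = (\<lambda>f. - u (partial j f))"

definition dist_curl ::
  "('n::finite \<Rightarrow> (real^'n) functional) \<Rightarrow> 'n \<Rightarrow> 'n \<Rightarrow> (real^'n) functional" where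
  "dist_curl F i j = (\<lambda>f. dist_partial i (F j) f - dist_partial j (F i) f)"


section \<open>Constant coefficient differential operators\<close>

definition dist_D :: "'n::finite \<Rightarrow> (real^'n) functional \<Rightarrow> (real^'n) functional" where
  "dist_D j u = (\<lambda>f. - \<i> * dist_partial j u f)"

text \<open>The index type carries no order, so the order of the factors in \<open>D\<^sup>\<alpha>\<close> is fixed by an arbitrary
  enumeration of the indices; the factors commute on distributions.\<close>

definition index_list :: "'n::finite list" where
  "index_list = (SOME js. distinct js \<and> set js = UNIV)"

definition dist_D_pow ::
  "('n::finite \<Rightarrow>\<^sub>0 nat) \<Rightarrow> (real^'n) functional \<Rightarrow> (real^'n) functional" where
  "dist_D_pow \<alpha> u = foldr (\<lambda>j. dist_D j ^^ Poly_Mapping.lookup \<alpha> j) index_list u"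

text \<open>Polynomials in the variables \<open>\<xi>\<^sub>j\<close>, \<open>j :: 'n\<close>, are finitely supported maps from multi-indices
  to coefficients.\<close>

type_synonym 'n polynomial = "('n \<Rightarrow>\<^sub>0 nat) \<Rightarrow>\<^sub>0 complex"

definition diff_op ::
  "'n::finite polynomial \<Rightarrow> (real^'n) functional \<Rightarrow> (real^'n) functional" where
  "diff_op P u = (\<lambda>f. \<Sum>\<alpha>\<in>Poly_Mapping.keys P. Poly_Mapping.lookup P \<alpha> * dist_D_pow \<alpha> u f)"


section \<open>Sobolev spaces and admissible functions\<close>

definition fourier :: "('a::euclidean_space \<Rightarrow> complex) \<Rightarrow> 'a \<Rightarrow> complex" where
  "fourier f \<xi> = (LINT x|lborel. exp (- \<i> * of_real (x \<bullet> \<xi>)) * f x)"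

definition dist_fourier :: "'a::euclidean_space functional \<Rightarrow> 'a functional" where
  "dist_fourier u = (\<lambda>f. u (fourier f))"

definition dist_mult :: "('a \<Rightarrow> complex) \<Rightarrow> 'a functional \<Rightarrow> 'a functional" where
  "dist_mult m u = (\<lambda>f. u (\<lambda>x. m x * f x))"

definition dist_in_L2 :: "'a::euclidean_space functional \<Rightarrow> bool" where
  "dist_in_L2 u \<longleftrightarrow>
     (\<exists>g. g \<in> borel_measurable lborel \<and> integrable lborel (\<lambda>x. (norm (g x))\<^sup>2) \<and>
          (\<forall>f. schwartz f \<longrightarrow> u f = (LINT x|lborel. g x * f x)))"

definition sobolev :: "real \<Rightarrow> 'a::euclidean_space functional set" where
  "sobolev r = {u. tempered_distribution u \<and>
     dist_in_L2 (dist_mult (\<lambda>\<xi>. of_real ((1 + (norm \<xi>)\<^sup>2) powr (r / 2))) (dist_fourier u))}"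

definition sobolev_minus_infinity :: "'a::euclidean_space functional set" where
  "sobolev_minus_infinity = (\<Union>r. sobolev r)"

definition admissible :: "(real^'n::finite) set \<Rightarrow> (real^'n) functional set" where
  "admissible V = {u \<in> sobolev_minus_infinity. \<exists>P. P \<noteq> 0 \<and> restriction_zero V (diff_op P u)}"


section \<open>The X-ray transform of vector-valued distributions\<close>

definition lines :: "('a::euclidean_space \<times> 'a) set" where
  "lines = {(z, \<theta>). norm \<theta> = 1 \<and> z \<bullet> \<theta> = 0}"

definition lines_meeting :: "'a::euclidean_space set \<Rightarrow> ('a \<times> 'a) set" where
  "lines_meeting V = {(z, \<theta>) \<in> lines. \<exists>s. z + s *\<^sub>R \<theta> \<in> V}"

text \<open>Surface measure on the unit sphere, via polar coordinates: the measure of \<open>A\<close> is \<open>n\<close> times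
  the Lebesgue measure of the cone \<open>{t \<theta> | 0 < t \<le> 1, \<theta> \<in> A}\<close>. It is a measure on the ambient
  space, carried by the sphere. Integrals against it are restricted to the sphere, because an
  integrand need not be measurable elsewhere.\<close>

definition sphere_measure :: "'a::euclidean_space measure" where
  "sphere_measure = scale_measure (of_nat DIM('a))
     (distr (restrict_space lborel (cball 0 1)) borel (\<lambda>x. x /\<^sub>R norm x))"

definition xray_adjoint ::
  "((real^'n::finite) \<times> (real^'n) \<Rightarrow> complex) \<Rightarrow> 'n \<Rightarrow> real^'n \<Rightarrow> complex" where
  "xray_adjoint \<psi> i x =
     (LINT \<theta>:sphere 0 1|sphere_measure. of_real (\<theta> $ i) * \<psi> (x - (x \<bullet> \<theta>) *\<^sub>R \<theta>, \<theta>))"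

definition xray ::
  "('n::finite \<Rightarrow> (real^'n) functional) \<Rightarrow> ((real^'n) \<times> (real^'n)) functional" where
  "xray F \<psi> = (\<Sum>i\<in>UNIV. F i (xray_adjoint \<psi> i))"

text \<open>Functions on the manifold of lines are represented by functions on the ambient product space,
  whose values off \<open>lines\<close> are ignored. As \<open>lines\<close> is closed, the closure below is also the
  closure relative to \<open>lines\<close>.\<close>

definition xray_vanishes_on_lines_meeting ::
  "('n::finite \<Rightarrow> (real^'n) functional) \<Rightarrow> (real^'n) set \<Rightarrow> bool" where
  "xray_vanishes_on_lines_meeting F V \<longleftrightarrow>
     (\<forall>\<psi>. smooth_on_subset lines \<psi> \<and> compact (closure (support_on lines \<psi>)) \<and>
           closure (support_on lines \<psi>) \<subseteq> lines_meeting V \<longrightarrow> xray F \<psi> = 0)"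

end

theory Submission
  imports Defs
begin

text \<open>The theorem reduces to \<open>dF = 0\<close>: a compactly supported closed one-form is exact with a compactly
supported potential (\<open>compact_distribution_Poincare\<close>). To show that \<open>dF\<close> vanishes, everything
is first made smooth. Fix a ball around a point of \<open>V\<close> and convolve with a test function \<open>\<phi>\<close> whose
support is small compared to that ball. The fields \<open>A\<^sub>i = F\<^sub>i * \<phi>\<close> are smooth and compactly
supported, convolution commutes with derivatives, and on a smaller ball \<open>B\<close> the hypotheses
persist: \<open>P(D) (dA)\<^sub>i\<^sub>j = 0\<close> on \<open>B\<close>, and the integral of \<open>A \<cdot> \<theta>\<close> vanishes along every line through
\<open>B\<close> (\<open>xray_vanishing_pointwise\<close>). A distribution all of whose convolutions with test functions of
small support vanish is itself zero, by a partition of unity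
(\<open>compact_distribution_eq_0_if_conv_eq_0\<close>), so it suffices to prove \<open>dA = 0\<close>.

Differentiating the integral of \<open>A \<cdot> \<theta>\<close> once in the base point and once in the direction, and
antisymmetrising, shows that all scalar functions \<open>(dA)\<^sub>i\<^sub>j\<close> integrate to zero along the lines
through \<open>B\<close> (\<open>curl_line_integral_zero\<close>). So do their derivatives, in particular
\<open>g = P(D) (dA)\<^sub>i\<^sub>j\<close>, which in addition vanishes on \<open>B\<close>.

The heart of the matter is that such a \<open>g\<close> is zero (\<open>line_integrals_determine_function\<close>). Take the
centre of \<open>B\<close> as origin and consider the moments \<open>M\<^sub>k(\<theta>) = \<integral> g(s\<theta>) s\<^sup>-\<^sup>k ds\<close>, which make sense because \<open>g\<close>
vanishes near the origin. \<open>M\<^sub>0 = 0\<close> by assumption. The derivative of \<open>M\<^sub>1\<close> in \<open>\<theta>\<close> consists of the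
moments \<open>M\<^sub>0\<close> of derivatives of \<open>g\<close>, hence \<open>M\<^sub>1\<close> is locally constant; it is odd, and the punctured
space is connected in dimension at least two, so \<open>M\<^sub>1 = 0\<close>. Integration by parts expresses
\<open>(k - 1) M\<^sub>k\<close> through the moments \<open>M\<^sub>k\<^sub>-\<^sub>1\<close> of derivatives of \<open>g\<close>, so all moments vanish.
By the Stone-Weierstrass theorem for polynomials in \<open>1/s\<close>, \<open>g\<close> vanishes on every line through the
origin.

Finally \<open>P(D) f = 0\<close> with \<open>P \<noteq> 0\<close> forces \<open>f = 0\<close> for compactly supported \<open>f\<close>
(\<open>diff_op_fun_injective\<close>): the Laplace transform of \<open>f\<close> is continuous and vanishes where the symbol
of \<open>P\<close> does not, hence everywhere, and exponentials span a dense algebra.\<close>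

section \<open>Smooth functions\<close>

definition dirD :: "'a::euclidean_space \<Rightarrow> ('a \<Rightarrow> complex) \<Rightarrow> 'a \<Rightarrow> complex" where
  "dirD b f = (\<lambda>x. frechet_derivative f (at x) b)"

lemma partial_eq_dirD: "partial j f = dirD (axis j 1) f"
  by (simp add: fun_eq_iff partial_def dirD_def)

lemma iter_deriv_Cons: "iter_deriv (v # vs) f = dirD v (iter_deriv vs f)"
  by (simp add: dirD_def)

declare iter_deriv.simps(2)[simp del] iter_deriv_Cons[simp]

lemma iter_deriv_append:
  fixes f :: "'a::euclidean_space \<Rightarrow> complex"
  shows "iter_deriv (vs @ ws) f = iter_deriv vs (iter_deriv ws f)"
  by (induction vs) auto

lemma smooth_iff:
  "smooth f \<longleftrightarrow> (\<forall>vs. set vs \<subseteq> Basis \<longrightarrow> (\<forall>x. iter_deriv vs f differentiable (at x)))"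
  by (simp add: smooth_on_def)

lemma smooth_differentiable: "smooth f \<Longrightarrow> f differentiable (at x)"
  unfolding smooth_iff by (drule spec[of _ "[]"]) simp

lemma smooth_iter_deriv: "smooth f \<Longrightarrow> set vs \<subseteq> Basis \<Longrightarrow> smooth (iter_deriv vs f)"
  unfolding smooth_iff iter_deriv_append[symmetric] by simp

lemma smooth_dirD: "smooth f \<Longrightarrow> b \<in> Basis \<Longrightarrow> smooth (dirD b f)"
  using smooth_iter_deriv[of f "[b]"] by simp

lemma dirD_eqI: "(f has_derivative f') (at x) \<Longrightarrow> dirD b f x = f' b"
  unfolding dirD_def by (simp add: frechet_derivative_at[symmetric])

lemma smooth_has_derivative:
  fixes f :: "'a::euclidean_space \<Rightarrow> complex"
  assumes "smooth f"
  shows "(f has_derivative (\<lambda>v. \<Sum>b\<in>Basis. (v \<bullet> b) *\<^sub>R dirD b f x)) (at x)"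
proof -
  have D: "(f has_derivative frechet_derivative f (at x)) (at x)"
    using smooth_differentiable[OF assms] frechet_derivative_works by blast
  then interpret bounded_linear "frechet_derivative f (at x)"
    by (rule has_derivative_bounded_linear)
  have "frechet_derivative f (at x) v = (\<Sum>b\<in>Basis. (v \<bullet> b) *\<^sub>R dirD b f x)" for v
    by (subst (1) euclidean_representation[of v, symmetric])
       (simp only: sum scaleR dirD_def)
  then have "frechet_derivative f (at x) = (\<lambda>v. \<Sum>b\<in>Basis. (v \<bullet> b) *\<^sub>R dirD b f x)"
    by blast
  with D show ?thesis
    by simp
qed

lemma smooth_continuous_on: "smooth f \<Longrightarrow> continuous_on S f"
  by (meson differentiable_imp_continuous_within continuous_at_imp_continuous_on smooth_differentiable)

text \<open>\<open>Ck k f\<close> means that \<open>f\<close> is \<open>k\<close> times differentiable. Closure properties of smooth functions are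
proved for \<open>Ck k\<close> by induction on \<open>k\<close>, where a single derivative is peeled off at a time; the words of
basis vectors in \<open>smooth_on\<close> would require a Leibniz formula instead.\<close>

primrec Ck :: "nat \<Rightarrow> ('a::euclidean_space \<Rightarrow> complex) \<Rightarrow> bool" where
  "Ck 0 f = True"
| "Ck (Suc k) f = ((\<forall>x. f differentiable (at x)) \<and> (\<forall>b\<in>Basis. Ck k (dirD b f)))"

lemma smooth_imp_Ck: "smooth f \<Longrightarrow> Ck k f"
  by (induction k arbitrary: f) (auto simp: smooth_differentiable smooth_dirD)

lemma Ck_imp_differentiable_iter:
  "Ck (Suc (length vs)) f \<Longrightarrow> set vs \<subseteq> Basis \<Longrightarrow> iter_deriv vs f differentiable (at x)"
  by (induction vs arbitrary: f rule: rev_induct) (auto simp: iter_deriv_append)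

lemma smooth_iff_Ck: "smooth f \<longleftrightarrow> (\<forall>k. Ck k f)"
  using Ck_imp_differentiable_iter smooth_imp_Ck unfolding smooth_iff by blast

lemma Ck_SucI:
  assumes "\<And>x. (f has_derivative f' x) (at x)" "\<And>b. b \<in> Basis \<Longrightarrow> Ck k (\<lambda>x. f' x b)"
  shows "Ck (Suc k) f"
proof -
  have "dirD b f = (\<lambda>x. f' x b)" for b
    using dirD_eqI[OF assms(1)] by blast
  with assms show ?thesis
    by (auto simp: differentiable_def)
qed

lemma Ck_Suc_D: "Ck (Suc k) f \<Longrightarrow> Ck k f"
  by (induction k arbitrary: f) auto

lemma Ck_SucD:
  assumes "Ck (Suc k) f"
  shows "(f has_derivative (\<lambda>v. frechet_derivative f (at x) v)) (at x)"
    and "b \<in> Basis \<Longrightarrow> Ck k (\<lambda>x. frechet_derivative f (at x) b)"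
  using assms frechet_derivative_works by (auto simp: dirD_def)

lemma Ck_const: "Ck k (\<lambda>x. c)"
proof (induction k arbitrary: c)
  case (Suc k)
  show ?case
    by (rule Ck_SucI) (auto intro!: derivative_eq_intros Suc)
qed simp

lemma Ck_add: "Ck k f \<Longrightarrow> Ck k g \<Longrightarrow> Ck k (\<lambda>x. f x + g x)"
proof (induction k arbitrary: f g)
  case (Suc k)
  show ?case
    by (rule Ck_SucI, rule has_derivative_add[OF Ck_SucD(1)[OF Suc.prems(1)] Ck_SucD(1)[OF Suc.prems(2)]])
       (intro Suc.IH Ck_SucD(2) Suc.prems)
qed simp

lemma Ck_mult: "Ck k f \<Longrightarrow> Ck k g \<Longrightarrow> Ck k (\<lambda>x. f x * g x)"
proof (induction k arbitrary: f g)
  case (Suc k)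
  show ?case
    by (rule Ck_SucI, rule has_derivative_mult[OF Ck_SucD(1)[OF Suc.prems(1)] Ck_SucD(1)[OF Suc.prems(2)]])
       (intro Suc.IH Ck_SucD(2) Suc.prems Ck_add Ck_Suc_D)
qed simp

lemma Ck_sum: "(\<And>i. i \<in> I \<Longrightarrow> Ck k (f i)) \<Longrightarrow> Ck k (\<lambda>x. \<Sum>i\<in>I. f i x)"
  by (induction I rule: infinite_finite_induct) (auto intro: Ck_const Ck_add)

lemma smooth_const: "smooth (\<lambda>x. c)"
  and smooth_add: "smooth f \<Longrightarrow> smooth g \<Longrightarrow> smooth (\<lambda>x. f x + g x)"
  and smooth_mult: "smooth f \<Longrightarrow> smooth g \<Longrightarrow> smooth (\<lambda>x. f x * g x)"
  unfolding smooth_iff_Ck by (auto intro: Ck_const Ck_add Ck_mult)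

lemma smooth_cmult: "smooth f \<Longrightarrow> smooth (\<lambda>x. c * f x)"
  by (intro smooth_mult smooth_const)

lemma smooth_scaleR: "smooth f \<Longrightarrow> smooth (\<lambda>x. r *\<^sub>R f x)"
  unfolding scaleR_conv_of_real by (rule smooth_cmult)

lemma smooth_uminus: "smooth f \<Longrightarrow> smooth (\<lambda>x. - f x)"
  using smooth_cmult[of f "-1"] by simp

lemma smooth_diff: "smooth f \<Longrightarrow> smooth g \<Longrightarrow> smooth (\<lambda>x. f x - g x)"
  using smooth_add[of f "\<lambda>x. - g x"] smooth_uminus[of g] by simp

lemma smooth_sum: "(\<And>i. i \<in> I \<Longrightarrow> smooth (f i)) \<Longrightarrow> smooth (\<lambda>x. \<Sum>i\<in>I. f i x)"
  by (induction I rule: infinite_finite_induct) (auto intro: smooth_const smooth_add)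

lemma smooth_prod: "(\<And>i. i \<in> I \<Longrightarrow> smooth (f i)) \<Longrightarrow> smooth (\<lambda>x. \<Prod>i\<in>I. f i x)"
  by (induction I rule: infinite_finite_induct) (auto intro: smooth_const smooth_mult)

lemma dirD_const: "dirD b (\<lambda>x. c) = (\<lambda>x. 0)"
  by (rule ext, rule dirD_eqI) (auto intro!: derivative_eq_intros)

lemma dirD_add: "smooth f \<Longrightarrow> smooth g \<Longrightarrow> dirD b (\<lambda>x. f x + g x) = (\<lambda>x. dirD b f x + dirD b g x)"
  unfolding dirD_def
  by (rule ext, subst frechet_derivative_at[symmetric, OF has_derivative_add])
     (auto simp: frechet_derivative_works[symmetric] smooth_differentiable)

lemma dirD_cmult: "smooth f \<Longrightarrow> dirD b (\<lambda>x. c * f x) = (\<lambda>x. c * dirD b f x)"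
  unfolding dirD_def
  by (rule ext, subst frechet_derivative_at[symmetric, OF has_derivative_mult_right])
     (auto simp: frechet_derivative_works[symmetric] smooth_differentiable)

lemma dirD_uminus: "smooth f \<Longrightarrow> dirD b (\<lambda>x. - f x) = (\<lambda>x. - dirD b f x)"
  using dirD_cmult[of f b "-1"] by simp

lemma dirD_diff: "smooth f \<Longrightarrow> smooth g \<Longrightarrow> dirD b (\<lambda>x. f x - g x) = (\<lambda>x. dirD b f x - dirD b g x)"
  using dirD_add[of f "\<lambda>x. - g x" b] by (simp add: smooth_uminus dirD_uminus)

lemma dirD_sum:
  "(\<And>i. i \<in> I \<Longrightarrow> smooth (f i)) \<Longrightarrow>
    dirD b (\<lambda>x. \<Sum>i\<in>I. f i x) = (\<lambda>x. \<Sum>i\<in>I. dirD b (f i) x)"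
  by (induction I rule: infinite_finite_induct) (auto simp: dirD_const dirD_add smooth_sum)

lemma dirD_local:
  assumes "open U" "x \<in> U" "\<And>y. y \<in> U \<Longrightarrow> f y = g y"
  shows "dirD b f x = dirD b g x"
proof -
  have "(f has_derivative D) (at x) \<longleftrightarrow> (g has_derivative D) (at x)" for D
    using has_derivative_transform_within_open[OF _ assms(1,2)] assms(3) by metis
  then show ?thesis
    by (simp add: dirD_def frechet_derivative_def)
qed

lemma dirD_eq_0:
  assumes "open U" "x \<in> U" "\<And>y. y \<in> U \<Longrightarrow> f y = 0"
  shows "dirD b f x = 0"
  using dirD_local[OF assms(1,2), of f "\<lambda>_. 0"] assms(3) by (simp add: dirD_const)

lemma iter_deriv_local:
  fixes f :: "'a::euclidean_space \<Rightarrow> complex"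
  assumes "open U" "\<And>y. y \<in> U \<Longrightarrow> f y = g y" "x \<in> U"
  shows "iter_deriv vs f x = iter_deriv vs g x"
  using assms(3)
proof (induction vs arbitrary: x)
  case (Cons v vs)
  then show ?case
    unfolding iter_deriv_Cons by (intro dirD_local[OF assms(1)])
qed (simp add: assms(2))

lemma smooth_local:
  assumes "\<And>R. R > 0 \<Longrightarrow> \<exists>g. smooth g \<and> (\<forall>x\<in>ball 0 R. f x = g x)"
  shows "smooth f"
  unfolding smooth_iff
proof (intro allI impI)
  fix vs :: "'a list" and x :: 'a
  assume vs: "set vs \<subseteq> Basis"
  obtain g where g: "smooth g" "\<forall>x\<in>ball 0 (norm x + 1). f x = g x"
    using assms[of "norm x + 1"] by (auto simp: add_nonneg_pos)
  have "iter_deriv vs f y = iter_deriv vs g y" if "y \<in> ball 0 (norm x + 1)" for y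
    using iter_deriv_local[OF open_ball _ that] g(2) by blast
  moreover have "iter_deriv vs g differentiable (at x)"
    using g(1) vs smooth_iff by blast
  ultimately show "iter_deriv vs f differentiable (at x)"
    unfolding differentiable_def
    using has_derivative_transform_within_open[of "iter_deriv vs g" _ x UNIV "ball 0 (norm x + 1)" "iter_deriv vs f"]
    by (metis centre_in_ball dist_0_norm less_add_one mem_ball open_ball)
qed

lemma smooth_bounded:
  fixes f :: "'a::euclidean_space \<Rightarrow> complex"
  assumes "smooth f"
  obtains K where "K \<ge> 0" "\<And>x. norm x \<le> R \<Longrightarrow> norm (f x) \<le> K"
proof -
  have "compact (f ` cball 0 R)"
    using assms by (intro compact_continuous_image smooth_continuous_on) auto
  then obtain K where "\<And>x. norm x \<le> R \<Longrightarrow> norm (f x) \<le> K"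
    using compact_imp_bounded[of "f ` cball 0 R"] unfolding bounded_iff
    by (metis dist_0_norm image_eqI mem_cball)
  then show ?thesis
    by (intro that[of "max K 0"]) (auto simp: le_max_iff_disj)
qed

lemma smooth_Lipschitz:
  fixes f :: "'a::euclidean_space \<Rightarrow> complex"
  assumes "smooth f"
  obtains K where "K \<ge> 0"
    "\<And>x y. norm x \<le> R \<Longrightarrow> norm y \<le> R \<Longrightarrow> norm (f x - f y) \<le> K * norm (x - y)"
proof -
  have "\<exists>K\<ge>0. \<forall>x. norm x \<le> R \<longrightarrow> norm (dirD b f x) \<le> K" if "b \<in> Basis" for b
    using smooth_bounded[OF smooth_dirD[OF assms that], of R] by metis
  then obtain K where K: "\<And>b. b \<in> Basis \<Longrightarrow> K b \<ge> 0"
    "\<And>b x. b \<in> Basis \<Longrightarrow> norm x \<le> R \<Longrightarrow> norm (dirD b f x) \<le> K b"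
    by metis
  have "norm (f x - f y) \<le> (\<Sum>b\<in>Basis. K b) * norm (x - y)" if "x \<in> cball 0 R" "y \<in> cball 0 R" for x y
  proof (rule differentiable_bound[OF convex_cball _ _ that])
    fix z :: 'a
    assume z: "z \<in> cball 0 R"
    show "(f has_derivative (\<lambda>v. \<Sum>b\<in>Basis. (v \<bullet> b) *\<^sub>R dirD b f z)) (at z within cball 0 R)"
      using smooth_has_derivative[OF assms] has_derivative_at_withinI by blast
    show "onorm (\<lambda>v. \<Sum>b\<in>Basis. (v \<bullet> b) *\<^sub>R dirD b f z) \<le> (\<Sum>b\<in>Basis. K b)"
    proof (rule onorm_le)
      fix v :: 'a
      have "norm (\<Sum>b\<in>Basis. (v \<bullet> b) *\<^sub>R dirD b f z) \<le> (\<Sum>b\<in>Basis. norm v * K b)"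
        using z K Basis_le_norm
        by (intro order.trans[OF norm_sum] sum_mono) (auto intro!: mult_mono)
      then show "norm (\<Sum>b\<in>Basis. (v \<bullet> b) *\<^sub>R dirD b f z) \<le> (\<Sum>b\<in>Basis. K b) * norm v"
        by (simp add: sum_distrib_right sum_distrib_left mult.commute)
    qed
  qed
  then show ?thesis
    by (intro that[of "\<Sum>b\<in>Basis. K b"]) (auto intro: sum_nonneg K(1))
qed

text \<open>The first order Taylor formula with a quadratic remainder that is uniform on balls. All
differentiations under an integral sign or inside a distribution below are instances of this
estimate, combined with \<open>has_derivative_quadratic_bound\<close>.\<close>

lemma smooth_Taylor:
  fixes f :: "'a::euclidean_space \<Rightarrow> complex"
  assumes "smooth f"
  obtains K where "K \<ge> 0"
    "\<And>x y. norm x \<le> R \<Longrightarrow> norm y \<le> R \<Longrightarrow>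
      norm (f y - f x - (\<Sum>b\<in>Basis. ((y - x) \<bullet> b) *\<^sub>R dirD b f x)) \<le> K * (norm (y - x))\<^sup>2"
proof -
  have "\<exists>K\<ge>0. \<forall>x y. norm x \<le> R \<longrightarrow> norm y \<le> R \<longrightarrow> norm (dirD b f x - dirD b f y) \<le> K * norm (x - y)"
    if "b \<in> Basis" for b
    using smooth_Lipschitz[OF smooth_dirD[OF assms that], of R] by metis
  then obtain K where K: "\<And>b. b \<in> Basis \<Longrightarrow> K b \<ge> 0"
    "\<And>b x y. b \<in> Basis \<Longrightarrow> norm x \<le> R \<Longrightarrow> norm y \<le> R \<Longrightarrow> norm (dirD b f x - dirD b f y) \<le> K b * norm (x - y)"
    by metis
  let ?S = "\<Sum>b\<in>Basis. K b"
  have S: "?S \<ge> 0"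
    by (auto intro: sum_nonneg K(1))
  have "norm (f y - f x - (\<Sum>b\<in>Basis. ((y - x) \<bullet> b) *\<^sub>R dirD b f x)) \<le> ?S * (norm (y - x))\<^sup>2"
    if x: "norm x \<le> R" and y: "norm y \<le> R" for x y
  proof -
    have "norm (f y - f x - (\<Sum>b\<in>Basis. ((y - x) \<bullet> b) *\<^sub>R dirD b f x)) \<le> norm (y - x) * (?S * norm (y - x))"
    proof (rule differentiable_bound_linearization[where S = "closed_segment x y" and
            f' = "\<lambda>z v. \<Sum>b\<in>Basis. (v \<bullet> b) *\<^sub>R dirD b f z"])
      show "t \<in> {0..1} \<Longrightarrow> x + t *\<^sub>R (y - x) \<in> closed_segment x y" for t
        by (auto simp: in_segment algebra_simps intro!: exI[of _ t])
      show "(f has_derivative (\<lambda>v. \<Sum>b\<in>Basis. (v \<bullet> b) *\<^sub>R dirD b f z)) (at z within closed_segment x y)" for z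
        using smooth_has_derivative[OF assms] has_derivative_at_withinI by blast
      show "x \<in> closed_segment x y" by simp
      fix z assume z: "z \<in> closed_segment x y"
      then have nz: "norm z \<le> R"
        using x y closed_segment_subset[of x "cball 0 R" y] by (auto simp: subset_iff)
      have zx: "norm (z - x) \<le> norm (y - x)"
        using z segment_bound1 by blast
      show "onorm ((\<lambda>v. \<Sum>b\<in>Basis. (v \<bullet> b) *\<^sub>R dirD b f z) - (\<lambda>v. \<Sum>b\<in>Basis. (v \<bullet> b) *\<^sub>R dirD b f x)) \<le> ?S * norm (y - x)"
      proof (rule onorm_le)
        fix v
        have "norm (((\<lambda>v. \<Sum>b\<in>Basis. (v \<bullet> b) *\<^sub>R dirD b f z) - (\<lambda>v. \<Sum>b\<in>Basis. (v \<bullet> b) *\<^sub>R dirD b f x)) v)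
          = norm (\<Sum>b\<in>Basis. (v \<bullet> b) *\<^sub>R (dirD b f z - dirD b f x))"
          by (simp add: sum_subtractf scaleR_diff_right)
        also have "\<dots> \<le> (\<Sum>b\<in>Basis. norm v * (K b * norm (y - x)))"
          using nz x K(1) order.trans[OF K(2) mult_left_mono[OF zx]] Basis_le_norm
          by (intro order.trans[OF norm_sum] sum_mono) (auto intro!: mult_mono)
        also have "\<dots> = ?S * norm (y - x) * norm v"
          by (simp add: sum_distrib_left sum_distrib_right mult_ac)
        finally show "norm (((\<lambda>v. \<Sum>b\<in>Basis. (v \<bullet> b) *\<^sub>R dirD b f z) - (\<lambda>v. \<Sum>b\<in>Basis. (v \<bullet> b) *\<^sub>R dirD b f x)) v)
          \<le> ?S * norm (y - x) * norm v" .
      qed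
    qed
    then show ?thesis
      by (simp add: power2_eq_square mult_ac)
  qed
  with S show ?thesis
    using that by blast
qed

lemma has_derivative_quadratic_bound:
  fixes f :: "'a::real_normed_vector \<Rightarrow> 'b::real_normed_vector"
  assumes "bounded_linear D"
    and "\<And>h. norm h \<le> 1 \<Longrightarrow> norm (f (x + h) - f x - D h) \<le> K * (norm h)\<^sup>2"
  shows "(f has_derivative D) (at x)"
  unfolding has_derivative_at
proof (intro conjI assms(1))
  show "(\<lambda>h. norm (f (x + h) - f x - D h) / norm h) \<midarrow>0\<rightarrow> 0"
  proof (rule Lim_null_comparison)
    have "norm (norm (f (x + h) - f x - D h) / norm h) \<le> K * norm h" if "norm h \<le> 1" for h
      using assms(2)[OF that] by (cases "h = 0") (auto simp: divide_simps power2_eq_square mult_ac)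
    moreover have "\<forall>\<^sub>F h::'a in at 0. norm h \<le> 1"
      using eventually_at_ball[of 1 "0::'a" UNIV] by (auto elim!: eventually_mono)
    ultimately show "\<forall>\<^sub>F h in at 0. norm (norm (f (x + h) - f x - D h) / norm h) \<le> K * norm h"
      by (auto elim: eventually_mono)
    show "(\<lambda>h::'a. K * norm h) \<midarrow>0\<rightarrow> 0"
      by (intro tendsto_mult_right_zero tendsto_norm_zero tendsto_ident_at)
  qed
qed

section \<open>Integrals over families of affine maps\<close>

text \<open>The data of a parameter integral \<open>y \<mapsto> \<integral> c(t) \<phi>(p(t) + L\<^sub>t y) dt\<close>. Line integrals as functions of the
line, Laplace transforms, primitives along an axis and averages of translates all have this form.
The weight \<open>c\<close> carries any truncation of the domain of integration, which is why \<open>p\<close> and \<open>L\<close> are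
only required to be bounded where \<open>c\<close> does not vanish.\<close>

definition affine_family ::
  "'t measure \<Rightarrow> ('t \<Rightarrow> complex) \<Rightarrow> ('t \<Rightarrow> 'b::euclidean_space) \<Rightarrow> ('t \<Rightarrow> 'a::euclidean_space \<Rightarrow> 'b) \<Rightarrow> bool" where
  "affine_family M c p L \<longleftrightarrow> integrable M c \<and> p \<in> borel_measurable M \<and>
     (\<forall>v. (\<lambda>t. L t v) \<in> borel_measurable M) \<and> (\<forall>t. linear (L t)) \<and>
     (\<exists>P. \<forall>t. c t \<noteq> 0 \<longrightarrow> norm (p t) \<le> P) \<and>
     (\<exists>l. \<forall>t v. c t \<noteq> 0 \<longrightarrow> norm (L t v) \<le> l * norm v)"

lemma borel_measurable_smooth:
  fixes f :: "'b::euclidean_space \<Rightarrow> complex"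
  shows "smooth f \<Longrightarrow> f \<in> borel_measurable borel"
  by (intro borel_measurable_continuous_onI smooth_continuous_on)

lemma affine_family_bounds:
  assumes "affine_family M c p L"
  obtains P l where "P \<ge> 0" "l \<ge> 0" "\<And>t. c t \<noteq> 0 \<Longrightarrow> norm (p t) \<le> P"
    "\<And>t v. c t \<noteq> 0 \<Longrightarrow> norm (L t v) \<le> l * norm v"
proof -
  obtain P l where Pl: "\<And>t. c t \<noteq> 0 \<Longrightarrow> norm (p t) \<le> P"
      "\<And>t v. c t \<noteq> 0 \<Longrightarrow> norm (L t v) \<le> l * norm v"
    using assms unfolding affine_family_def by blast
  show ?thesis
  proof (rule that[of "max P 0" "max l 0"])
    show "norm (L t v) \<le> max l 0 * norm v" if "c t \<noteq> 0" for t v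
      using Pl(2)[OF that, of v] mult_right_mono[of l "max l 0" "norm v"] by simp
  qed (use Pl(1) in \<open>force+\<close>)
qed

lemma affine_family_integrable:
  assumes A: "affine_family M c p L" and \<phi>: "smooth \<phi>"
  shows "integrable M (\<lambda>t. c t * \<phi> (p t + L t y))"
proof -
  obtain P l where Pl: "P \<ge> 0" "l \<ge> 0" "\<And>t. c t \<noteq> 0 \<Longrightarrow> norm (p t) \<le> P"
    "\<And>t v. c t \<noteq> 0 \<Longrightarrow> norm (L t v) \<le> l * norm v"
    using affine_family_bounds[OF A] by blast
  obtain K where K: "K \<ge> 0" "\<And>x. norm x \<le> P + l * norm y \<Longrightarrow> norm (\<phi> x) \<le> K"
    using smooth_bounded[OF \<phi>] by blast
  have [measurable]: "c \<in> borel_measurable M" "p \<in> borel_measurable M" "(\<lambda>t. L t y) \<in> borel_measurable M"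
      "\<phi> \<in> borel_measurable borel"
    using A \<phi> unfolding affine_family_def by (auto intro: borel_measurable_smooth)
  have "integrable M (\<lambda>t. of_real K * c t)"
    using A unfolding affine_family_def by auto
  then show ?thesis
  proof (rule Bochner_Integration.integrable_bound)
    show "AE t in M. norm (c t * \<phi> (p t + L t y)) \<le> norm (of_real K * c t)"
    proof (rule AE_I2)
      fix t
      show "norm (c t * \<phi> (p t + L t y)) \<le> norm (of_real K * c t)"
      proof (cases "c t = 0")
        case False
        then have "norm (p t + L t y) \<le> P + l * norm y"
          using Pl(3,4) norm_triangle_mono by blast
        from K(2)[OF this] K(1) show ?thesis
          by (simp add: norm_mult) (metis mult.commute mult_left_mono norm_ge_zero)
      qed simp
    qed
  qed measurable
qed

text \<open>The partial derivatives of a parameter integral are parameter integrals of the same kind with the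
weights multiplied by a component of \<open>L\<^sub>t v\<close>; so smoothness follows by induction.\<close>

lemma affine_family_weight:
  fixes L :: "'t \<Rightarrow> 'a::euclidean_space \<Rightarrow> 'b::euclidean_space"
  assumes A: "affine_family M c p L" and b': "b' \<in> Basis"
  shows "affine_family M (\<lambda>t. (L t v \<bullet> b') *\<^sub>R c t) p L"
proof -
  obtain P l where Pl: "P \<ge> 0" "l \<ge> 0" "\<And>t. c t \<noteq> 0 \<Longrightarrow> norm (p t) \<le> P"
    "\<And>t v. c t \<noteq> 0 \<Longrightarrow> norm (L t v) \<le> l * norm v"
    using affine_family_bounds[OF A] by blast
  have [measurable]: "c \<in> borel_measurable M" "(\<lambda>t. L t v) \<in> borel_measurable M"
    using A unfolding affine_family_def by auto
  have "integrable M (\<lambda>t. of_real (l * norm v) * c t)"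
    using A unfolding affine_family_def by auto
  then have "integrable M (\<lambda>t. (L t v \<bullet> b') *\<^sub>R c t)"
  proof (rule Bochner_Integration.integrable_bound)
    show "AE t in M. norm ((L t v \<bullet> b') *\<^sub>R c t) \<le> norm (of_real (l * norm v) * c t)"
    proof (rule AE_I2)
      fix t
      show "norm ((L t v \<bullet> b') *\<^sub>R c t) \<le> norm (of_real (l * norm v) * c t)"
      proof (cases "c t = 0")
        case False
        then have "\<bar>L t v \<bullet> b'\<bar> \<le> l * norm v"
          using Pl(4) Basis_le_norm[OF b'] order.trans by blast
        moreover have "l * norm v \<ge> 0"
          using Pl(2) by simp
        ultimately show ?thesis
          by (simp only: norm_mult norm_scaleR norm_of_real abs_of_nonneg mult_right_mono norm_ge_zero)
      qed simp
    qed
  qed measurable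
  moreover have "\<exists>P. \<forall>t. (L t v \<bullet> b') *\<^sub>R c t \<noteq> 0 \<longrightarrow> norm (p t) \<le> P"
    using Pl(3) by auto
  moreover have "\<exists>l. \<forall>t u. (L t v \<bullet> b') *\<^sub>R c t \<noteq> 0 \<longrightarrow> norm (L t u) \<le> l * norm u"
    by (rule exI[of _ l]) (use Pl(4) in auto)
  ultimately show ?thesis
    using A unfolding affine_family_def by auto
qed

lemma affine_family_has_derivative:
  fixes L :: "'t \<Rightarrow> 'a::euclidean_space \<Rightarrow> 'b::euclidean_space"
  assumes A: "affine_family M c p L" and \<phi>: "smooth \<phi>"
  shows "((\<lambda>y. LINT t|M. c t * \<phi> (p t + L t y)) has_derivative
           (\<lambda>v. \<Sum>b\<in>Basis. LINT t|M. ((L t v \<bullet> b) *\<^sub>R c t) * dirD b \<phi> (p t + L t y))) (at y)"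
    (is "(?I has_derivative ?D) _")
proof -
  obtain P l where Pl: "P \<ge> 0" "l \<ge> 0" "\<And>t. c t \<noteq> 0 \<Longrightarrow> norm (p t) \<le> P"
    "\<And>t v. c t \<noteq> 0 \<Longrightarrow> norm (L t v) \<le> l * norm v"
    using affine_family_bounds[OF A] by blast
  define R where "R = P + l * (norm y + 1)"
  obtain K where K: "K \<ge> 0" "\<And>x y. norm x \<le> R \<Longrightarrow> norm y \<le> R \<Longrightarrow>
      norm (\<phi> y - \<phi> x - (\<Sum>b\<in>Basis. ((y - x) \<bullet> b) *\<^sub>R dirD b \<phi> x)) \<le> K * (norm (y - x))\<^sup>2"
    using smooth_Taylor[OF \<phi>] by blast
  have lin: "linear (L t)" for t
    using A unfolding affine_family_def by auto
  have int: "integrable M (\<lambda>t. ((L t v \<bullet> b) *\<^sub>R c t) * dirD b \<phi> (p t + L t y))" if "b \<in> Basis" for v b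
    by (intro affine_family_integrable[OF affine_family_weight[OF A that]] smooth_dirD \<phi> that)
  have c: "integrable M c"
    using A unfolding affine_family_def by auto
  have "linear (\<lambda>v. LINT t|M. ((L t v \<bullet> b) *\<^sub>R c t) * dirD b \<phi> (p t + L t y))" if b: "b \<in> Basis" for b
  proof (rule linearI)
    fix v w :: 'a and r :: real
    show "(LINT t|M. ((L t (v + w) \<bullet> b) *\<^sub>R c t) * dirD b \<phi> (p t + L t y))
      = (LINT t|M. ((L t v \<bullet> b) *\<^sub>R c t) * dirD b \<phi> (p t + L t y))
      + (LINT t|M. ((L t w \<bullet> b) *\<^sub>R c t) * dirD b \<phi> (p t + L t y))"
      by (subst Bochner_Integration.integral_add[symmetric, OF int[OF b] int[OF b]])
         (simp add: linear_add[OF lin] inner_add_left scaleR_add_left distrib_right)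
    show "(LINT t|M. ((L t (r *\<^sub>R v) \<bullet> b) *\<^sub>R c t) * dirD b \<phi> (p t + L t y))
      = r *\<^sub>R (LINT t|M. ((L t v \<bullet> b) *\<^sub>R c t) * dirD b \<phi> (p t + L t y))"
      by (subst integral_scaleR_right[symmetric]) (simp add: linear_scale[OF lin])
  qed
  then have "linear ?D"
    by (intro linear_compose_sum) auto
  then have D: "bounded_linear ?D"
    by (simp add: linear_conv_bounded_linear)
  show ?thesis
  proof (rule has_derivative_quadratic_bound[OF D])
    fix h :: 'a assume h: "norm h \<le> 1"
    have intD: "integrable M (\<lambda>t. \<Sum>b\<in>Basis. ((L t h \<bullet> b) *\<^sub>R c t) * dirD b \<phi> (p t + L t y))"
      by (intro Bochner_Integration.integrable_sum int)
    have "?I (y + h) - ?I y - ?D h = (LINT t|M. c t * \<phi> (p t + L t (y + h)) - c t * \<phi> (p t + L t y)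
        - (\<Sum>b\<in>Basis. ((L t h \<bullet> b) *\<^sub>R c t) * dirD b \<phi> (p t + L t y)))"
      using intD affine_family_integrable[OF A \<phi>] int by simp
    also have "norm \<dots> \<le> (LINT t|M. K * l\<^sup>2 * (norm h)\<^sup>2 * norm (c t))"
    proof (rule order.trans[OF integral_norm_bound integral_mono_AE[OF integrable_norm _ AE_I2]])
      show "integrable M (\<lambda>t. K * l\<^sup>2 * (norm h)\<^sup>2 * norm (c t))"
        using c by simp
      show "integrable M (\<lambda>t. c t * \<phi> (p t + L t (y + h)) - c t * \<phi> (p t + L t y)
        - (\<Sum>b\<in>Basis. ((L t h \<bullet> b) *\<^sub>R c t) * dirD b \<phi> (p t + L t y)))"
        by (intro Bochner_Integration.integrable_diff intD affine_family_integrable[OF A \<phi>])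
      fix t
      show "norm (c t * \<phi> (p t + L t (y + h)) - c t * \<phi> (p t + L t y)
        - (\<Sum>b\<in>Basis. ((L t h \<bullet> b) *\<^sub>R c t) * dirD b \<phi> (p t + L t y))) \<le> K * l\<^sup>2 * (norm h)\<^sup>2 * norm (c t)"
      proof (cases "c t = 0")
        case False
        have 1: "norm (p t + L t z) \<le> R" if "norm z \<le> norm y + 1" for z
        proof -
          have "norm (p t + L t z) \<le> P + l * norm z"
            using Pl(3,4)[OF False] norm_triangle_mono by blast
          also have "\<dots> \<le> R"
            using that Pl(2) by (simp add: R_def mult_left_mono)
          finally show ?thesis .
        qed
        have "norm (y + h) \<le> norm y + 1"
          using h norm_triangle_ineq[of y h] by linarith
        note K' = K(2)[OF 1[of y] 1[OF this]]
        have "c t * \<phi> (p t + L t (y + h)) - c t * \<phi> (p t + L t y)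
          - (\<Sum>b\<in>Basis. ((L t h \<bullet> b) *\<^sub>R c t) * dirD b \<phi> (p t + L t y))
          = c t * (\<phi> (p t + L t (y + h)) - \<phi> (p t + L t y)
              - (\<Sum>b\<in>Basis. (((p t + L t (y + h)) - (p t + L t y)) \<bullet> b) *\<^sub>R dirD b \<phi> (p t + L t y)))"
          by (simp add: linear_add[OF lin] ring_distribs sum_distrib_left)
        also have "norm \<dots> \<le> norm (c t) * (K * (norm (L t h))\<^sup>2)"
          unfolding norm_mult using K' by (intro mult_left_mono) (auto simp: linear_add[OF lin])
        also have "\<dots> \<le> norm (c t) * (K * (l * norm h)\<^sup>2)"
          using Pl(4)[OF False, of h] K(1) by (intro mult_left_mono power_mono) auto
        finally show ?thesis
          by (simp add: power_mult_distrib mult_ac)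
      qed simp
    qed
    also have "\<dots> = K * l\<^sup>2 * (LINT t|M. norm (c t)) * (norm h)\<^sup>2"
      by simp
    finally show "norm (?I (y + h) - ?I y - ?D h) \<le> K * l\<^sup>2 * (LINT t|M. norm (c t)) * (norm h)\<^sup>2" .
  qed
qed

lemma affine_family_Ck:
  "affine_family M c p L \<Longrightarrow> smooth \<phi> \<Longrightarrow> Ck k (\<lambda>y. LINT t|M. c t * \<phi> (p t + L t y))"
proof (induction k arbitrary: c \<phi>)
  case (Suc k)
  show ?case
    by (rule Ck_SucI[OF affine_family_has_derivative[OF Suc.prems]])
       (intro Ck_sum Suc.IH affine_family_weight Suc.prems smooth_dirD)
qed simp

lemma affine_family_smooth:
  "affine_family M c p L \<Longrightarrow> smooth \<phi> \<Longrightarrow> smooth (\<lambda>y. LINT t|M. c t * \<phi> (p t + L t y))"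
  by (simp add: smooth_iff_Ck affine_family_Ck)

lemma affine_family_dirD:
  "affine_family M c p L \<Longrightarrow> smooth \<phi> \<Longrightarrow>
    dirD v (\<lambda>y. LINT t|M. c t * \<phi> (p t + L t y)) y =
    (\<Sum>b\<in>Basis. LINT t|M. ((L t v \<bullet> b) *\<^sub>R c t) * dirD b \<phi> (p t + L t y))"
  by (rule dirD_eqI[OF affine_family_has_derivative])

text \<open>Composition with one affine map is the parameter integral over a one-point measure space.\<close>

lemma affine_family_point:
  fixes L :: "'a::euclidean_space \<Rightarrow> 'b::euclidean_space"
  assumes "linear L"
  shows "affine_family (count_space (UNIV :: unit set)) (\<lambda>_. 1) (\<lambda>_. a) (\<lambda>_. L)"
proof -
  have "\<exists>l. \<forall>v. norm (L v) \<le> l * norm v"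
    using assms linear_conv_bounded_linear bounded_linear.nonneg_bounded by (metis mult.commute)
  then show ?thesis
    using assms unfolding affine_family_def by (auto intro!: integrable_count_space)
qed

lemma smooth_compose_affine:
  fixes L :: "'a::euclidean_space \<Rightarrow> 'b::euclidean_space"
  assumes "linear L" "smooth \<phi>"
  shows "smooth (\<lambda>y. \<phi> (a + L y))"
  using affine_family_smooth[OF affine_family_point[OF assms(1)] assms(2)]
  by (simp add: lebesgue_integral_count_space_finite)

lemma dirD_compose_affine:
  fixes L :: "'a::euclidean_space \<Rightarrow> 'b::euclidean_space"
  assumes "linear L" "smooth \<phi>"
  shows "dirD v (\<lambda>y. \<phi> (a + L y)) y = (\<Sum>b\<in>Basis. (L v \<bullet> b) *\<^sub>R dirD b \<phi> (a + L y))"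
  using affine_family_dirD[OF affine_family_point[OF assms(1)] assms(2)]
  by (simp add: lebesgue_integral_count_space_finite)

lemma sum_Basis_pick:
  fixes f :: "'a::euclidean_space \<Rightarrow> 'c::real_vector"
  assumes "v \<in> Basis"
  shows "(\<Sum>b\<in>Basis. (v \<bullet> b) *\<^sub>R f b) = f v"
  using assms by (simp add: inner_Basis if_distrib[of "\<lambda>r. r *\<^sub>R _"] cong: if_cong)

lemma smooth_reflect:
  fixes \<phi> :: "'a::euclidean_space \<Rightarrow> complex"
  assumes "smooth \<phi>"
  shows "smooth (\<lambda>y. \<phi> (x - y))"
  using smooth_compose_affine[of uminus \<phi> x] assms by (simp add: linear_uminus)

lemma dirD_reflect:
  fixes \<phi> :: "'a::euclidean_space \<Rightarrow> complex"
  assumes "smooth \<phi>" "v \<in> Basis"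
  shows "dirD v (\<lambda>y. \<phi> (x - y)) = (\<lambda>y. - dirD v \<phi> (x - y))"
proof
  fix y
  show "dirD v (\<lambda>y. \<phi> (x - y)) y = - dirD v \<phi> (x - y)"
    using dirD_compose_affine[of uminus \<phi> v x y] assms sum_Basis_pick[of v "\<lambda>b. dirD b \<phi> (x - y)"]
    by (simp add: linear_uminus sum_negf)
qed

lemma smooth_translate:
  fixes \<phi> :: "'a::euclidean_space \<Rightarrow> complex"
  assumes "smooth \<phi>"
  shows "smooth (\<lambda>y. \<phi> (x + y))"
  using smooth_compose_affine[of id \<phi> x] assms by (simp add: linear_id)

lemma dirD_translate:
  fixes \<phi> :: "'a::euclidean_space \<Rightarrow> complex"
  assumes "smooth \<phi>" "v \<in> Basis"
  shows "dirD v (\<lambda>y. \<phi> (x + y)) y = dirD v \<phi> (x + y)"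
  using dirD_compose_affine[of id \<phi> v x y] assms sum_Basis_pick[of v "\<lambda>b. dirD b \<phi> (x + y)"]
  by (simp add: linear_id)

lemma smooth_line_has_vector_derivative:
  fixes \<phi> :: "'a::euclidean_space \<Rightarrow> complex"
  assumes "smooth \<phi>"
  shows "((\<lambda>s. \<phi> (x + s *\<^sub>R v)) has_vector_derivative (\<Sum>b\<in>Basis. (v \<bullet> b) *\<^sub>R dirD b \<phi> (x + s *\<^sub>R v))) (at s within S)"
proof -
  have "((\<lambda>s. x + s *\<^sub>R v) has_derivative (\<lambda>s. s *\<^sub>R v)) (at s within S)"
    by (auto intro!: derivative_eq_intros)
  from diff_chain_within[OF this has_derivative_at_withinI[OF smooth_has_derivative[OF assms]]]
  show ?thesis
    by (simp add: has_vector_derivative_def o_def scaleR_sum_right)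
qed

lemma integrable_indicator_cbox_continuous:
  fixes f :: "real \<Rightarrow> complex"
  assumes "continuous_on {a..b} f"
  shows "integrable lborel (\<lambda>s. indicator {a..b} s * f s)"
proof -
  have "(\<lambda>s. indicator {a..b} s *\<^sub>R f s) = (\<lambda>s. indicator {a..b} s * f s)"
    by (auto simp: indicator_def)
  with borel_integrable_compact[OF compact_Icc assms] show ?thesis
    by simp
qed

lemma integrable_Icc_indicator: "integrable lborel (indicator {a..b} :: real \<Rightarrow> complex)"
  using integrable_indicator_cbox_continuous[of a b "\<lambda>_. 1"] by simp

lemma integral_FTC_complex:
  fixes F :: "real \<Rightarrow> complex"
  assumes "a \<le> b" "\<And>x. a \<le> x \<Longrightarrow> x \<le> b \<Longrightarrow> (F has_vector_derivative f x) (at x within {a..b})"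
    and "continuous_on {a..b} f"
  shows "(LINT x|lborel. indicator {a..b} x * f x) = F b - F a"
proof -
  have "(LINT x|lborel. indicator {a..b} x * f x) = (LINT x|lborel. indicator {a..b} x *\<^sub>R f x)"
    by (intro Bochner_Integration.integral_cong) (auto simp: indicator_def)
  with integral_FTC_Icc[OF assms] show ?thesis by simp
qed

text \<open>Symmetry of second derivatives. The increment of \<open>dirD e f\<close> in the direction \<open>b\<close> is an integral of
\<open>dirD b (dirD e f)\<close> by the fundamental theorem of calculus; it is also an integral of
\<open>dirD e (dirD b f)\<close>, by differentiating under the integral sign the same theorem for \<open>f\<close>. Compare
the integrands at the initial point.\<close>

lemma dirD_commute:
  fixes f :: "'a::euclidean_space \<Rightarrow> complex"
  assumes f: "smooth f" and b: "b \<in> Basis" and e: "e \<in> Basis"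
  shows "dirD b (dirD e f) = dirD e (dirD b f)"
proof
  fix x
  have FTC: "(LINT s|lborel. indicator {0..t} s * dirD b g (y + s *\<^sub>R b)) = g (y + t *\<^sub>R b) - g y"
    if "t \<ge> 0" "smooth g" for t y and g :: "'a \<Rightarrow> complex"
  proof -
    have "continuous_on {0..t} (\<lambda>s. dirD b g (y + s *\<^sub>R b))"
      by (intro continuous_on_compose2[OF smooth_continuous_on[OF smooth_dirD[OF that(2) b], of UNIV]] continuous_intros) auto
    then show ?thesis
      using integral_FTC_complex[of 0 t "\<lambda>s. g (y + s *\<^sub>R b)" "\<lambda>s. dirD b g (y + s *\<^sub>R b)"]
        smooth_line_has_vector_derivative[OF that(2), of y b] that b
      by (simp add: sum_Basis_pick)
  qed
  have A: "affine_family lborel (indicator {0..t}) (\<lambda>s. s *\<^sub>R b) (\<lambda>_ y. y)" for t :: real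
    unfolding affine_family_def
  proof (intro conjI)
    show "\<exists>P. \<forall>s. indicator {0..t} s \<noteq> (0::complex) \<longrightarrow> norm (s *\<^sub>R b) \<le> P"
      using b by (intro exI[of _ t]) (auto simp: indicator_def)
    show "integrable lborel (indicator {0..t} :: real \<Rightarrow> complex)"
      by (rule integrable_Icc_indicator)
  qed (auto simp: linear_ident intro!: exI[of _ 1])
  have key: "dirD e f (x + t *\<^sub>R b) - dirD e f x
      = (LINT s|lborel. indicator {0..t} s * dirD e (dirD b f) (x + s *\<^sub>R b))" if "t \<ge> 0" for t
  proof -
    have "dirD e f (x + t *\<^sub>R b) - dirD e f x = dirD e (\<lambda>y. f (t *\<^sub>R b + y) - f y) x"
      using f e by (simp add: dirD_diff smooth_translate dirD_translate) (simp add: add.commute)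
    also have "(\<lambda>y. f (t *\<^sub>R b + y) - f y) = (\<lambda>y. LINT s|lborel. indicator {0..t} s * dirD b f (s *\<^sub>R b + y))"
      using FTC[OF that f] by (simp add: add.commute)
    also have "dirD e \<dots> x = (\<Sum>b'\<in>Basis. LINT s|lborel. ((e \<bullet> b') *\<^sub>R indicator {0..t} s) * dirD b' (dirD b f) (s *\<^sub>R b + x))"
      by (rule affine_family_dirD[OF A]) (intro smooth_dirD f b)
    also have "\<dots> = (\<Sum>b'\<in>Basis. (e \<bullet> b') *\<^sub>R (LINT s|lborel. indicator {0..t} s * dirD b' (dirD b f) (s *\<^sub>R b + x)))"
      by simp
    finally show ?thesis
      by (simp only: sum_Basis_pick[OF e] add.commute)
  qed
  define G where "G = (\<lambda>y. dirD e (dirD b f) y - dirD b (dirD e f) y)"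
  have G: "smooth G"
    unfolding G_def by (intro smooth_diff smooth_dirD f b e)
  have I0: "(LINT s|lborel. indicator {0..t} s * G (x + s *\<^sub>R b)) = 0" if "t \<ge> 0" for t
  proof -
    have int: "integrable lborel (\<lambda>s. indicator {0..t} s * g (x + s *\<^sub>R b))" if "smooth g" for g
      using affine_family_integrable[OF A that, of t x] by (simp add: add.commute)
    have "(LINT s|lborel. indicator {0..t} s * G (x + s *\<^sub>R b))
      = (LINT s|lborel. indicator {0..t} s * dirD e (dirD b f) (x + s *\<^sub>R b) - indicator {0..t} s * dirD b (dirD e f) (x + s *\<^sub>R b))"
      by (simp add: G_def right_diff_distrib)
    also have "\<dots> = 0"
      using key[OF that] FTC[OF that smooth_dirD[OF f e], of x]
      by (subst Bochner_Integration.integral_diff) (auto intro!: int smooth_dirD f b e)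
    finally show ?thesis .
  qed
  have "G x = 0"
  proof -
    have cont: "continuous_on {0..1} (\<lambda>s. G (x + s *\<^sub>R b))"
      by (intro continuous_on_compose2[OF smooth_continuous_on[OF G, of UNIV]] continuous_intros) auto
    have D: "((\<lambda>t. integral {0..t} (\<lambda>s. G (x + s *\<^sub>R b))) has_vector_derivative G (x + 0 *\<^sub>R b)) (at 0 within {0..1})"
      by (rule integral_has_vector_derivative[OF cont]) simp
    have "integral {0..t} (\<lambda>s. G (x + s *\<^sub>R b)) = 0" if "t \<in> {0..1}" for t
    proof -
      have "set_integrable lborel {0..t} (\<lambda>s. G (x + s *\<^sub>R b))"
        unfolding set_integrable_def using that
        by (intro borel_integrable_compact continuous_on_subset[OF cont]) auto
      from set_borel_integral_eq_integral(2)[OF this] I0[of t] that show ?thesis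
        by (simp add: set_lebesgue_integral_def scaleR_conv_of_real of_real_indicator)
    qed
    then have "((\<lambda>t. 0) has_vector_derivative G (x + 0 *\<^sub>R b)) (at 0 within {0..1::real})"
      by (intro has_vector_derivative_transform[OF _ _ D]) auto
    moreover have "((\<lambda>t. 0) has_vector_derivative (0::complex)) (at 0 within {0..1::real})"
      by (rule has_vector_derivative_const)
    ultimately show ?thesis
      using vector_derivative_unique_within_closed_interval[of 0 1 0 "\<lambda>_. 0::complex"] by simp
  qed
  then show "dirD b (dirD e f) x = dirD e (dirD b f) x"
    by (simp add: G_def)
qed

lemma dirD_iter_deriv_commute:
  fixes f :: "'a::euclidean_space \<Rightarrow> complex"
  assumes "smooth f" "set vs \<subseteq> Basis" "e \<in> Basis"
  shows "iter_deriv vs (dirD e f) = dirD e (iter_deriv vs f)"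
  using assms(2)
  by (induction vs) (auto simp: dirD_commute smooth_iter_deriv assms)

section \<open>Compactly supported distributions\<close>

lemma iter_deriv_cmult:
  fixes f :: "'a::euclidean_space \<Rightarrow> complex"
  assumes "smooth f" "set vs \<subseteq> Basis"
  shows "iter_deriv vs (\<lambda>x. c * f x) = (\<lambda>x. c * iter_deriv vs f x)"
  using assms(2) by (induction vs) (auto simp: dirD_cmult smooth_iter_deriv assms)

lemma iter_deriv_diff:
  fixes f :: "'a::euclidean_space \<Rightarrow> complex"
  assumes "smooth f" "smooth g" "set vs \<subseteq> Basis"
  shows "iter_deriv vs (\<lambda>x. f x - g x) = (\<lambda>x. iter_deriv vs f x - iter_deriv vs g x)"
  using assms(3) by (induction vs) (auto simp: dirD_diff smooth_iter_deriv assms)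

lemma iter_deriv_sum:
  fixes f :: "'i \<Rightarrow> 'a::euclidean_space \<Rightarrow> complex"
  assumes "\<And>i. i \<in> I \<Longrightarrow> smooth (f i)" "set vs \<subseteq> Basis"
  shows "iter_deriv vs (\<lambda>x. \<Sum>i\<in>I. f i x) = (\<lambda>x. \<Sum>i\<in>I. iter_deriv vs (f i) x)"
  using assms(2) by (induction vs) (auto simp: dirD_sum smooth_iter_deriv assms)

lemma iter_deriv_reflect:
  fixes \<phi> :: "'a::euclidean_space \<Rightarrow> complex"
  assumes "smooth \<phi>" "set vs \<subseteq> Basis"
  shows "iter_deriv vs (\<lambda>y. \<phi> (x - y)) = (\<lambda>y. (-1) ^ length vs * iter_deriv vs \<phi> (x - y))"
  using assms(2)
  by (induction vs) (auto simp: dirD_cmult smooth_iter_deriv smooth_reflect assms dirD_reflect)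

abbreviation deriv_words :: "nat \<Rightarrow> 'a::euclidean_space list set" where
  "deriv_words k \<equiv> {vs. set vs \<subseteq> Basis \<and> length vs \<le> k}"

lemma finite_deriv_words: "finite (deriv_words k)"
  by (rule finite_lists_length_le) simp

lemma finite_uniform_constant:
  fixes a :: "'s \<Rightarrow> 'z \<Rightarrow> real"
  assumes "finite S" "\<And>s. s \<in> S \<Longrightarrow> \<exists>K\<ge>0. \<forall>z\<in>Z. a s z \<le> K * b z" and b: "\<And>z. z \<in> Z \<Longrightarrow> b z \<ge> 0"
  shows "\<exists>K\<ge>0. \<forall>s\<in>S. \<forall>z\<in>Z. a s z \<le> K * b z"
  using assms(1,2)
proof (induction S)
  case (insert s S)
  then obtain K L where KL: "K \<ge> 0" "\<forall>s\<in>S. \<forall>z\<in>Z. a s z \<le> K * b z" "L \<ge> 0" "\<forall>z\<in>Z. a s z \<le> L * b z"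
    by (metis insertCI)
  have "K * b z \<le> max K L * b z" "L * b z \<le> max K L * b z" if "z \<in> Z" for z
    using b[OF that] by (auto intro: mult_right_mono)
  then have "\<forall>r\<in>insert s S. \<forall>z\<in>Z. a r z \<le> max K L * b z"
    using KL(2,4) by (metis insertE order.trans)
  with KL show ?case
    by (intro exI[of _ "max K L"]) (auto simp: le_max_iff_disj)
qed auto

text \<open>A distribution sees finitely many derivatives of its argument, so the constants can be chosen
uniformly in the derivative.\<close>

lemma smooth_Taylor_words:
  fixes f :: "'a::euclidean_space \<Rightarrow> complex"
  assumes "smooth f"
  shows "\<exists>K\<ge>0. \<forall>vs x y. set vs \<subseteq> Basis \<longrightarrow> length vs \<le> k \<longrightarrow> norm x \<le> R \<longrightarrow> norm y \<le> R \<longrightarrow>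
      norm (iter_deriv vs f y - iter_deriv vs f x
      - (\<Sum>b\<in>Basis. ((y - x) \<bullet> b) *\<^sub>R dirD b (iter_deriv vs f) x)) \<le> K * (norm (y - x))\<^sup>2"
proof -
  have "\<exists>K\<ge>0. \<forall>vs\<in>deriv_words k. \<forall>z\<in>cball 0 R \<times> cball 0 R.
      norm (iter_deriv vs f (snd z) - iter_deriv vs f (fst z)
      - (\<Sum>b\<in>Basis. ((snd z - fst z) \<bullet> b) *\<^sub>R dirD b (iter_deriv vs f) (fst z))) \<le> K * (norm (snd z - fst z))\<^sup>2"
  proof (rule finite_uniform_constant[OF finite_deriv_words])
    fix vs :: "'a list" assume "vs \<in> deriv_words k"
    then have "smooth (iter_deriv vs f)"
      using assms smooth_iter_deriv by blast
    then obtain K where "K \<ge> 0" "\<And>x y. norm x \<le> R \<Longrightarrow> norm y \<le> R \<Longrightarrow>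
      norm (iter_deriv vs f y - iter_deriv vs f x
      - (\<Sum>b\<in>Basis. ((y - x) \<bullet> b) *\<^sub>R dirD b (iter_deriv vs f) x)) \<le> K * (norm (y - x))\<^sup>2"
      by (rule smooth_Taylor[of "iter_deriv vs f" R]) blast
    then show "\<exists>K\<ge>0. \<forall>z\<in>cball 0 R \<times> cball 0 R.
      norm (iter_deriv vs f (snd z) - iter_deriv vs f (fst z)
      - (\<Sum>b\<in>Basis. ((snd z - fst z) \<bullet> b) *\<^sub>R dirD b (iter_deriv vs f) (fst z))) \<le> K * (norm (snd z - fst z))\<^sup>2"
      by (intro exI[of _ K]) auto
  qed simp
  then obtain K where "K \<ge> 0" "\<forall>vs\<in>deriv_words k. \<forall>z\<in>cball 0 R \<times> cball 0 R.
      norm (iter_deriv vs f (snd z) - iter_deriv vs f (fst z)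
      - (\<Sum>b\<in>Basis. ((snd z - fst z) \<bullet> b) *\<^sub>R dirD b (iter_deriv vs f) (fst z))) \<le> K * (norm (snd z - fst z))\<^sup>2"
    by blast
  then show ?thesis
    by (intro exI[of _ K]) auto
qed

lemma smooth_Lipschitz_words:
  fixes f :: "'a::euclidean_space \<Rightarrow> complex"
  assumes "smooth f"
  shows "\<exists>K\<ge>0. \<forall>vs x y. set vs \<subseteq> Basis \<longrightarrow> length vs \<le> k \<longrightarrow> norm x \<le> R \<longrightarrow> norm y \<le> R \<longrightarrow>
      norm (iter_deriv vs f x - iter_deriv vs f y) \<le> K * norm (x - y)"
proof -
  have "\<exists>K\<ge>0. \<forall>vs\<in>deriv_words k. \<forall>z\<in>cball 0 R \<times> cball 0 R.
      norm (iter_deriv vs f (fst z) - iter_deriv vs f (snd z)) \<le> K * norm (fst z - snd z)"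
  proof (rule finite_uniform_constant[OF finite_deriv_words])
    fix vs :: "'a list" assume "vs \<in> deriv_words k"
    then have "smooth (iter_deriv vs f)"
      using assms smooth_iter_deriv by blast
    then obtain K where "K \<ge> 0" "\<And>x y. norm x \<le> R \<Longrightarrow> norm y \<le> R \<Longrightarrow>
      norm (iter_deriv vs f x - iter_deriv vs f y) \<le> K * norm (x - y)"
      by (rule smooth_Lipschitz[of "iter_deriv vs f" R]) blast
    then show "\<exists>K\<ge>0. \<forall>z\<in>cball 0 R \<times> cball 0 R.
      norm (iter_deriv vs f (fst z) - iter_deriv vs f (snd z)) \<le> K * norm (fst z - snd z)"
      by (intro exI[of _ K]) auto
  qed simp
  then obtain K where "K \<ge> 0" "\<forall>vs\<in>deriv_words k. \<forall>z\<in>cball 0 R \<times> cball 0 R.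
      norm (iter_deriv vs f (fst z) - iter_deriv vs f (snd z)) \<le> K * norm (fst z - snd z)"
    by blast
  then show ?thesis
    by (intro exI[of _ K]) auto
qed

lemma smooth_seminorm_upper:
  fixes f :: "'a::euclidean_space \<Rightarrow> complex"
  assumes f: "smooth f" and x: "norm x \<le> k" and vs: "set vs \<subseteq> Basis" "length vs \<le> k"
  shows "norm (iter_deriv vs f x) \<le> smooth_seminorm k f"
proof -
  have "\<exists>K. \<forall>x. norm x \<le> k \<longrightarrow> norm (iter_deriv vs f x) \<le> K" if "vs \<in> deriv_words k" for vs
    using that smooth_bounded[OF smooth_iter_deriv[OF f, of vs], of k] by auto metis
  then obtain K where K: "\<And>vs x. vs \<in> deriv_words k \<Longrightarrow> norm x \<le> k \<Longrightarrow> norm (iter_deriv vs f x) \<le> K vs"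
    by metis
  have "bdd_above ((\<lambda>(x, vs). norm (iter_deriv vs f x)) ` (cball 0 (real k) \<times> deriv_words k))"
  proof (rule bdd_aboveI2)
    fix z assume "z \<in> cball (0::'a) (real k) \<times> (deriv_words k :: 'a list set)"
    then obtain x vs where z: "z = (x, vs)" "norm x \<le> k" "vs \<in> deriv_words k"
      by auto
    have "norm (iter_deriv vs f x) \<le> K vs"
      using K z by blast
    also have "\<dots> \<le> \<bar>K vs\<bar>" by simp
    also have "\<dots> \<le> (\<Sum>vs\<in>deriv_words k. \<bar>K vs\<bar>)"
      by (rule member_le_sum[OF z(3) _ finite_deriv_words]) simp
    finally show "(case z of (x, vs) \<Rightarrow> norm (iter_deriv vs f x)) \<le> (\<Sum>vs\<in>deriv_words k. \<bar>K vs\<bar>)"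
      by (simp add: z)
  qed
  from cSUP_upper[OF _ this, of "(x, vs)"] show ?thesis
    using x vs by (simp add: smooth_seminorm_def)
qed

lemma smooth_seminorm_least:
  fixes f :: "'a::euclidean_space \<Rightarrow> complex"
  assumes "\<And>x vs. norm x \<le> k \<Longrightarrow> set vs \<subseteq> Basis \<Longrightarrow> length vs \<le> k \<Longrightarrow> norm (iter_deriv vs f x) \<le> B"
  shows "smooth_seminorm k f \<le> B"
  unfolding smooth_seminorm_def
proof (rule cSUP_least)
  have "(0, []) \<in> cball (0::'a) (real k) \<times> (deriv_words k :: 'a list set)" by simp
  then show "cball (0::'a) (real k) \<times> (deriv_words k :: 'a list set) \<noteq> {}" by blast
qed (use assms in auto)

text \<open>Continuity of \<open>u\<close> in a form that is applied by bounding derivatives pointwise, without computing the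
seminorm.\<close>

definition distribution_bound :: "'a::euclidean_space functional \<Rightarrow> nat \<Rightarrow> real \<Rightarrow> bool" where
  "distribution_bound u k C \<longleftrightarrow> C \<ge> 0 \<and>
    (\<forall>f B. smooth f \<longrightarrow> (\<forall>x vs. norm x \<le> real k \<longrightarrow> set vs \<subseteq> Basis \<longrightarrow> length vs \<le> k \<longrightarrow>
       norm (iter_deriv vs f x) \<le> B) \<longrightarrow> norm (u f) \<le> C * B)"

lemma distribution_boundD:
  assumes "distribution_bound u k C" "smooth f"
    and "\<And>x vs. norm x \<le> real k \<Longrightarrow> set vs \<subseteq> Basis \<Longrightarrow> length vs \<le> k \<Longrightarrow> norm (iter_deriv vs f x) \<le> B"
  shows "norm (u f) \<le> C * B"
  using assms unfolding distribution_bound_def by blast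

lemma compact_distribution_estimate:
  fixes u :: "'a::euclidean_space functional"
  assumes "compact_distribution u"
  obtains k C where "distribution_bound u k C"
proof -
  obtain k C where kC: "\<And>f. smooth f \<Longrightarrow> norm (u f) \<le> C * smooth_seminorm k f"
    using assms unfolding compact_distribution_def by blast
  have "norm (u f) \<le> max C 0 * B"
    if f: "smooth f" and B: "\<And>x vs. norm x \<le> real k \<Longrightarrow> set vs \<subseteq> Basis \<Longrightarrow> length vs \<le> k \<Longrightarrow>
       norm (iter_deriv vs f x) \<le> B" for f :: "'a \<Rightarrow> complex" and B
  proof -
    have "norm (iter_deriv [] f 0) \<le> smooth_seminorm k f"
      by (rule smooth_seminorm_upper[OF f]) auto
    then have 0: "smooth_seminorm k f \<ge> 0"
      using norm_ge_zero order.trans by blast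
    have "norm (u f) \<le> max C 0 * smooth_seminorm k f"
      using kC[OF f] mult_right_mono[OF max.cobounded1 0] order.trans by blast
    also have "\<dots> \<le> max C 0 * B"
      by (intro mult_left_mono smooth_seminorm_least B) auto
    finally show ?thesis .
  qed
  then have "distribution_bound u k (max C 0)"
    by (auto simp: distribution_bound_def)
  then show ?thesis
    by (rule that)
qed

lemma
  assumes "compact_distribution u"
  shows compact_distribution_add: "smooth f \<Longrightarrow> smooth g \<Longrightarrow> u (\<lambda>x. f x + g x) = u f + u g"
    and compact_distribution_cmult: "smooth f \<Longrightarrow> u (\<lambda>x. c * f x) = c * u f"
  using assms unfolding compact_distribution_def linear_functional_on_def by auto

lemma compact_distribution_scaleR:
  "compact_distribution u \<Longrightarrow> smooth f \<Longrightarrow> u (\<lambda>x. r *\<^sub>R f x) = r *\<^sub>R u f"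
  unfolding scaleR_conv_of_real by (rule compact_distribution_cmult)

lemma compact_distribution_uminus:
  "compact_distribution u \<Longrightarrow> smooth f \<Longrightarrow> u (\<lambda>x. - f x) = - u f"
  using compact_distribution_cmult[of u f "-1"] by simp

lemma compact_distribution_diff:
  assumes "compact_distribution u" "smooth f" "smooth g"
  shows "u (\<lambda>x. f x - g x) = u f - u g"
  using compact_distribution_add[OF assms(1,2) smooth_uminus[OF assms(3)]]
    compact_distribution_uminus[OF assms(1,3)] by simp

lemma compact_distribution_0: "compact_distribution u \<Longrightarrow> u (\<lambda>x. 0) = 0"
  using compact_distribution_cmult[OF _ smooth_const, of u 0 0] by simp

lemma compact_distribution_sum:
  assumes "compact_distribution u" "\<And>i. i \<in> I \<Longrightarrow> smooth (f i)"
  shows "u (\<lambda>x. \<Sum>i\<in>I. f i x) = (\<Sum>i\<in>I. u (f i))"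
  using assms(2)
  by (induction I rule: infinite_finite_induct)
     (auto simp: compact_distribution_0 compact_distribution_add[OF assms(1)] assms(1) smooth_sum)

text \<open>The continuity estimate involves derivatives on a fixed closed ball only, and functions that agree
on a larger open ball have the same derivatives there. This replaces the notion of support of \<open>u\<close>.\<close>

lemma compact_distribution_local:
  fixes u :: "'a::euclidean_space functional"
  assumes "compact_distribution u"
  obtains R where "R > 0"
    "\<And>f g. smooth f \<Longrightarrow> smooth g \<Longrightarrow> (\<And>x. norm x < R \<Longrightarrow> f x = g x) \<Longrightarrow> u f = u g"
proof -
  obtain k C where kC: "distribution_bound u k C"
    by (rule compact_distribution_estimate[OF assms])
  show ?thesis
  proof (rule that[of "real k + 1"])
    fix f g :: "'a \<Rightarrow> complex"
    assume fg: "smooth f" "smooth g" "\<And>x. norm x < real k + 1 \<Longrightarrow> f x = g x"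
    have "norm (u (\<lambda>x. f x - g x)) \<le> C * 0"
    proof (rule distribution_boundD[OF kC smooth_diff[OF fg(1,2)]])
      fix x :: 'a and vs :: "'a list"
      assume x: "norm x \<le> k" and vs: "set vs \<subseteq> Basis" "length vs \<le> k"
      have "iter_deriv vs f x = iter_deriv vs g x"
        by (rule iter_deriv_local[of "ball 0 (real k + 1)"]) (use fg x in auto)
      with fg vs show "norm (iter_deriv vs (\<lambda>x. f x - g x) x) \<le> 0"
        by (simp add: iter_deriv_diff)
    qed
    then show "u f = u g"
      using compact_distribution_diff[OF assms fg(1,2)] by simp
  qed simp
qed

lemma compact_distribution_dist_partial:
  fixes u :: "(real^'n::finite) functional"
  assumes u: "compact_distribution u"
  shows "compact_distribution (dist_partial j u)"
proof -
  obtain k C where kC: "distribution_bound u k C"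
    by (rule compact_distribution_estimate[OF u])
  have j: "axis j 1 \<in> (Basis :: (real^'n) set)"
    by simp
  have "norm (dist_partial j u f) \<le> C * smooth_seminorm (Suc k) f" if f: "smooth f" for f
    unfolding dist_partial_def norm_minus_cancel partial_eq_dirD
  proof (rule distribution_boundD[OF kC smooth_dirD[OF f j]])
    fix x :: "real^'n" and vs :: "(real^'n) list"
    assume x: "norm x \<le> k" and vs: "set vs \<subseteq> Basis" "length vs \<le> k"
    then show "norm (iter_deriv vs (dirD (axis j 1) f) x) \<le> smooth_seminorm (Suc k) f"
      using smooth_seminorm_upper[OF f, of x "Suc k" "vs @ [axis j 1]"]
      by (simp add: iter_deriv_append)
  qed
  moreover have "linear_functional_on {f. smooth f} (dist_partial j u)"
    unfolding linear_functional_on_def dist_partial_def partial_eq_dirD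
    using u j by (auto simp: dirD_add dirD_cmult compact_distribution_add compact_distribution_cmult smooth_dirD)
  ultimately show ?thesis
    unfolding compact_distribution_def by blast
qed

lemma compact_distribution_linear_combination:
  fixes u v :: "'a::euclidean_space functional"
  assumes u: "compact_distribution u" and v: "compact_distribution v"
  shows "compact_distribution (\<lambda>f. a * u f + b * v f)"
proof -
  obtain k C where kC: "distribution_bound u k C"
    by (rule compact_distribution_estimate[OF u])
  obtain l D where lD: "distribution_bound v l D"
    by (rule compact_distribution_estimate[OF v])
  have "norm (a * u f + b * v f) \<le> (norm a * C + norm b * D) * smooth_seminorm (max k l) f" if f: "smooth f" for f
  proof -
    have "norm (u f) \<le> C * smooth_seminorm (max k l) f" "norm (v f) \<le> D * smooth_seminorm (max k l) f"
      by (intro distribution_boundD[OF kC] distribution_boundD[OF lD] f smooth_seminorm_upper; simp)+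
    then have "norm a * norm (u f) + norm b * norm (v f)
      \<le> norm a * (C * smooth_seminorm (max k l) f) + norm b * (D * smooth_seminorm (max k l) f)"
      by (intro add_mono mult_left_mono) auto
    moreover have "norm (a * u f + b * v f) \<le> norm a * norm (u f) + norm b * norm (v f)"
      by (metis norm_mult norm_triangle_ineq)
    ultimately show ?thesis
      by (simp add: algebra_simps)
  qed
  moreover have "linear_functional_on {f. smooth f} (\<lambda>f. a * u f + b * v f)"
    unfolding linear_functional_on_def
    using u v by (auto simp: compact_distribution_add compact_distribution_cmult algebra_simps)
  ultimately show ?thesis
    unfolding compact_distribution_def by blast
qed

lemma compact_distribution_dist_D:
  "compact_distribution u \<Longrightarrow> compact_distribution (dist_D j u)"
  using compact_distribution_linear_combination[OF compact_distribution_dist_partial compact_distribution_dist_partial,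
      of u u "- \<i>" j 0 j]
  by (simp add: dist_D_def)

lemma compact_distribution_dist_curl:
  "compact_distribution (F i) \<Longrightarrow> compact_distribution (F j) \<Longrightarrow> compact_distribution (dist_curl F i j)"
  using compact_distribution_linear_combination[OF compact_distribution_dist_partial compact_distribution_dist_partial,
      of "F j" "F i" 1 i "-1" j]
  by (simp add: dist_curl_def)

section \<open>Convolution of a distribution with a smooth function\<close>

definition conv :: "'a::euclidean_space functional \<Rightarrow> ('a \<Rightarrow> complex) \<Rightarrow> 'a \<Rightarrow> complex" where
  "conv u \<phi> x = u (\<lambda>y. \<phi> (x - y))"

text \<open>The difference quotients of \<open>x \<mapsto> \<phi>(x - \<cdot>)\<close> converge in every seminorm, with a quadratic error by
Taylor's formula applied to each derivative of \<open>\<phi>\<close>. The symmetry of second derivatives enters here, to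
move the direction of differentiation past the derivatives that occur in the seminorm.\<close>

lemma conv_has_derivative:
  fixes u :: "'a::euclidean_space functional"
  assumes u: "compact_distribution u" and \<phi>: "smooth \<phi>"
  shows "(conv u \<phi> has_derivative (\<lambda>v. \<Sum>b\<in>Basis. (v \<bullet> b) *\<^sub>R conv u (dirD b \<phi>) x)) (at x)"
proof -
  obtain k C where kC: "distribution_bound u k C"
    by (rule compact_distribution_estimate[OF u])
  define R where "R = norm x + 1 + k"
  obtain K where K: "K \<ge> 0"
    "\<And>vs x y. set vs \<subseteq> Basis \<Longrightarrow> length vs \<le> k \<Longrightarrow> norm x \<le> R \<Longrightarrow> norm y \<le> R \<Longrightarrow> norm (iter_deriv vs \<phi> y - iter_deriv vs \<phi> x
      - (\<Sum>b\<in>Basis. ((y - x) \<bullet> b) *\<^sub>R dirD b (iter_deriv vs \<phi>) x)) \<le> K * (norm (y - x))\<^sup>2"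
    using smooth_Taylor_words[OF \<phi>, of k R] by blast
  show ?thesis
  proof (rule has_derivative_quadratic_bound)
    show "bounded_linear (\<lambda>v. \<Sum>b\<in>Basis. (v \<bullet> b) *\<^sub>R conv u (dirD b \<phi>) x)"
      by (intro bounded_linear_sum bounded_linear_scaleR_const bounded_linear_inner_left)
    fix h :: 'a assume h: "norm h \<le> 1"
    let ?f = "\<lambda>y. \<phi> (x + h - y) - \<phi> (x - y) - (\<Sum>b\<in>Basis. (h \<bullet> b) *\<^sub>R dirD b \<phi> (x - y))"
    have sm: "smooth (\<lambda>y. \<Sum>b\<in>Basis. (h \<bullet> b) *\<^sub>R dirD b \<phi> (x - y))"
      by (intro smooth_sum smooth_scaleR smooth_reflect smooth_dirD \<phi>)
    have eq: "conv u \<phi> (x + h) - conv u \<phi> x - (\<Sum>b\<in>Basis. (h \<bullet> b) *\<^sub>R conv u (dirD b \<phi>) x) = u ?f"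
      by (simp add: conv_def compact_distribution_diff[OF u] compact_distribution_sum[OF u]
          compact_distribution_scaleR[OF u] smooth_diff smooth_reflect \<phi> smooth_scaleR smooth_dirD sm)
    have "norm (u ?f) \<le> C * (K * (norm h)\<^sup>2)"
    proof (rule distribution_boundD[OF kC])
      show "smooth ?f"
        by (intro smooth_diff sm smooth_reflect \<phi>)
      fix y :: 'a and vs :: "'a list"
      assume y: "norm y \<le> k" and vs: "set vs \<subseteq> Basis" "length vs \<le> k"
      have eq: "iter_deriv vs ?f y = (-1) ^ length vs * (iter_deriv vs \<phi> (x + h - y) - iter_deriv vs \<phi> (x - y)
         - (\<Sum>b\<in>Basis. (h \<bullet> b) *\<^sub>R dirD b (iter_deriv vs \<phi>) (x - y)))"
        using vs
        by (simp add: iter_deriv_diff iter_deriv_sum iter_deriv_cmult iter_deriv_reflect smooth_diff smooth_cmult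
            smooth_reflect \<phi> smooth_dirD sm[unfolded scaleR_conv_of_real] dirD_iter_deriv_commute scaleR_conv_of_real
            right_diff_distrib sum_distrib_left mult.left_commute)
      have "norm (iter_deriv vs ?f y) = norm (iter_deriv vs \<phi> (x + h - y) - iter_deriv vs \<phi> (x - y)
         - (\<Sum>b\<in>Basis. (((x + h - y) - (x - y)) \<bullet> b) *\<^sub>R dirD b (iter_deriv vs \<phi>) (x - y)))"
        unfolding eq by (simp add: norm_mult norm_power)
      also have "\<dots> \<le> K * (norm ((x + h - y) - (x - y)))\<^sup>2"
      proof (rule K(2)[OF vs])
        show "norm (x - y) \<le> R"
          using norm_triangle_ineq4[of x y] y by (simp add: R_def)
        show "norm (x + h - y) \<le> R"
          using norm_triangle_ineq4[of "x + h" y] norm_triangle_ineq[of x h] y h by (simp add: R_def)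
      qed
      finally show "norm (iter_deriv vs ?f y) \<le> K * (norm h)\<^sup>2" by simp
    qed
    then show "norm (conv u \<phi> (x + h) - conv u \<phi> x - (\<Sum>b\<in>Basis. (h \<bullet> b) *\<^sub>R conv u (dirD b \<phi>) x))
      \<le> (C * K) * (norm h)\<^sup>2"
      unfolding eq by (simp add: mult_ac)
  qed
qed

lemma dirD_conv:
  assumes "compact_distribution u" "smooth \<phi>" "v \<in> Basis"
  shows "dirD v (conv u \<phi>) = conv u (dirD v \<phi>)"
  by (rule ext) (simp add: dirD_eqI[OF conv_has_derivative[OF assms(1,2)]] sum_Basis_pick assms(3))

lemma smooth_conv:
  assumes u: "compact_distribution u" and \<phi>: "smooth \<phi>"
  shows "smooth (conv u \<phi>)"
proof -
  have "Ck k (conv u \<phi>)" for k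
    using \<phi>
  proof (induction k arbitrary: \<phi>)
    case (Suc k)
    show ?case
      unfolding Ck.simps using conv_has_derivative[OF u Suc.prems]
      by (auto simp: differentiable_def dirD_conv[OF u Suc.prems] Suc.IH smooth_dirD Suc.prems)
  qed simp
  then show ?thesis
    by (simp add: smooth_iff_Ck)
qed

lemma conv_dist_partial:
  assumes u: "compact_distribution u" and \<phi>: "smooth \<phi>"
  shows "conv (dist_partial j u) \<phi> = partial j (conv u \<phi>)"
  unfolding partial_eq_dirD
  by (subst dirD_conv[OF u \<phi>])
     (auto simp: conv_def dist_partial_def fun_eq_iff partial_eq_dirD dirD_reflect \<phi>
       compact_distribution_uminus[OF u] smooth_reflect smooth_dirD)

lemma conv_eq_0_far:
  fixes u :: "'a::euclidean_space functional"
  assumes u: "compact_distribution u"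
  obtains R where "R > 0" "\<And>\<phi> x. smooth \<phi> \<Longrightarrow> (\<And>y. norm y > \<epsilon> \<Longrightarrow> \<phi> y = 0) \<Longrightarrow> norm x \<ge> R + \<epsilon> \<Longrightarrow> conv u \<phi> x = 0"
proof -
  obtain R where R: "R > 0"
    "\<And>f g. smooth f \<Longrightarrow> smooth g \<Longrightarrow> (\<And>x. norm x < R \<Longrightarrow> f x = g x) \<Longrightarrow> u f = u g"
    using compact_distribution_local[OF u] by metis
  have "conv u \<phi> x = 0" if "smooth \<phi>" "\<And>y. norm y > \<epsilon> \<Longrightarrow> \<phi> y = 0" "norm x \<ge> R + \<epsilon>" for \<phi> x
  proof -
    have "u (\<lambda>y. \<phi> (x - y)) = u (\<lambda>y. 0)"
    proof (rule R(2)[OF smooth_reflect[OF that(1)] smooth_const that(2)])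
      fix y :: 'a assume "norm y < R"
      with that(3) norm_triangle_ineq2[of x y] show "norm (x - y) > \<epsilon>"
        by linarith
    qed
    then show ?thesis
      by (simp add: conv_def compact_distribution_0[OF u])
  qed
  with R(1) show ?thesis
    using that by blast
qed

lemma conv_family_support:
  fixes F :: "'n::finite \<Rightarrow> 'a::euclidean_space functional"
  assumes F: "\<And>i. compact_distribution (F i)" and \<phi>: "smooth \<phi>" "\<And>y. norm y > \<epsilon> \<Longrightarrow> \<phi> y = 0"
  shows "\<exists>R\<ge>0. \<forall>i x. norm x > R \<longrightarrow> conv (F i) \<phi> x = 0"
proof -
  have "\<exists>R>0. \<forall>x. norm x \<ge> R + \<epsilon> \<longrightarrow> conv (F i) \<phi> x = 0" for i
    by (rule conv_eq_0_far[OF F[of i], of \<epsilon>]) (use \<phi> in blast)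
  then obtain R0 where R0: "\<And>i. R0 i > 0" "\<And>i x. norm x \<ge> R0 i + \<epsilon> \<Longrightarrow> conv (F i) \<phi> x = 0"
    by metis
  have le: "R0 i \<le> (\<Sum>i\<in>UNIV. R0 i)" for i
    using R0(1) by (intro member_le_sum) (auto intro: less_imp_le)
  show ?thesis
  proof (intro exI[of _ "(\<Sum>i\<in>UNIV. R0 i) + \<bar>\<epsilon>\<bar>"] conjI allI impI)
    show "(\<Sum>i\<in>UNIV. R0 i) + \<bar>\<epsilon>\<bar> \<ge> 0"
      using R0(1) by (intro add_nonneg_nonneg sum_nonneg) (auto intro: less_imp_le)
    show "conv (F i) \<phi> x = 0" if "norm x > (\<Sum>i\<in>UNIV. R0 i) + \<bar>\<epsilon>\<bar>" for i x
      by (rule R0(2)[of i]) (use le[of i] that in linarith)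
  qed
qed

text \<open>For the next three lemmas: \<open>\<integral> c(t) \<phi>(p(t) - y) dt\<close> is the convolution of \<open>\<phi>\<close> with the reflected image under \<open>p\<close> of
the complex measure with density \<open>c\<close>.\<close>

lemma iter_deriv_integral_reflect:
  fixes \<phi> :: "'a::euclidean_space \<Rightarrow> complex"
  assumes A: "affine_family M c p (\<lambda>_. uminus)" and "smooth \<phi>" "set vs \<subseteq> Basis"
  shows "iter_deriv vs (\<lambda>y. LINT t|M. c t * \<phi> (p t - y))
     = (\<lambda>y. (-1) ^ length vs * (LINT t|M. c t * iter_deriv vs \<phi> (p t - y)))"
  using assms(3)
proof (induction vs)
  case (Cons v vs)
  then have v: "v \<in> Basis" and sm: "smooth (iter_deriv vs \<phi>)"
    using assms(2) smooth_iter_deriv by auto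
  have "dirD v (\<lambda>y. LINT t|M. c t * \<psi> (p t - y)) y = - (LINT t|M. c t * dirD v \<psi> (p t - y))"
    if \<psi>: "smooth \<psi>" for \<psi> y
  proof -
    have "dirD v (\<lambda>y. LINT t|M. c t * \<psi> (p t - y)) y
      = (\<Sum>b\<in>Basis. LINT t|M. ((- v \<bullet> b) *\<^sub>R c t) * dirD b \<psi> (p t - y))"
      using affine_family_dirD[OF A \<psi>, of v y] by simp
    also have "\<dots> = (\<Sum>b\<in>Basis. (v \<bullet> b) *\<^sub>R - (LINT t|M. c t * dirD b \<psi> (p t - y)))"
      by (simp add: sum_negf)
    finally show ?thesis
      by (simp only: sum_Basis_pick[OF v])
  qed
  moreover have "smooth (\<lambda>y. LINT t|M. c t * iter_deriv vs \<phi> (p t - y))"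
    using affine_family_smooth[OF A sm] by simp
  ultimately show ?case
    using Cons sm by (simp add: dirD_cmult)
qed simp

lemma integral_simple_function_fibres:
  fixes c :: "'t \<Rightarrow> complex" and G :: "'b \<Rightarrow> complex"
  assumes s: "simple_function M s" and c: "integrable M c"
  shows "(LINT t|M. c t * G (s t)) = (\<Sum>a\<in>s ` space M. (LINT t|M. indicator (s -` {a} \<inter> space M) t * c t) * G a)"
proof -
  have fin: "finite (s ` space M)" and meas: "\<And>a. s -` {a} \<inter> space M \<in> sets M"
    using simple_functionD[OF s] by auto
  have int: "integrable M (\<lambda>t. indicator (s -` {a} \<inter> space M) t * c t)" for a
    using integrable_mult_indicator[OF meas c, of a]
    by (simp add: scaleR_conv_of_real of_real_indicator)
  have "(LINT t|M. c t * G (s t)) = (LINT t|M. (\<Sum>a\<in>s ` space M. (indicator (s -` {a} \<inter> space M) t * c t) * G a))"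
  proof (rule Bochner_Integration.integral_cong)
    fix t assume t: "t \<in> space M"
    have "(\<Sum>a\<in>s ` space M. (indicator (s -` {a} \<inter> space M) t * c t) * G a)
       = (\<Sum>a\<in>s ` space M. if a = s t then c t * G (s t) else 0)"
      using t by (intro sum.cong) (auto simp: indicator_def)
    also have "\<dots> = c t * G (s t)"
      using fin t by simp
    finally show "c t * G (s t) = (\<Sum>a\<in>s ` space M. (indicator (s -` {a} \<inter> space M) t * c t) * G a)" ..
  qed simp
  also have "\<dots> = (\<Sum>a\<in>s ` space M. (LINT t|M. indicator (s -` {a} \<inter> space M) t * c t) * G a)"
    using int by simp
  finally show ?thesis .
qed

text \<open>A distribution may be applied under the integral sign. For a simple function in place of \<open>p\<close> the
integral is a finite sum and this is linearity. In general approximate \<open>p\<close> by simple functions: as the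
derivatives of \<open>\<phi>\<close> are Lipschitz continuous on balls, the two sides converge by dominated convergence.\<close>

lemma compact_distribution_integral:
  fixes u :: "'a::euclidean_space functional"
  assumes u: "compact_distribution u" and \<phi>: "smooth \<phi>"
    and A: "affine_family M c p (\<lambda>_. uminus)"
  shows "u (\<lambda>y. LINT t|M. c t * \<phi> (p t - y)) = (LINT t|M. c t * conv u \<phi> (p t))"
proof -
  obtain k C where kC: "distribution_bound u k C"
    by (rule compact_distribution_estimate[OF u])
  have "\<exists>P. \<forall>t. c t \<noteq> 0 \<longrightarrow> norm (p t) \<le> P"
    using A unfolding affine_family_def by simp
  then obtain P0 where "\<forall>t. c t \<noteq> 0 \<longrightarrow> norm (p t) \<le> P0" ..
  then obtain P where P: "P \<ge> 0" "\<And>t. c t \<noteq> 0 \<Longrightarrow> norm (p t) \<le> P"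
    by (intro that[of "max P0 0"]) (auto simp: le_max_iff_disj)
  have c: "integrable M c" and p[measurable]: "p \<in> borel_measurable M" and [measurable]: "c \<in> borel_measurable M"
    using A unfolding affine_family_def by auto
  obtain s where s: "\<And>n. simple_function M (s n)" "\<And>t. t \<in> space M \<Longrightarrow> (\<lambda>n. s n t) \<longlonglongrightarrow> p t"
    "\<And>n t. t \<in> space M \<Longrightarrow> norm (s n t) \<le> 2 * norm (p t)"
    using borel_measurable_implies_sequence_metric[OF p, of 0] unfolding dist_0_norm dist_norm diff_0_right by metis
  have [measurable]: "s n \<in> borel_measurable M" for n
    using s(1) borel_measurable_simple_function by blast
  define c' where "c' = (\<lambda>t. if t \<in> space M then c t else 0)"
  have As: "affine_family M c' (s n) (\<lambda>_. uminus)" for n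
    unfolding affine_family_def
  proof (intro conjI)
    show "integrable M c'"
      using c by (subst Bochner_Integration.integrable_cong[of M M c' c]) (auto simp: c'_def)
    show "\<exists>P. \<forall>t. c' t \<noteq> 0 \<longrightarrow> norm (s n t) \<le> P"
    proof (intro exI[of _ "2 * P"] allI impI)
      fix t assume "c' t \<noteq> 0"
      then have "t \<in> space M" "c t \<noteq> 0"
        by (auto simp: c'_def split: if_splits)
      with s(3)[of t n] P(2)[of t] show "norm (s n t) \<le> 2 * P"
        by linarith
    qed
  qed (auto simp: linear_uminus intro: exI[of _ 1])
  have Ac: "affine_family M c' p (\<lambda>_. uminus)"
    using A As[of 0] P(2) unfolding affine_family_def by (auto simp: c'_def)
  have cc: "(LINT t|M. c t * g t) = (LINT t|M. c' t * g t)" for g :: "_ \<Rightarrow> complex"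
    by (intro Bochner_Integration.integral_cong) (auto simp: c'_def)
  define e where "e n = (LINT t|M. norm (c' t) * norm (s n t - p t))" for n
  have c'int: "integrable M c'"
    using Ac unfolding affine_family_def by auto
  have c'm[measurable]: "c' \<in> borel_measurable M"
    using c'int by auto
  have bnd: "norm (c' t) * norm (s n t - p t) \<le> norm (c' t) * (3 * P)" for n t
  proof (cases "c' t = 0")
    case False
    then have "t \<in> space M" "c t \<noteq> 0"
      by (auto simp: c'_def split: if_splits)
    then have "norm (s n t - p t) \<le> 3 * P"
      using norm_triangle_ineq4[of "s n t" "p t"] s(3)[of t n] P(2)[of t] by linarith
    then show ?thesis by (simp add: mult_left_mono)
  qed simp
  have eint: "integrable M (\<lambda>t. norm (c' t) * norm (s n t - p t))" for n
  proof (rule Bochner_Integration.integrable_bound[of M "\<lambda>t. norm (c' t) * (3 * P)"])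
    show "integrable M (\<lambda>t. norm (c' t) * (3 * P))"
      using c'int by simp
    show "AE t in M. norm (norm (c' t) * norm (s n t - p t)) \<le> norm (norm (c' t) * (3 * P))"
      using bnd P(1) by (intro AE_I2) simp
  qed measurable
  have e0: "e \<longlonglongrightarrow> (LINT t|M. 0)"
    unfolding e_def
  proof (rule integral_dominated_convergence[where w = "\<lambda>t. norm (c' t) * (3 * P)"])
    show "integrable M (\<lambda>t. norm (c' t) * (3 * P))"
      using c'int by simp
    show "AE t in M. (\<lambda>n. norm (c' t) * norm (s n t - p t)) \<longlonglongrightarrow> 0"
      using s(2) by (intro AE_I2 tendsto_mult_right_zero tendsto_norm_zero) (simp add: LIM_zero)
    show "AE t in M. norm (norm (c' t) * norm (s n t - p t)) \<le> norm (c' t) * (3 * P)" for n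
      using bnd by (intro AE_I2) simp
  qed measurable
  obtain K where K: "K \<ge> 0"
    "\<And>vs x y. set vs \<subseteq> Basis \<Longrightarrow> length vs \<le> k \<Longrightarrow> norm x \<le> 2 * P + k \<Longrightarrow> norm y \<le> 2 * P + k \<Longrightarrow>
      norm (iter_deriv vs \<phi> x - iter_deriv vs \<phi> y) \<le> K * norm (x - y)"
    using smooth_Lipschitz_words[OF \<phi>, of k "2 * P + k"] by blast
  let ?I = "\<lambda>p y. LINT t|M. c' t * \<phi> (p t - y)"
  have smI: "smooth (?I p)" "smooth (?I (s n))" for n
    using affine_family_smooth[OF Ac \<phi>] affine_family_smooth[OF As \<phi>] by simp_all
  have est: "norm (u (?I (s n)) - u (?I p)) \<le> C * (K * e n)" for n
    unfolding compact_distribution_diff[OF u smI(2,1), symmetric]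
  proof (rule distribution_boundD[OF kC smooth_diff[OF smI(2,1)]])
    fix y :: 'a and vs :: "'a list"
    assume y: "norm y \<le> k" and vs: "set vs \<subseteq> Basis" "length vs \<le> k"
    have sm: "smooth (iter_deriv vs \<phi>)"
      using \<phi> vs smooth_iter_deriv by blast
    have int: "integrable M (\<lambda>t. c' t * iter_deriv vs \<phi> (s n t - y))" "integrable M (\<lambda>t. c' t * iter_deriv vs \<phi> (p t - y))"
      using affine_family_integrable[OF As sm, of _ y] affine_family_integrable[OF Ac sm, of y] by simp_all
    have eq: "iter_deriv vs (\<lambda>y. ?I (s n) y - ?I p y) y =
        (-1) ^ length vs * ((LINT t|M. c' t * iter_deriv vs \<phi> (s n t - y)) - (LINT t|M. c' t * iter_deriv vs \<phi> (p t - y)))"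
      using vs smI by (simp add: iter_deriv_diff iter_deriv_integral_reflect[OF As \<phi>] iter_deriv_integral_reflect[OF Ac \<phi>]
          right_diff_distrib)
    have "norm (iter_deriv vs (\<lambda>y. ?I (s n) y - ?I p y) y) = norm (LINT t|M. c' t * iter_deriv vs \<phi> (s n t - y) - c' t * iter_deriv vs \<phi> (p t - y))"
      unfolding eq using int by (simp add: norm_mult norm_power)
    also have "\<dots> \<le> (LINT t|M. K * (norm (c' t) * norm (s n t - p t)))"
    proof (rule order.trans[OF integral_norm_bound integral_mono_AE[OF integrable_norm _ AE_I2]])
      show "integrable M (\<lambda>t. c' t * iter_deriv vs \<phi> (s n t - y) - c' t * iter_deriv vs \<phi> (p t - y))"
        using int by simp
      show "integrable M (\<lambda>t. K * (norm (c' t) * norm (s n t - p t)))"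
        using eint by simp
      fix t assume t: "t \<in> space M"
      show "norm (c' t * iter_deriv vs \<phi> (s n t - y) - c' t * iter_deriv vs \<phi> (p t - y))
        \<le> K * (norm (c' t) * norm (s n t - p t))"
      proof (cases "c' t = 0")
        case False
        then have "c t \<noteq> 0"
          by (auto simp: c'_def split: if_splits)
        have "norm (s n t - y) \<le> 2 * P + k" "norm (p t - y) \<le> 2 * P + k"
          using norm_triangle_ineq4[of "s n t" y] norm_triangle_ineq4[of "p t" y] s(3)[OF t, of n] P(2)[OF \<open>c t \<noteq> 0\<close>] y P(1)
          by linarith+
        then have "norm (iter_deriv vs \<phi> (s n t - y) - iter_deriv vs \<phi> (p t - y)) \<le> K * norm (s n t - p t)"
          using K(2)[OF vs, of "s n t - y" "p t - y"] by simp
        then have "norm (c' t) * norm (iter_deriv vs \<phi> (s n t - y) - iter_deriv vs \<phi> (p t - y))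
          \<le> norm (c' t) * (K * norm (s n t - p t))"
          by (simp add: mult_left_mono)
        then show ?thesis
          by (simp only: right_diff_distrib[symmetric] norm_mult mult.left_commute)
      qed simp
    qed
    also have "\<dots> = K * e n"
      by (simp add: e_def)
    finally show "norm (iter_deriv vs (\<lambda>y. ?I (s n) y - ?I p y) y) \<le> K * e n" .
  qed
  have "(\<lambda>n. u (?I (s n)) - u (?I p)) \<longlonglongrightarrow> 0"
  proof (rule Lim_null_comparison)
    show "\<forall>\<^sub>F n in sequentially. norm (u (?I (s n)) - u (?I p)) \<le> C * (K * e n)"
      using est by simp
    show "(\<lambda>n. C * (K * e n)) \<longlonglongrightarrow> 0"
      using e0 by (intro tendsto_mult_right_zero) simp
  qed
  then have L1: "(\<lambda>n. u (?I (s n))) \<longlonglongrightarrow> u (?I p)"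
    by (simp add: LIM_zero_iff)
  have simple: "u (?I (s n)) = (LINT t|M. c' t * conv u \<phi> (s n t))" for n
  proof -
    have "?I (s n) = (\<lambda>y. \<Sum>a\<in>s n ` space M. (LINT t|M. indicator (s n -` {a} \<inter> space M) t * c' t) * \<phi> (a - y))"
      by (rule ext) (rule integral_simple_function_fibres[OF s(1) c'int])
    then have "u (?I (s n)) = (\<Sum>a\<in>s n ` space M. (LINT t|M. indicator (s n -` {a} \<inter> space M) t * c' t) * conv u \<phi> a)"
      by (simp add: compact_distribution_sum[OF u] compact_distribution_cmult[OF u] smooth_cmult smooth_reflect \<phi> conv_def)
    also have "\<dots> = (LINT t|M. c' t * conv u \<phi> (s n t))"
      by (rule integral_simple_function_fibres[OF s(1) c'int, symmetric])
    finally show ?thesis .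
  qed
  have smc: "smooth (conv u \<phi>)"
    by (rule smooth_conv[OF u \<phi>])
  obtain B where B: "B \<ge> 0" "\<And>x. norm x \<le> 2 * P \<Longrightarrow> norm (conv u \<phi> x) \<le> B"
    using smooth_bounded[OF smc] by metis
  have [measurable]: "conv u \<phi> \<in> borel_measurable borel"
    by (rule borel_measurable_smooth[OF smc])
  have "(\<lambda>n. LINT t|M. c' t * conv u \<phi> (s n t)) \<longlonglongrightarrow> (LINT t|M. c' t * conv u \<phi> (p t))"
  proof (rule integral_dominated_convergence[where w = "\<lambda>t. norm (c' t) * B"])
    show "integrable M (\<lambda>t. norm (c' t) * B)"
      using c'int by simp
    show "AE t in M. (\<lambda>n. c' t * conv u \<phi> (s n t)) \<longlonglongrightarrow> c' t * conv u \<phi> (p t)"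
    proof (rule AE_I2)
      fix t assume "t \<in> space M"
      then show "(\<lambda>n. c' t * conv u \<phi> (s n t)) \<longlonglongrightarrow> c' t * conv u \<phi> (p t)"
        using continuous_on_tendsto_compose[OF smooth_continuous_on[OF smc, of UNIV] s(2)]
        by (intro tendsto_mult_left) auto
    qed
    show "AE t in M. norm (c' t * conv u \<phi> (s n t)) \<le> norm (c' t) * B" for n
    proof (rule AE_I2)
      fix t assume t: "t \<in> space M"
      show "norm (c' t * conv u \<phi> (s n t)) \<le> norm (c' t) * B"
      proof (cases "c' t = 0")
        case False
        then have "c t \<noteq> 0"
          by (auto simp: c'_def split: if_splits)
        then have "norm (s n t) \<le> 2 * P"
          using s(3)[OF t, of n] P(2)[of t] by linarith
        then show ?thesis
          by (simp add: norm_mult mult_left_mono B)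
      qed simp
    qed
  qed measurable
  then have L2: "(\<lambda>n. u (?I (s n))) \<longlonglongrightarrow> (LINT t|M. c' t * conv u \<phi> (p t))"
    by (simp only: simple)
  have "u (?I p) = (LINT t|M. c' t * conv u \<phi> (p t))"
    by (rule LIMSEQ_unique[OF L1 L2])
  then show ?thesis
    by (simp only: cc)
qed

section \<open>Orthogonality to a separating algebra of functions\<close>

lemma continuous_nonneg_integral_0:
  fixes g :: "'a::euclidean_space \<Rightarrow> real"
  assumes "continuous_on UNIV g" "\<And>x. g x \<ge> 0" "integrable lborel g" "(LINT x|lborel. g x) = 0"
  shows "g x = 0"
proof -
  have AE: "AE x in lborel. g x = 0"
    using integral_nonneg_eq_0_iff_AE[OF assms(3)] assms(2,4) by simp
  have op: "open {x. g x \<noteq> 0}"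
    by (intro open_Collect_neq assms(1) continuous_on_const)
  have "emeasure lborel {x. g x \<noteq> 0} = 0"
    using AE op by (subst (asm) AE_iff_measurable[of "{x. g x \<noteq> 0}"]) auto
  then have "negligible {x. g x \<noteq> 0}"
    using op by (auto simp: negligible_iff_emeasure0 borel_open)
  then show ?thesis
    using open_not_negligible[OF op] by auto
qed

text \<open>By the Stone-Weierstrass theorem \<open>g\<close> is a uniform limit on \<open>K\<close> of functions from \<open>R\<close>, to which it is
orthogonal, so the integral of \<open>g\<^sup>2\<close> is zero. Elements of \<open>R\<close> may be arbitrary, even discontinuous,
outside \<open>K\<close>; there the factor \<open>g\<close> removes them.\<close>

lemma function_ring_orthogonal_real:
  fixes g :: "'a::euclidean_space \<Rightarrow> real"
  assumes R: "function_ring_on R K" and g: "continuous_on UNIV g" "\<And>x. x \<notin> K \<Longrightarrow> g x = 0"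
    and orth: "\<And>q. q \<in> R \<Longrightarrow> (LINT x|lborel. g x * q x) = 0"
  shows "g x = 0"
proof -
  interpret function_ring_on R K by (rule R)
  have gK: "continuous_on K g"
    using g(1) continuous_on_subset by blast
  have int: "integrable lborel (\<lambda>x. g x * h x)" if "continuous_on K h" for h
  proof -
    have "(\<lambda>x. g x * h x) = (\<lambda>x. indicator K x *\<^sub>R (g x * h x))"
      using g(2) by (auto simp: indicator_def fun_eq_iff)
    moreover have "integrable lborel (\<lambda>x. indicator K x *\<^sub>R (g x * h x))"
      by (intro borel_integrable_compact compact continuous_intros gK that)
    ultimately show ?thesis by simp
  qed
  have intg: "integrable lborel (\<lambda>x. \<bar>g x\<bar>)"
    using int[of "\<lambda>_. 1"] integrable_abs by simp
  have le: "(LINT x|lborel. g x * g x) \<le> e * (LINT x|lborel. \<bar>g x\<bar>)" if e: "e > 0" for e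
  proof -
    obtain q where q: "q \<in> R" "\<forall>x\<in>K. \<bar>g x - q x\<bar> < e"
      using Stone_Weierstrass_basic[OF gK e] by blast
    have cq: "continuous_on K q"
      by (rule continuous[OF q(1)])
    have "(LINT x|lborel. g x * g x) = (LINT x|lborel. g x * g x) - (LINT x|lborel. g x * q x)"
      using orth[OF q(1)] by simp
    also have "\<dots> = (LINT x|lborel. g x * (g x - q x))"
      using int[OF gK] int[OF cq] by (simp add: right_diff_distrib)
    also have "\<dots> \<le> (LINT x|lborel. e * \<bar>g x\<bar>)"
    proof (rule integral_mono)
      show "integrable lborel (\<lambda>x. g x * (g x - q x))"
        by (intro int continuous_intros gK cq)
      show "integrable lborel (\<lambda>x. e * \<bar>g x\<bar>)"
        using intg by simp
      fix x
      show "g x * (g x - q x) \<le> e * \<bar>g x\<bar>"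
      proof (cases "x \<in> K")
        case True
        have "g x * (g x - q x) \<le> \<bar>g x\<bar> * \<bar>g x - q x\<bar>"
          by (metis abs_ge_self abs_mult)
        also have "\<dots> \<le> \<bar>g x\<bar> * e"
          using q(2) True by (intro mult_left_mono) auto
        finally show ?thesis by (simp add: mult.commute)
      qed (simp add: g(2))
    qed
    finally show ?thesis by simp
  qed
  have "(LINT x|lborel. g x * g x) \<le> 0"
  proof (rule field_le_epsilon)
    fix e :: real assume e: "e > 0"
    define I where "I = (LINT x|lborel. \<bar>g x\<bar>)"
    have I: "I \<ge> 0" by (simp add: I_def)
    then have "e / (I + 1) * I \<le> e"
      using e by (simp add: field_simps)
    with le[of "e / (I + 1)", folded I_def] e I show "(LINT x|lborel. g x * g x) \<le> 0 + e"
      by (simp add: add_nonneg_pos)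
  qed
  then have "(LINT x|lborel. g x * g x) = 0"
    by (intro antisym integral_nonneg_AE) auto
  with int[OF gK] have "g x * g x = 0"
    by (intro continuous_nonneg_integral_0[of "\<lambda>x. g x * g x"] continuous_intros g(1)) auto
  then show ?thesis by simp
qed

lemma function_ring_orthogonal:
  fixes g :: "'a::euclidean_space \<Rightarrow> complex"
  assumes R: "function_ring_on R K" and g: "continuous_on UNIV g" "\<And>x. x \<notin> K \<Longrightarrow> g x = 0"
    and orth: "\<And>q. q \<in> R \<Longrightarrow> (LINT x|lborel. g x * of_real (q x)) = 0"
  shows "g x = 0"
proof -
  interpret function_ring_on R K by (rule R)
  have int: "integrable lborel (\<lambda>x. g x * of_real (q x))" if "q \<in> R" for q
  proof -
    have "(\<lambda>x. g x * of_real (q x)) = (\<lambda>x. indicator K x *\<^sub>R (g x * of_real (q x)))"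
      using g(2) by (auto simp: indicator_def fun_eq_iff)
    moreover have "integrable lborel (\<lambda>x. indicator K x *\<^sub>R (g x * of_real (q x)))"
      by (intro borel_integrable_compact compact continuous_intros continuous that continuous_on_subset[OF g(1)]) auto
    ultimately show ?thesis by simp
  qed
  have "Re (g x) = 0"
  proof (rule function_ring_orthogonal_real[OF R])
    show "(LINT x|lborel. Re (g x) * q x) = 0" if "q \<in> R" for q
      using integral_Re[OF int[OF that]] orth[OF that] by simp
  qed (auto intro!: continuous_intros g(1) simp: g(2))
  moreover have "Im (g x) = 0"
  proof (rule function_ring_orthogonal_real[OF R])
    show "(LINT x|lborel. Im (g x) * q x) = 0" if "q \<in> R" for q
      using integral_Im[OF int[OF that]] orth[OF that] by simp
  qed (auto intro!: continuous_intros g(1) simp: g(2))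
  ultimately show ?thesis
    by (simp add: complex_eq_iff)
qed

text \<open>On the two intervals where \<open>g\<close> lives, the polynomials in \<open>1/s\<close> form a separating algebra.\<close>

lemma inverse_moments_zero:
  fixes g :: "real \<Rightarrow> complex"
  assumes g: "continuous_on UNIV g" and a: "a > 0"
    and supp: "\<And>s. \<bar>s\<bar> < a \<Longrightarrow> g s = 0" "\<And>s. \<bar>s\<bar> > T \<Longrightarrow> g s = 0"
    and mom: "\<And>k. (LINT s|lborel. g s / of_real s ^ k) = 0"
  shows "g s = 0"
proof -
  define K where "K = {- T..- a} \<union> {a..T}"
  define R where "R = range (\<lambda>p s. poly p (inverse s) :: real)"
  have K0: "s \<noteq> 0" if "s \<in> K" for s
    using that a by (auto simp: K_def)
  have gK: "g s = 0" if "s \<notin> K" for s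
    using that supp[of s] by (auto simp: K_def abs_if split: if_splits)
  have R: "function_ring_on R K"
  proof
    show "compact K"
      by (auto simp: K_def intro: compact_Un)
    show "continuous_on K f" if "f \<in> R" for f
      using that K0 by (auto simp: R_def intro!: continuous_intros)
    show "(\<lambda>x. f x + g x) \<in> R" if "f \<in> R" "g \<in> R" for f g
      using that by (auto simp: R_def image_iff poly_add[symmetric] simp del: poly_add)
    show "(\<lambda>x. f x * g x) \<in> R" if "f \<in> R" "g \<in> R" for f g
      using that by (auto simp: R_def image_iff poly_mult[symmetric] simp del: poly_mult)
    show "(\<lambda>_. c) \<in> R" for c
      unfolding R_def by (rule range_eqI[of _ _ "[:c:]"]) simp
    show "\<exists>f\<in>R. f x \<noteq> f y" if "x \<in> K" "y \<in> K" "x \<noteq> y" for x y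
      using that unfolding R_def by (intro bexI[of _ "\<lambda>s. poly [:0, 1:] (inverse s)"] rangeI) auto
  qed
  have int: "integrable lborel (\<lambda>s. g s / of_real s ^ k)" for k
  proof -
    have "(\<lambda>s. g s / of_real s ^ k) = (\<lambda>s. indicator K s *\<^sub>R (g s / of_real s ^ k))"
      using gK by (auto simp: indicator_def fun_eq_iff)
    moreover have "integrable lborel (\<lambda>s. indicator K s *\<^sub>R (g s / of_real s ^ k))"
      using K0
      by (intro borel_integrable_compact continuous_intros continuous_on_subset[OF g])
         (auto simp: K_def intro: compact_Un)
    ultimately show ?thesis by simp
  qed
  show ?thesis
  proof (rule function_ring_orthogonal[OF R g gK])
    fix q assume "q \<in> R"
    then obtain p where q: "q = (\<lambda>s. poly p (inverse s))"
      by (auto simp: R_def)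
    have "(LINT s|lborel. g s * of_real (q s)) = (LINT s|lborel. (\<Sum>k\<le>degree p. of_real (coeff p k) * (g s / of_real s ^ k)))"
      by (intro Bochner_Integration.integral_cong)
         (auto simp: q poly_altdef sum_distrib_left field_simps power_inverse)
    also have "\<dots> = 0"
      by (subst Bochner_Integration.integral_sum) (auto simp: int mom simp del: times_divide_eq_right)
    finally show "(LINT s|lborel. g s * of_real (q s)) = 0" .
  qed
qed

section \<open>Functions whose integrals over the lines through a ball vanish\<close>

lemma integral_ray_truncate:
  fixes f :: "'a::euclidean_space \<Rightarrow> complex"
  assumes "\<And>x. norm x > R \<Longrightarrow> f x = 0" "R + norm x \<le> T * norm \<theta>" "\<theta> \<noteq> 0"
  shows "(LINT s|lborel. c s * f (x + s *\<^sub>R \<theta>)) = (LINT s|lborel. (indicator {-T..T} s * c s) * f (x + s *\<^sub>R \<theta>))"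
proof (rule Bochner_Integration.integral_cong)
  fix s :: real
  show "c s * f (x + s *\<^sub>R \<theta>) = indicator {-T..T} s * c s * f (x + s *\<^sub>R \<theta>)"
  proof (cases "s \<in> {-T..T}")
    case False
    then have "T < \<bar>s\<bar>"
      by auto
    then have "T * norm \<theta> < \<bar>s\<bar> * norm \<theta>"
      using assms(3) by (intro mult_strict_right_mono) auto
    then have "norm (x + s *\<^sub>R \<theta>) > R"
      using assms(2) norm_triangle_ineq4[of "x + s *\<^sub>R \<theta>" x] by simp
    then show ?thesis
      using assms(1) by simp
  qed simp
qed simp

lemma ray_family:
  assumes "integrable lborel c" "\<And>s. c s \<noteq> 0 \<Longrightarrow> \<bar>s\<bar> \<le> T"
  shows "affine_family lborel c (\<lambda>_. 0) (\<lambda>s (z::'a::euclidean_space \<times> 'a). fst z + s *\<^sub>R snd z)"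
  unfolding affine_family_def
proof (intro conjI)
  show "\<forall>s. linear (\<lambda>z::'a \<times> 'a. fst z + s *\<^sub>R snd z)"
    by (auto intro!: linearI simp: scaleR_add_right scaleR_left_commute)
  show "\<exists>l. \<forall>s (z::'a \<times> 'a). c s \<noteq> 0 \<longrightarrow> norm (fst z + s *\<^sub>R snd z) \<le> l * norm z"
  proof (intro exI[of _ "1 + T"] allI impI)
    fix s and z :: "'a \<times> 'a" assume "c s \<noteq> 0"
    have "norm (fst z + s *\<^sub>R snd z) \<le> norm (fst z) + \<bar>s\<bar> * norm (snd z)"
      by (metis norm_scaleR norm_triangle_ineq)
    also have "\<dots> \<le> norm z + T * norm z"
      using assms(2)[OF \<open>c s \<noteq> 0\<close>] norm_fst_le[of "fst z" "snd z"] norm_snd_le[of "snd z" "fst z"]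
      by (intro add_mono mult_mono) auto
    finally show "norm (fst z + s *\<^sub>R snd z) \<le> (1 + T) * norm z"
      by (simp add: distrib_right)
  qed
qed (use assms in auto)

text \<open>Weighted line integrals as functions of the base point and the direction jointly, so that they can be
differentiated in both.\<close>

definition ray_integral :: "(real \<Rightarrow> complex) \<Rightarrow> ('a::euclidean_space \<Rightarrow> complex) \<Rightarrow> 'a \<times> 'a \<Rightarrow> complex" where
  "ray_integral c f z = (LINT s|lborel. c s * f (fst z + s *\<^sub>R snd z))"

lemma
  fixes f :: "'a::euclidean_space \<Rightarrow> complex"
  assumes c: "integrable lborel c" "\<And>s. c s \<noteq> 0 \<Longrightarrow> \<bar>s\<bar> \<le> T" and f: "smooth f"
  shows smooth_ray_integral: "smooth (ray_integral c f)"
    and dirD_ray_integral_fst: "e \<in> Basis \<Longrightarrow> dirD (e, 0) (ray_integral c f) = ray_integral c (dirD e f)"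
    and dirD_ray_integral_snd: "e \<in> Basis \<Longrightarrow>
      dirD (0, e) (ray_integral c f) = ray_integral (\<lambda>s. of_real s * c s) (dirD e f)"
proof -
  note A = ray_family[where ?'a = 'a, OF c]
  show "smooth (ray_integral c f)"
    using affine_family_smooth[OF A f] by (simp add: ray_integral_def[abs_def])
  assume e: "e \<in> Basis"
  show "dirD (e, 0) (ray_integral c f) = ray_integral c (dirD e f)"
  proof
    fix z
    have "dirD (e, 0) (ray_integral c f) z =
      (\<Sum>b\<in>Basis. (e \<bullet> b) *\<^sub>R (LINT s|lborel. c s * dirD b f (fst z + s *\<^sub>R snd z)))"
      using affine_family_dirD[OF A f, of "(e, 0)" z] by (simp add: ray_integral_def[abs_def])
    then show "dirD (e, 0) (ray_integral c f) z = ray_integral c (dirD e f) z"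
      by (simp only: sum_Basis_pick[OF e] ray_integral_def)
  qed
  show "dirD (0, e) (ray_integral c f) = ray_integral (\<lambda>s. of_real s * c s) (dirD e f)"
  proof
    fix z
    have "dirD (0, e) (ray_integral c f) z =
      (\<Sum>b\<in>Basis. LINT s|lborel. ((s *\<^sub>R e \<bullet> b) *\<^sub>R c s) * dirD b f (fst z + s *\<^sub>R snd z))"
      using affine_family_dirD[OF A f, of "(0, e)" z] by (simp add: ray_integral_def[abs_def])
    also have "\<dots> = (\<Sum>b\<in>Basis. (e \<bullet> b) *\<^sub>R (LINT s|lborel. (of_real s * c s) * dirD b f (fst z + s *\<^sub>R snd z)))"
      by (intro sum.cong refl, subst integral_scaleR_right[symmetric])
         (simp add: scaleR_conv_of_real mult_ac)
    finally show "dirD (0, e) (ray_integral c f) z = ray_integral (\<lambda>s. of_real s * c s) (dirD e f) z"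
      by (simp only: sum_Basis_pick[OF e] ray_integral_def)
  qed
qed

text \<open>The hypotheses of the uniqueness theorem, with the ball centred at the origin. The point of collecting
them is that they are inherited by derivatives (\<open>ray_null_dirD\<close>).\<close>

definition ray_null :: "real \<Rightarrow> real \<Rightarrow> ('a::euclidean_space \<Rightarrow> complex) \<Rightarrow> bool" where
  "ray_null r R f \<longleftrightarrow> smooth f \<and> (\<forall>x. norm x < r \<longrightarrow> f x = 0) \<and> (\<forall>x. norm x > R \<longrightarrow> f x = 0) \<and>
     (\<forall>x \<theta>. norm x < r \<longrightarrow> \<theta> \<noteq> 0 \<longrightarrow> (LINT s|lborel. f (x + s *\<^sub>R \<theta>)) = 0)"

lemma open_norm_less: "open {x::'a::real_normed_vector. norm x < r}"
  and open_norm_greater: "open {x::'a::real_normed_vector. norm x > r}"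
  by (auto intro!: open_Collect_less continuous_intros)

lemma dirD_support:
  assumes "\<And>x. norm x > R \<Longrightarrow> f x = 0" "norm x > R"
  shows "dirD b f x = 0"
  by (rule dirD_eq_0[OF open_norm_greater[of R]]) (use assms in auto)

text \<open>Only the base point is moved: the line integrals vanish for all base points near \<open>x\<close>, so their
derivative with respect to the base point does, too.\<close>

lemma dirD_line_integral:
  fixes f :: "'a::euclidean_space \<Rightarrow> complex"
  assumes f: "smooth f" "\<And>x. norm x > R \<Longrightarrow> f x = 0" and B: "open B" "x \<in> B" and \<theta>: "\<theta> \<noteq> 0" and b: "b \<in> Basis"
    and zero: "\<And>x. x \<in> B \<Longrightarrow> (LINT s|lborel. f (x + s *\<^sub>R \<theta>)) = 0"
  shows "(LINT s|lborel. dirD b f (x + s *\<^sub>R \<theta>)) = 0"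
proof -
  define T where "T = (\<bar>R\<bar> + norm x + 1) / norm \<theta>"
  let ?c = "indicator {-T..T} :: real \<Rightarrow> complex"
  have c: "integrable lborel ?c" "\<And>s. ?c s \<noteq> 0 \<Longrightarrow> \<bar>s\<bar> \<le> T"
    by (rule integrable_Icc_indicator) (auto simp: indicator_def split: if_splits)
  have trunc: "(LINT s|lborel. g (y + s *\<^sub>R \<theta>)) = ray_integral ?c g (y, \<theta>)"
    if "norm y < norm x + 1" "\<And>x. norm x > R \<Longrightarrow> g x = 0" for g y
    using integral_ray_truncate[of R g y T \<theta> "\<lambda>_. 1", OF that(2)] that(1) \<theta>
    by (simp add: ray_integral_def T_def)
  have "dirD b (\<lambda>y. ray_integral ?c f (y, \<theta>)) x = 0"
  proof (rule dirD_eq_0)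
    show "open (B \<inter> ball 0 (norm x + 1))" "x \<in> B \<inter> ball 0 (norm x + 1)"
      using B by auto
    show "ray_integral ?c f (y, \<theta>) = 0" if "y \<in> B \<inter> ball 0 (norm x + 1)" for y
      using trunc[of y f] that zero[of y] f(2) by simp
  qed
  moreover have "dirD b (\<lambda>y. ray_integral ?c f (y, \<theta>)) x = dirD (b, 0) (ray_integral ?c f) (x, \<theta>)"
  proof (rule dirD_eqI)
    have "((\<lambda>y. (y, \<theta>)) has_derivative (\<lambda>v. (v, 0))) (at x)"
      by (auto intro!: derivative_eq_intros)
    from diff_chain_at[OF this] smooth_differentiable[OF smooth_ray_integral[OF c f(1)]]
    show "((\<lambda>y. ray_integral ?c f (y, \<theta>)) has_derivative
        (\<lambda>b. dirD (b, 0) (ray_integral ?c f) (x, \<theta>))) (at x)"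
      by (fastforce simp: dirD_def o_def frechet_derivative_works)
  qed
  ultimately have "ray_integral ?c (dirD b f) (x, \<theta>) = 0"
    using dirD_ray_integral_fst[OF c f(1) b] by simp
  then show ?thesis
    using trunc[of x "dirD b f"] dirD_support[of R f, OF f(2)] by simp
qed

lemma ray_null_dirD:
  assumes f: "ray_null r R f" and b: "b \<in> Basis"
  shows "ray_null r R (dirD b f)"
  unfolding ray_null_def
proof (intro conjI allI impI)
  show "smooth (dirD b f)"
    using f b by (simp add: ray_null_def smooth_dirD)
  show "dirD b f x = 0" if "norm x < r" for x
    by (rule dirD_eq_0[OF open_norm_less[of r]]) (use f that in \<open>auto simp: ray_null_def\<close>)
  show "dirD b f x = 0" if "norm x > R" for x
    by (rule dirD_eq_0[OF open_norm_greater[of R]]) (use f that in \<open>auto simp: ray_null_def\<close>)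
  show "(LINT s|lborel. dirD b f (x + s *\<^sub>R \<theta>)) = 0" if "norm x < r" "\<theta> \<noteq> 0" for x \<theta>
    by (rule dirD_line_integral[of _ R "{x. norm x < r}"])
       (use f that b in \<open>auto simp: ray_null_def open_norm_less\<close>)
qed

text \<open>At \<open>s = 0\<close> the quotient is \<open>0\<close> by the convention for division, in agreement with \<open>f\<close> being zero near
the origin.\<close>

lemma ray_null_moment_continuous:
  assumes f: "ray_null r R f" and r: "r > 0" and \<theta>: "\<theta> \<noteq> 0"
  shows "continuous_on S (\<lambda>s. f (s *\<^sub>R \<theta>) / of_real s ^ k)"
proof -
  have "continuous_on ({s. s \<noteq> 0} \<union> {s. \<bar>s\<bar> * norm \<theta> < r}) (\<lambda>s. f (s *\<^sub>R \<theta>) / of_real s ^ k)"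
  proof (rule continuous_on_open_Un)
    show "open {s::real. s \<noteq> 0}" "open {s. \<bar>s\<bar> * norm \<theta> < r}"
      by (auto intro!: open_Collect_neq open_Collect_less continuous_intros)
    show "continuous_on {s. s \<noteq> 0} (\<lambda>s. f (s *\<^sub>R \<theta>) / of_real s ^ k)"
      using f by (intro continuous_intros continuous_on_compose2[OF smooth_continuous_on[of f UNIV]]) (auto simp: ray_null_def)
    show "continuous_on {s. \<bar>s\<bar> * norm \<theta> < r} (\<lambda>s. f (s *\<^sub>R \<theta>) / of_real s ^ k)"
      by (rule continuous_on_cong[THEN iffD2, OF refl _ continuous_on_const[of _ 0]])
         (use f in \<open>auto simp: ray_null_def\<close>)
  qed
  moreover have "{s. s \<noteq> 0} \<union> {s. \<bar>s\<bar> * norm \<theta> < r} = UNIV"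
    using r by auto
  ultimately show ?thesis
    using continuous_on_subset by fastforce
qed

lemma ray_null_moment_integrable:
  assumes f: "ray_null r R f" and r: "r > 0" and \<theta>: "\<theta> \<noteq> 0"
  shows "integrable lborel (\<lambda>s. f (s *\<^sub>R \<theta>) / of_real s ^ k)"
proof -
  define T where "T = R / norm \<theta>"
  have "f (s *\<^sub>R \<theta>) = 0" if "s \<notin> {-T..T}" for s
  proof -
    have "T < \<bar>s\<bar>" using that by auto
    then have "R < norm (s *\<^sub>R \<theta>)"
      using \<theta> by (simp add: T_def divide_less_eq)
    with f show ?thesis by (simp add: ray_null_def)
  qed
  then have "(\<lambda>s. f (s *\<^sub>R \<theta>) / of_real s ^ k) = (\<lambda>s. indicator {-T..T} s * (f (s *\<^sub>R \<theta>) / of_real s ^ k))"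
    by (auto simp: indicator_def fun_eq_iff)
  moreover have "integrable lborel (\<lambda>s. indicator {-T..T} s * (f (s *\<^sub>R \<theta>) / of_real s ^ k))"
    by (intro integrable_indicator_cbox_continuous ray_null_moment_continuous[OF f r \<theta>])
  ultimately show ?thesis
    by (simp only:)
qed

text \<open>The moment of order one is an odd function of the direction. Its derivatives are line integrals of
derivatives of \<open>f\<close>, the factor \<open>s\<close> from the chain rule cancelling \<open>1/s\<close>. So the moment is constant on an annulus
that contains \<open>\<theta>\<close> and \<open>-\<theta>\<close>; annuli are connected in dimension at least two.\<close>

lemma ray_null_first_moment:
  fixes f :: "'a::euclidean_space \<Rightarrow> complex"
  assumes dim: "DIM('a) \<ge> 2" and f: "ray_null r R f" and r: "r > 0" and \<theta>: "\<theta> \<noteq> 0"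
  shows "(LINT s|lborel. f (s *\<^sub>R \<theta>) / of_real s) = 0"
proof -
  define \<nu> where "\<nu> = norm \<theta>"
  have \<nu>: "\<nu> > 0" using \<theta> by (simp add: \<nu>_def)
  \<comment> \<open>For directions in the annulus \<open>W\<close>, all \<open>s\<close> at which \<open>f\<close> does not vanish satisfy \<open>a \<le> \<bar>s\<bar> \<le> T\<close>.\<close>
  define a T where "a = r / (2 * \<nu>)" and "T = 2 * R / \<nu>"
  define W where "W = {y::'a. \<nu> / 2 < norm (y - 0) \<and> norm (y - 0) < 2 * \<nu>}"
  define c :: "real \<Rightarrow> complex" where "c s = (if a \<le> \<bar>s\<bar> \<and> \<bar>s\<bar> \<le> T then 1 / of_real s else 0)" for s
  have a: "a > 0" using r \<nu> by (simp add: a_def)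
  have sm: "smooth f" and f0: "\<And>x. norm x < r \<Longrightarrow> f x = 0" and f1: "\<And>x. norm x > R \<Longrightarrow> f x = 0"
    using f by (auto simp: ray_null_def)
  have c_eq: "c = (\<lambda>s. indicator ({-T..-a} \<union> {a..T}) s *\<^sub>R (1 / of_real s))"
    using a by (auto simp: c_def indicator_def fun_eq_iff abs_if)
  have c_int: "integrable lborel c"
    unfolding c_eq using a by (intro borel_integrable_compact compact_Un continuous_intros) auto
  have A: "affine_family lborel c (\<lambda>_. 0) (\<lambda>s (y::'a). s *\<^sub>R y)"
    unfolding affine_family_def
  proof (intro conjI)
    show "\<forall>s. linear (\<lambda>y::'a. s *\<^sub>R y)"
      by (auto intro: linearI simp: scaleR_add_right)
    show "\<exists>l. \<forall>s (y::'a). c s \<noteq> 0 \<longrightarrow> norm (s *\<^sub>R y) \<le> l * norm y"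
      by (intro exI[of _ T]) (auto simp: c_def intro: mult_right_mono split: if_splits)
  qed (use c_int in auto)
  have range: "a \<le> \<bar>s\<bar> \<and> \<bar>s\<bar> \<le> T" if "y \<in> W" "r \<le> norm (s *\<^sub>R y)" "norm (s *\<^sub>R y) \<le> R" for y s
  proof -
    have y: "norm y > 0" "\<nu> / 2 < norm y" "norm y < 2 * \<nu>"
      using that(1) \<nu> unfolding W_def by auto
    have "r \<le> \<bar>s\<bar> * norm y" "\<bar>s\<bar> * norm y \<le> R"
      using that by simp_all
    moreover have "\<bar>s\<bar> * norm y \<le> \<bar>s\<bar> * (2 * \<nu>)"
      by (rule mult_left_mono) (use y in auto)
    moreover have "\<bar>s\<bar> * (\<nu> / 2) \<le> \<bar>s\<bar> * norm y"
      by (rule mult_left_mono) (use y in auto)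
    ultimately show ?thesis
      using \<nu> by (simp add: a_def T_def field_simps)
  qed
  have N: "(LINT s|lborel. c s * f (0 + s *\<^sub>R y)) = (LINT s|lborel. f (s *\<^sub>R y) / of_real s)" if "y \<in> W" for y
  proof (rule Bochner_Integration.integral_cong)
    fix s
    show "c s * f (0 + s *\<^sub>R y) = f (s *\<^sub>R y) / of_real s"
      using range[OF that, of s] f0[of "s *\<^sub>R y"] f1[of "s *\<^sub>R y"] by (force simp: c_def not_less)
  qed simp
  let ?N = "\<lambda>y. LINT s|lborel. c s * f (0 + s *\<^sub>R y)"
  have "(?N has_derivative (\<lambda>v. 0)) (at y)" if y: "y \<in> W" for y
  proof -
    have "(LINT s|lborel. ((s *\<^sub>R v \<bullet> b) *\<^sub>R c s) * dirD b f (0 + s *\<^sub>R y)) = 0" if b: "b \<in> Basis" for b v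
    proof -
      have fb: "ray_null r R (dirD b f)"
        by (rule ray_null_dirD[OF f b])
      have y0: "y \<noteq> 0"
        using y \<nu> by (auto simp: W_def)
      have "(LINT s|lborel. ((s *\<^sub>R v \<bullet> b) *\<^sub>R c s) * dirD b f (0 + s *\<^sub>R y))
        = (LINT s|lborel. of_real (v \<bullet> b) * dirD b f (0 + s *\<^sub>R y))"
      proof (rule Bochner_Integration.integral_cong)
        fix s
        show "((s *\<^sub>R v \<bullet> b) *\<^sub>R c s) * dirD b f (0 + s *\<^sub>R y) = of_real (v \<bullet> b) * dirD b f (0 + s *\<^sub>R y)"
        proof (cases "dirD b f (s *\<^sub>R y) = 0")
          case False
          then have "r \<le> norm (s *\<^sub>R y)" "norm (s *\<^sub>R y) \<le> R"
            using fb unfolding ray_null_def by (meson not_le)+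
          with range[OF y] have "a \<le> \<bar>s\<bar> \<and> \<bar>s\<bar> \<le> T" by blast
          with a show ?thesis
            by (auto simp: c_def scaleR_conv_of_real)
        qed simp
      qed simp
      also have "\<dots> = of_real (v \<bullet> b) * (LINT s|lborel. dirD b f (0 + s *\<^sub>R y))"
        by simp
      also have "(LINT s|lborel. dirD b f (0 + s *\<^sub>R y)) = 0"
        using fb y0 r unfolding ray_null_def by (metis norm_zero)
      finally show ?thesis by simp
    qed
    with affine_family_has_derivative[OF A sm, of y] show ?thesis
      by simp
  qed
  moreover have "continuous_on W ?N"
    by (rule smooth_continuous_on[OF affine_family_smooth[OF A sm]])
  moreover have "connected W"
    unfolding W_def by (rule connected_annulus(1)[OF dim])
  moreover have "open W"
    unfolding W_def by (auto intro!: open_Collect_conj open_Collect_less continuous_intros)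
  ultimately have "?N constant_on W"
    by (intro has_derivative_zero_connected_constant_on[of _ "{}"]) (auto intro: has_derivative_at_withinI)
  moreover have "\<theta> \<in> W" "-\<theta> \<in> W"
    using \<nu> by (auto simp: W_def \<nu>_def)
  ultimately have "?N \<theta> = ?N (-\<theta>)"
    unfolding constant_on_def by metis
  then have "(LINT s|lborel. f (s *\<^sub>R \<theta>) / of_real s) = (LINT s|lborel. f (s *\<^sub>R (-\<theta>)) / of_real s)"
    using N[OF \<open>\<theta> \<in> W\<close>] N[OF \<open>-\<theta> \<in> W\<close>] by (simp only:)
  also have "\<dots> = - (LINT s|lborel. f (s *\<^sub>R \<theta>) / of_real s)"
    by (subst lborel_integral_real_affine[of "-1" _ 0]) auto
  finally show ?thesis
    by simp
qed

text \<open>From order \<open>k > 0\<close> to order \<open>k + 1\<close> by integrating the derivative of \<open>f(s\<theta>) / s\<^sup>k\<close> over the line: the result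
is zero, and the terms in which \<open>f\<close> is differentiated vanish by induction. The factor \<open>k\<close> of the
remaining term is the reason why the step from order zero needs the preceding lemma.\<close>

lemma ray_null_moments:
  fixes f :: "'a::euclidean_space \<Rightarrow> complex"
  assumes dim: "DIM('a) \<ge> 2" and f: "ray_null r R f" and r: "r > 0" and \<theta>: "\<theta> \<noteq> 0"
  shows "(LINT s|lborel. f (s *\<^sub>R \<theta>) / of_real s ^ k) = 0"
  using f
proof (induction k arbitrary: f)
  case 0
  have "(LINT s|lborel. f (0 + s *\<^sub>R \<theta>)) = 0"
    using 0 r \<theta> unfolding ray_null_def by (metis norm_zero)
  then show ?case by simp
next
  case (Suc k)
  show ?case
  proof (cases "k = 0")
    case True
    then show ?thesis
      using ray_null_first_moment[OF dim Suc.prems r \<theta>] by simp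
  next
    case False
    have sm: "smooth f" and f0: "\<And>x. norm x < r \<Longrightarrow> f x = 0" and f1: "\<And>x. norm x > R \<Longrightarrow> f x = 0"
      using Suc.prems by (auto simp: ray_null_def)
    define T where "T = (\<bar>R\<bar> + 1) / norm \<theta>"
    have T: "T > 0" "norm (T *\<^sub>R \<theta>) > R"
      using \<theta> by (auto simp: T_def)
    define w where "w s = f (s *\<^sub>R \<theta>) / of_real s ^ k" for s :: real
    define w' where "w' s = (\<Sum>b\<in>Basis. (\<theta> \<bullet> b) *\<^sub>R (dirD b f (s *\<^sub>R \<theta>) / of_real s ^ k))
       - of_nat k * (f (s *\<^sub>R \<theta>) / of_real s ^ Suc k)" for s :: real
    have nullb: "ray_null r R (dirD b f)" if "b \<in> Basis" for b
      by (rule ray_null_dirD[OF Suc.prems that])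
    have der: "(w has_vector_derivative w' s) (at s)" for s
    proof (cases "s = 0")
      case True
      have "((\<lambda>s. 0) has_vector_derivative 0) (at s)"
        by (rule has_vector_derivative_const)
      then have "(w has_vector_derivative 0) (at s)"
      proof (rule has_vector_derivative_transform_within_open)
        show "open {s. \<bar>s\<bar> * norm \<theta> < r}"
          by (auto intro!: open_Collect_less continuous_intros)
      qed (use True r f0 in \<open>auto simp: w_def\<close>)
      moreover have "w' s = 0"
        using True False by (simp add: w'_def power_0_left)
      ultimately show ?thesis by simp
    next
      case s: False
      have 1: "((\<lambda>s. f (0 + s *\<^sub>R \<theta>)) has_vector_derivative (\<Sum>b\<in>Basis. (\<theta> \<bullet> b) *\<^sub>R dirD b f (0 + s *\<^sub>R \<theta>))) (at s)"
        by (rule smooth_line_has_vector_derivative[OF sm])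
      have 2: "((\<lambda>s. complex_of_real (inverse (s ^ k))) has_vector_derivative
          of_real (- (of_nat k * s ^ (k - 1)) * inverse (s ^ k) ^ 2)) (at s)"
        using s by (intro has_vector_derivative_of_real)
          (auto intro!: derivative_eq_intros simp: power2_eq_square)
      have 3: "w = (\<lambda>s. f (0 + s *\<^sub>R \<theta>) * complex_of_real (inverse (s ^ k)))"
        by (simp add: w_def fun_eq_iff field_simps)
      have "w' s = f (0 + s *\<^sub>R \<theta>) * of_real (- (of_nat k * s ^ (k - 1)) * inverse (s ^ k) ^ 2)
         + (\<Sum>b\<in>Basis. (\<theta> \<bullet> b) *\<^sub>R dirD b f (0 + s *\<^sub>R \<theta>)) * complex_of_real (inverse (s ^ k))"
      proof -
        have "(\<Sum>b\<in>Basis. (\<theta> \<bullet> b) *\<^sub>R (dirD b f (s *\<^sub>R \<theta>) / of_real s ^ k))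
          = (\<Sum>b\<in>Basis. (\<theta> \<bullet> b) *\<^sub>R dirD b f (0 + s *\<^sub>R \<theta>)) * complex_of_real (inverse (s ^ k))"
          by (simp add: sum_distrib_right divide_inverse power_inverse)
        moreover have "- of_nat k * (f (s *\<^sub>R \<theta>) / of_real s ^ Suc k)
          = f (0 + s *\<^sub>R \<theta>) * of_real (- (of_nat k * s ^ (k - 1)) * inverse (s ^ k) ^ 2)"
          using s False by (cases k) (auto simp: field_simps power2_eq_square)
        ultimately show ?thesis
          by (simp add: w'_def)
      qed
      with has_vector_derivative_mult[OF 1 2] show ?thesis
        by (simp add: 3)
    qed
    have cont: "continuous_on {-T..T} w'"
      unfolding w'_def
      by (intro continuous_on_diff continuous_on_sum continuous_on_scaleR continuous_on_mult continuous_on_const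
          ray_null_moment_continuous[OF nullb r \<theta>] ray_null_moment_continuous[OF Suc.prems r \<theta>])
    have "(LINT s|lborel. indicator {-T..T} s * w' s) = w T - w (-T)"
      using T by (intro integral_FTC_complex cont has_vector_derivative_at_within[OF der]) auto
    also have "\<dots> = 0"
      using f1[OF T(2)] f1[of "(-T) *\<^sub>R \<theta>"] T(2) by (simp add: w_def)
    also have "(LINT s|lborel. indicator {-T..T} s * w' s) = (LINT s|lborel. w' s)"
    proof (rule Bochner_Integration.integral_cong)
      fix s
      show "indicator {-T..T} s * w' s = w' s"
      proof (cases "s \<in> {-T..T}")
        case False
        then have "T < \<bar>s\<bar>" by auto
        then have "norm (s *\<^sub>R \<theta>) > R"
          using \<theta> by (simp add: T_def divide_less_eq)
        then show ?thesis
          using nullb f1 by (simp add: w'_def ray_null_def)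
      qed simp
    qed simp
    finally have "(LINT s|lborel. w' s) = 0" .
    moreover have "(LINT s|lborel. w' s) = - of_nat k * (LINT s|lborel. f (s *\<^sub>R \<theta>) / of_real s ^ Suc k)"
    proof -
      have "(LINT s|lborel. w' s) = (\<Sum>b\<in>Basis. (\<theta> \<bullet> b) *\<^sub>R (LINT s|lborel. dirD b f (s *\<^sub>R \<theta>) / of_real s ^ k))
         - of_nat k * (LINT s|lborel. f (s *\<^sub>R \<theta>) / of_real s ^ Suc k)"
        unfolding w'_def
      proof (subst Bochner_Integration.integral_diff)
        have i: "integrable lborel (\<lambda>s. (\<theta> \<bullet> b) *\<^sub>R (dirD b f (s *\<^sub>R \<theta>) / of_real s ^ k))" if "b \<in> Basis" for b
          by (intro integrable_scaleR_right ray_null_moment_integrable[OF nullb[OF that] r \<theta>])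
        then show "integrable lborel (\<lambda>s. \<Sum>b\<in>Basis. (\<theta> \<bullet> b) *\<^sub>R (dirD b f (s *\<^sub>R \<theta>) / of_real s ^ k))"
          by (rule Bochner_Integration.integrable_sum)
        show "integrable lborel (\<lambda>s. of_nat k * (f (s *\<^sub>R \<theta>) / of_real s ^ Suc k))"
          by (intro integrable_mult_right ray_null_moment_integrable[OF Suc.prems r \<theta>])
        show "(LINT s|lborel. (\<Sum>b\<in>Basis. (\<theta> \<bullet> b) *\<^sub>R (dirD b f (s *\<^sub>R \<theta>) / of_real s ^ k)))
           - (LINT s|lborel. of_nat k * (f (s *\<^sub>R \<theta>) / of_real s ^ Suc k))
          = (\<Sum>b\<in>Basis. (\<theta> \<bullet> b) *\<^sub>R (LINT s|lborel. dirD b f (s *\<^sub>R \<theta>) / of_real s ^ k))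
           - of_nat k * (LINT s|lborel. f (s *\<^sub>R \<theta>) / of_real s ^ Suc k)"
          by (simp only: Bochner_Integration.integral_sum[OF i] integral_scaleR_right integral_mult_right_zero)
      qed
      then show ?thesis
        using Suc.IH[OF nullb] by simp
    qed
    ultimately show ?thesis
      using False by simp
  qed
qed

text \<open>Restricted to a line through the centre of the ball, \<open>f\<close> has vanishing moments of all orders with
respect to \<open>1/s\<close>.\<close>

theorem line_integrals_determine_function:
  fixes f :: "'a::euclidean_space \<Rightarrow> complex"
  assumes dim: "DIM('a) \<ge> 2" and f: "smooth f" "\<And>x. norm x > R \<Longrightarrow> f x = 0"
    and r: "r > 0" "\<And>x. x \<in> ball x0 r \<Longrightarrow> f x = 0"
    and ray: "\<And>x \<theta>. x \<in> ball x0 r \<Longrightarrow> \<theta> \<noteq> 0 \<Longrightarrow> (LINT s|lborel. f (x + s *\<^sub>R \<theta>)) = 0"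
  shows "f x = 0"
proof -
  define g where "g y = f (x0 + y)" for y
  have g: "ray_null r (R + norm x0) g"
    unfolding ray_null_def
  proof (intro conjI allI impI)
    show "smooth g"
      unfolding g_def by (rule smooth_translate[OF f(1)])
    show "g y = 0" if "norm y < r" for y
      unfolding g_def by (rule r(2)) (use that in \<open>simp add: dist_norm\<close>)
    show "g y = 0" if "norm y > R + norm x0" for y
      unfolding g_def using that norm_triangle_ineq4[of "x0 + y" x0] by (intro f(2)) simp
    show "(LINT s|lborel. g (y + s *\<^sub>R \<theta>)) = 0" if "norm y < r" "\<theta> \<noteq> 0" for y \<theta>
      using ray[of "x0 + y" \<theta>] that by (simp add: g_def dist_norm add.assoc)
  qed
  have "g y = 0" if "y \<noteq> 0" for y
  proof -
    have "g (1 *\<^sub>R y) = 0"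
    proof (rule inverse_moments_zero[of "\<lambda>s. g (s *\<^sub>R y)" "r / norm y" "(R + norm x0) / norm y"])
      show "continuous_on UNIV (\<lambda>s. g (s *\<^sub>R y))"
        using ray_null_moment_continuous[OF g r(1) that, of UNIV 0] by simp
      show "r / norm y > 0"
        using r that by simp
      show "g (s *\<^sub>R y) = 0" if "\<bar>s\<bar> < r / norm y" for s
        using that \<open>y \<noteq> 0\<close> g by (simp add: ray_null_def less_divide_eq)
      show "g (s *\<^sub>R y) = 0" if "\<bar>s\<bar> > (R + norm x0) / norm y" for s
        using that \<open>y \<noteq> 0\<close> g by (simp add: ray_null_def divide_less_eq)
      show "(LINT s|lborel. g (s *\<^sub>R y) / of_real s ^ k) = 0" for k
        by (rule ray_null_moments[OF dim g r(1) that])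
    qed
    then show ?thesis by simp
  qed
  moreover have "g 0 = 0"
    using g r(1) by (simp add: ray_null_def)
  ultimately have "g (x - x0) = 0"
    by (cases "x - x0 = 0") simp_all
  then show ?thesis
    by (simp add: g_def)
qed

section \<open>Line integrals of the curl\<close>

lemma smooth_linear_functional: "smooth (\<lambda>z. complex_of_real (z \<bullet> w))"
proof -
  have "Ck k (\<lambda>z. complex_of_real (z \<bullet> w))" for k
  proof (cases k)
    case (Suc m)
    have "bounded_linear (\<lambda>z. complex_of_real (z \<bullet> w))"
      by (intro bounded_linear_compose[OF bounded_linear_of_real] bounded_linear_inner_left)
    then have "((\<lambda>z. complex_of_real (z \<bullet> w)) has_derivative (\<lambda>v. complex_of_real (v \<bullet> w))) (at x)" for x
      by (rule bounded_linear_imp_has_derivative)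
    then show ?thesis
      unfolding Suc by (rule Ck_SucI) (rule Ck_const)
  qed simp
  then show ?thesis
    by (simp add: smooth_iff_Ck)
qed

lemma
  fixes f :: "'a::euclidean_space \<Rightarrow> complex"
  assumes f: "smooth f"
  shows smooth_inner_scaleR: "smooth (\<lambda>z. (z \<bullet> w) *\<^sub>R f z)"
    and dirD_inner_scaleR: "dirD v (\<lambda>z. (z \<bullet> w) *\<^sub>R f z) z = (z \<bullet> w) *\<^sub>R dirD v f z + (v \<bullet> w) *\<^sub>R f z"
proof -
  show "smooth (\<lambda>z. (z \<bullet> w) *\<^sub>R f z)"
    unfolding scaleR_conv_of_real by (intro smooth_mult f smooth_linear_functional)
  have D: "(f has_derivative (\<lambda>v. dirD v f z)) (at z)"
    using smooth_differentiable[OF f, of z] by (simp add: dirD_def frechet_derivative_works)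
  show "dirD v (\<lambda>z. (z \<bullet> w) *\<^sub>R f z) z = (z \<bullet> w) *\<^sub>R dirD v f z + (v \<bullet> w) *\<^sub>R f z"
    by (rule dirD_eqI) (auto intro!: derivative_eq_intros D)
qed

text \<open>Let \<open>H(x, \<theta>)\<close> be the integral of \<open>A(x + s\<theta>) \<cdot> \<theta>\<close>. Differentiating it in \<open>x\<^sub>i\<close> and then in \<open>\<theta>\<^sub>j\<close> gives the
integral of \<open>\<partial>\<^sub>i A\<^sub>j\<close> plus a term that contains \<open>s \<partial>\<^sub>j \<partial>\<^sub>i A\<^sub>b\<close> and is symmetric in \<open>i\<close> and \<open>j\<close>. The symmetric
term drops out of the difference.\<close>

lemma curl_line_integral_zero:
  fixes A :: "'a::euclidean_space \<Rightarrow> 'a \<Rightarrow> complex"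
  assumes A: "\<And>b. b \<in> Basis \<Longrightarrow> smooth (A b)" "\<And>b x. b \<in> Basis \<Longrightarrow> norm x > R \<Longrightarrow> A b x = 0"
    and U: "open U" "x \<in> U" and \<theta>: "\<theta> \<noteq> 0" and ij: "i \<in> Basis" "j \<in> Basis"
    and zero: "\<And>x \<theta>. x \<in> U \<Longrightarrow> \<theta> \<noteq> 0 \<Longrightarrow>
      (LINT s|lborel. (\<Sum>b\<in>Basis. (\<theta> \<bullet> b) *\<^sub>R A b (x + s *\<^sub>R \<theta>))) = 0"
  shows "(LINT s|lborel. dirD i (A j) (x + s *\<^sub>R \<theta>) - dirD j (A i) (x + s *\<^sub>R \<theta>)) = 0"
proof -
  define \<rho> where "\<rho> = norm \<theta> / 2"
  have \<rho>: "\<rho> > 0" using \<theta> by (simp add: \<rho>_def)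
  \<comment> \<open>On \<open>W\<close> directions are longer than \<open>\<rho>\<close> and base points are bounded, so that one truncation of the
    lines serves for all of them.\<close>
  define T where "T = (\<bar>R\<bar> + norm x + 1) / \<rho>"
  let ?c = "indicator {-T..T} :: real \<Rightarrow> complex"
  have c: "integrable lborel ?c" "\<And>s. ?c s \<noteq> 0 \<Longrightarrow> \<bar>s\<bar> \<le> T"
    by (rule integrable_Icc_indicator) (auto simp: indicator_def split: if_splits)
  have "integrable lborel (\<lambda>s. ?c s * of_real s)"
    by (intro integrable_indicator_cbox_continuous continuous_intros)
  then have sc: "integrable lborel (\<lambda>s. of_real s * ?c s)"
    by (simp add: mult.commute)
  define W where "W = {z::'a \<times> 'a. fst z \<in> U \<inter> ball 0 (norm x + 1) \<and> norm (snd z) > \<rho>}"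
  have W: "open W"
  proof -
    have "W = (U \<inter> ball 0 (norm x + 1)) \<times> {y. norm y > \<rho>}"
      by (auto simp: W_def)
    then show ?thesis
      using U by (auto intro!: open_Times open_norm_greater)
  qed
  have xW: "(x, \<theta>) \<in> W"
    using U \<theta> by (simp add: W_def \<rho>_def)
  have trunc: "(LINT s|lborel. g (fst z + s *\<^sub>R snd z)) = ray_integral ?c g z"
    if "z \<in> W" "\<And>x. norm x > R \<Longrightarrow> g x = 0" for g z
  proof -
    have "T * \<rho> \<le> T * norm (snd z)"
      using that(1) \<rho> by (intro mult_left_mono) (auto simp: W_def T_def)
    moreover have "R + norm (fst z) \<le> T * \<rho>"
      using that(1) \<rho> by (auto simp: W_def T_def)
    moreover have "snd z \<noteq> 0"
      using that(1) \<rho> by (auto simp: W_def)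
    ultimately show ?thesis
      using integral_ray_truncate[of R g "fst z" T "snd z" "\<lambda>_. 1", OF that(2)]
      by (simp add: ray_integral_def)
  qed
  have intb: "integrable lborel (\<lambda>s. ?c s * g (fst z + s *\<^sub>R snd z))" if "smooth g" for g :: "'a \<Rightarrow> complex" and z
    using affine_family_integrable[OF ray_family[OF c] that, of z] by simp
  define H where "H z = (\<Sum>b\<in>Basis. (z \<bullet> (0, b)) *\<^sub>R ray_integral ?c (A b) z)" for z
  have H0: "H z = 0" if z: "z \<in> W" for z
  proof -
    have z0: "snd z \<noteq> 0" "fst z \<in> U"
      using z \<rho> by (auto simp: W_def)
    have "H z = (\<Sum>b\<in>Basis. (snd z \<bullet> b) *\<^sub>R (LINT s|lborel. ?c s * A b (fst z + s *\<^sub>R snd z)))"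
      by (simp add: H_def ray_integral_def inner_prod_def)
    also have "\<dots> = (LINT s|lborel. (\<Sum>b\<in>Basis. (snd z \<bullet> b) *\<^sub>R (?c s * A b (fst z + s *\<^sub>R snd z))))"
      by (subst Bochner_Integration.integral_sum) (auto intro!: integrable_scaleR_right intb A)
    also have "\<dots> = ray_integral ?c (\<lambda>y. \<Sum>b\<in>Basis. (snd z \<bullet> b) *\<^sub>R A b y) z"
      by (simp add: ray_integral_def sum_distrib_left)
    also have "\<dots> = 0"
      using trunc[OF z, of "\<lambda>y. \<Sum>b\<in>Basis. (snd z \<bullet> b) *\<^sub>R A b y"] zero[OF z0(2,1)] A(2) by simp
    finally show ?thesis .
  qed
  have main: "ray_integral ?c (dirD i (A j)) (x, \<theta>) =
     - (\<Sum>b\<in>Basis. (\<theta> \<bullet> b) *\<^sub>R ray_integral (\<lambda>s. of_real s * ?c s) (dirD j (dirD i (A b))) (x, \<theta>))"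
    if i: "i \<in> Basis" and j: "j \<in> Basis" for i j
  proof -
    define G where "G z = (\<Sum>b\<in>Basis. (z \<bullet> (0, b)) *\<^sub>R ray_integral ?c (dirD i (A b)) z)" for z
    have "dirD (i, 0) H = G"
      unfolding H_def[abs_def] G_def[abs_def]
      by (subst dirD_sum)
         (auto intro!: sum.cong smooth_inner_scaleR smooth_ray_integral[OF c] A simp: fun_eq_iff dirD_inner_scaleR
           smooth_ray_integral[OF c] A dirD_ray_integral_fst[OF c] i)
    then have G0: "G z = 0" if "z \<in> W" for z
      using dirD_eq_0[where f = H and b = "(i, 0)", OF W that H0] by simp
    have "dirD (0, j) G (x, \<theta>) = (\<Sum>b\<in>Basis. dirD (0, j) (\<lambda>z. (z \<bullet> (0, b)) *\<^sub>R ray_integral ?c (dirD i (A b)) z) (x, \<theta>))"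
      unfolding G_def[abs_def]
      by (subst dirD_sum) (auto intro!: smooth_inner_scaleR smooth_ray_integral[OF c] smooth_dirD A i)
    also have "\<dots> = (\<Sum>b\<in>Basis. (\<theta> \<bullet> b) *\<^sub>R ray_integral (\<lambda>s. of_real s * ?c s) (dirD j (dirD i (A b))) (x, \<theta>)
        + (j \<bullet> b) *\<^sub>R ray_integral ?c (dirD i (A b)) (x, \<theta>))"
      by (intro sum.cong refl)
         (simp add: dirD_inner_scaleR smooth_ray_integral[OF c] smooth_dirD A i dirD_ray_integral_snd[OF c] j)
    also have "\<dots> = (\<Sum>b\<in>Basis. (\<theta> \<bullet> b) *\<^sub>R ray_integral (\<lambda>s. of_real s * ?c s) (dirD j (dirD i (A b))) (x, \<theta>))
        + ray_integral ?c (dirD i (A j)) (x, \<theta>)"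
      unfolding sum.distrib by (simp only: sum_Basis_pick[OF j])
    finally show ?thesis
      using dirD_eq_0[where f = G and b = "(0, j)", OF W xW G0] by (simp add: eq_neg_iff_add_eq_0 add.commute)
  qed
  have "(LINT s|lborel. dirD i (A j) (x + s *\<^sub>R \<theta>) - dirD j (A i) (x + s *\<^sub>R \<theta>))
     = ray_integral ?c (\<lambda>y. dirD i (A j) y - dirD j (A i) y) (x, \<theta>)"
    using trunc[OF xW, of "\<lambda>y. dirD i (A j) y - dirD j (A i) y"] dirD_support[of R "A i" _ j] dirD_support[of R "A j" _ i] A(2) ij
    by simp
  also have "\<dots> = ray_integral ?c (dirD i (A j)) (x, \<theta>) - ray_integral ?c (dirD j (A i)) (x, \<theta>)"
    using intb[OF smooth_dirD[OF A(1)], of i j "(x, \<theta>)"] intb[OF smooth_dirD[OF A(1)], of j i "(x, \<theta>)"] ij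
    by (simp add: ray_integral_def right_diff_distrib)
  also have "\<dots> = 0"
    using main[OF ij] main[OF ij(2,1)] dirD_commute[OF A(1) ij] by simp
  finally show ?thesis .
qed

section \<open>Constant coefficient operators\<close>

text \<open>Unlike \<open>ray_null\<close> this does not ask \<open>f\<close> to vanish on \<open>U\<close>: components of the curl satisfy it
before the operator \<open>P(D)\<close> is applied.\<close>

definition ray_free :: "'a::euclidean_space set \<Rightarrow> real \<Rightarrow> ('a \<Rightarrow> complex) \<Rightarrow> bool" where
  "ray_free U R f \<longleftrightarrow> smooth f \<and> (\<forall>x. norm x > R \<longrightarrow> f x = 0) \<and>
     (\<forall>x\<in>U. \<forall>\<theta>. \<theta> \<noteq> 0 \<longrightarrow> (LINT s|lborel. f (x + s *\<^sub>R \<theta>)) = 0)"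

lemma compactly_supported_ray_integrable:
  fixes f :: "'a::euclidean_space \<Rightarrow> complex"
  assumes f: "smooth f" "\<And>x. norm x > R \<Longrightarrow> f x = 0" and \<theta>: "\<theta> \<noteq> 0"
  shows "integrable lborel (\<lambda>s. f (x + s *\<^sub>R \<theta>))"
proof -
  define T where "T = (R + norm x) / norm \<theta>"
  have eq: "(\<lambda>s. f (x + s *\<^sub>R \<theta>)) = (\<lambda>s. indicator {-T..T} s * f (x + s *\<^sub>R \<theta>))"
  proof
    fix s
    show "f (x + s *\<^sub>R \<theta>) = indicator {-T..T} s * f (x + s *\<^sub>R \<theta>)"
    proof (cases "s \<in> {-T..T}")
      case False
      then have "T < \<bar>s\<bar>" by auto
      then have "R + norm x < norm (s *\<^sub>R \<theta>)"
        using \<theta> by (simp add: T_def divide_less_eq)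
      then have "norm (x + s *\<^sub>R \<theta>) > R"
        using norm_triangle_ineq4[of "x + s *\<^sub>R \<theta>" x] by simp
      then show ?thesis by (simp add: f)
    qed simp
  qed
  show ?thesis
  proof (subst eq)
    show "integrable lborel (\<lambda>s. indicator {-T..T} s * f (x + s *\<^sub>R \<theta>))"
      by (intro integrable_indicator_cbox_continuous continuous_on_compose2[OF smooth_continuous_on[OF f(1), of UNIV]]
          continuous_intros) auto
  qed
qed

lemma ray_free_dirD:
  assumes "ray_free U R f" "open U" "b \<in> Basis"
  shows "ray_free U R (dirD b f)"
  using assms dirD_support[of R f _ b] dirD_line_integral[of f R U _ _ b]
  unfolding ray_free_def by (auto simp: smooth_dirD)

lemma ray_free_cmult:
  assumes "ray_free U R f"
  shows "ray_free U R (\<lambda>x. c * f x)"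
  using assms unfolding ray_free_def by (auto simp: smooth_cmult)

lemma ray_free_sum:
  assumes "\<And>i. i \<in> I \<Longrightarrow> ray_free U R (f i)"
  shows "ray_free U R (\<lambda>x. \<Sum>i\<in>I. f i x)"
proof -
  have "(LINT s|lborel. (\<Sum>i\<in>I. f i (x + s *\<^sub>R \<theta>))) = 0" if "x \<in> U" "\<theta> \<noteq> 0" for x \<theta>
    using that assms
    by (subst Bochner_Integration.integral_sum)
       (auto simp: ray_free_def intro!: compactly_supported_ray_integrable[of _ R] sum.neutral)
  then show ?thesis
    using assms unfolding ray_free_def by (auto simp: smooth_sum)
qed

text \<open>The operators on functions are assembled in the same way as those on distributions, so that
convolution intertwines the two step by step (\<open>conv_diff_op\<close>).\<close>

definition D_fun :: "'n::finite \<Rightarrow> (real^'n \<Rightarrow> complex) \<Rightarrow> real^'n \<Rightarrow> complex" where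
  "D_fun j f = (\<lambda>x. - \<i> * dirD (axis j 1) f x)"

definition D_fun_pow :: "('n::finite \<Rightarrow>\<^sub>0 nat) \<Rightarrow> (real^'n \<Rightarrow> complex) \<Rightarrow> real^'n \<Rightarrow> complex" where
  "D_fun_pow \<alpha> f = foldr (\<lambda>j. D_fun j ^^ Poly_Mapping.lookup \<alpha> j) index_list f"

definition diff_op_fun :: "'n::finite polynomial \<Rightarrow> (real^'n \<Rightarrow> complex) \<Rightarrow> real^'n \<Rightarrow> complex" where
  "diff_op_fun P f x = (\<Sum>\<alpha>\<in>Poly_Mapping.keys P. Poly_Mapping.lookup P \<alpha> * D_fun_pow \<alpha> f x)"

lemma D_fun_pow_invariant:
  assumes "Q f" "\<And>j f. Q f \<Longrightarrow> Q (D_fun j f)"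
  shows "Q (D_fun_pow \<alpha> f)"
proof -
  have pow: "Q ((D_fun j ^^ m) f)" if "Q f" for j m f
    using that by (induction m) (auto intro: assms(2))
  have "Q (foldr (\<lambda>j. D_fun j ^^ Poly_Mapping.lookup \<alpha> j) js f)" for js
    by (induction js) (auto intro: assms(1) pow)
  then show ?thesis
    by (simp add: D_fun_pow_def)
qed

lemma ray_free_diff_op_fun:
  assumes "ray_free U R f" "open U"
  shows "ray_free U R (diff_op_fun P f)"
proof -
  have "ray_free U R (D_fun_pow \<alpha> f)" for \<alpha>
    by (rule D_fun_pow_invariant[where Q = "ray_free U R", OF assms(1)])
       (auto simp: D_fun_def intro!: ray_free_dirD[OF _ assms(2)] ray_free_cmult[where c = "-\<i>", simplified])
  then show ?thesis
    unfolding diff_op_fun_def[abs_def] by (intro ray_free_sum ray_free_cmult)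
qed

lemma conv_dist_D:
  assumes "compact_distribution u" "smooth \<phi>"
  shows "conv (dist_D j u) \<phi> = D_fun j (conv u \<phi>)"
  using conv_dist_partial[OF assms, of j]
  by (auto simp: conv_def dist_D_def D_fun_def fun_eq_iff partial_eq_dirD)

lemma conv_diff_op:
  assumes u: "compact_distribution u" and \<phi>: "smooth \<phi>"
  shows "conv (diff_op P u) \<phi> = diff_op_fun P (conv u \<phi>)"
proof -
  have pow: "compact_distribution ((dist_D j ^^ m) v) \<and> conv ((dist_D j ^^ m) v) \<phi> = (D_fun j ^^ m) (conv v \<phi>)"
    if "compact_distribution v" for j m v
    by (induction m) (auto simp: that compact_distribution_dist_D conv_dist_D \<phi>)
  have "compact_distribution (foldr (\<lambda>j. dist_D j ^^ Poly_Mapping.lookup \<alpha> j) js u) \<and>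
    conv (foldr (\<lambda>j. dist_D j ^^ Poly_Mapping.lookup \<alpha> j) js u) \<phi>
     = foldr (\<lambda>j. D_fun j ^^ Poly_Mapping.lookup \<alpha> j) js (conv u \<phi>)" for \<alpha> js
    by (induction js) (auto simp: u pow)
  then have eq: "conv (dist_D_pow \<alpha> u) \<phi> x = D_fun_pow \<alpha> (conv u \<phi>) x" for \<alpha> x
    by (simp add: dist_D_pow_def D_fun_pow_def)
  have "dist_D_pow \<alpha> u (\<lambda>y. \<phi> (x - y)) = D_fun_pow \<alpha> (conv u \<phi>) x" for \<alpha> x
    using eq[of \<alpha> x] by (simp add: conv_def[of "dist_D_pow \<alpha> u"])
  then show ?thesis
    by (simp only: fun_eq_iff conv_def[of "diff_op P u"]) (simp add: diff_op_def diff_op_fun_def)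
qed

text \<open>For compactly supported functions the Fourier transform may be replaced by the two-sided Laplace transform at
real arguments. Its kernels are real and closed under multiplication, as the Stone-Weierstrass
theorem requires.\<close>

definition csmooth :: "real \<Rightarrow> ('a::euclidean_space \<Rightarrow> complex) \<Rightarrow> bool" where
  "csmooth R f \<longleftrightarrow> smooth f \<and> (\<forall>x. norm x > R \<longrightarrow> f x = 0)"

definition laplace :: "('a::euclidean_space \<Rightarrow> complex) \<Rightarrow> 'a \<Rightarrow> complex" where
  "laplace f \<zeta> = (LINT y|lborel. f y * of_real (exp (y \<bullet> \<zeta>)))"

lemma csmooth_dirD: "csmooth R f \<Longrightarrow> b \<in> Basis \<Longrightarrow> csmooth R (dirD b f)"
  using dirD_support[of R f] unfolding csmooth_def by (auto simp: smooth_dirD)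

lemma csmooth_integrable:
  assumes "csmooth R f" "continuous_on UNIV g"
  shows "integrable lborel (\<lambda>y. f y * g y)"
proof -
  have "(\<lambda>y. f y * g y) = (\<lambda>y. indicator (cball 0 R) y *\<^sub>R (f y * g y))"
    using assms(1) by (auto simp: csmooth_def indicator_def fun_eq_iff)
  moreover have "integrable lborel (\<lambda>y. indicator (cball 0 R) y *\<^sub>R (f y * g y))"
    using assms by (intro borel_integrable_compact continuous_intros)
       (auto simp: csmooth_def smooth_continuous_on intro: continuous_on_subset)
  ultimately show ?thesis by simp
qed

lemma smooth_exp: "smooth (\<lambda>t::real. complex_of_real (exp t))"
proof -
  have "Ck k (\<lambda>t::real. complex_of_real (exp t))" for k
  proof (induction k)
    case (Suc k)
    show ?case
    proof (rule Ck_SucI)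
      show "((\<lambda>t::real. complex_of_real (exp t)) has_derivative (\<lambda>v. complex_of_real (v * exp t))) (at t)" for t
        by (auto intro!: derivative_eq_intros)
    qed (use Suc in simp)
  qed simp
  then show ?thesis
    by (simp add: smooth_iff_Ck)
qed

lemma integral_lborel_translate:
  fixes g :: "'a::euclidean_space \<Rightarrow> complex"
  assumes "g \<in> borel_measurable borel"
  shows "(LINT x|lborel. g (c + x)) = (LINT x|lborel. g x)"
  using integral_distr[of "(+) c" lborel borel g] assms by (simp add: lborel_distr_plus)

text \<open>Translating \<open>f\<close> by \<open>t b\<close> multiplies the transform by \<open>exp (- t (b \<bullet> \<zeta>))\<close>; compare the derivatives at
\<open>t = 0\<close>. This avoids integration by parts in several variables.\<close>

lemma laplace_dirD:
  fixes f :: "'a::euclidean_space \<Rightarrow> complex"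
  assumes f: "csmooth R f" and b: "b \<in> Basis"
  shows "laplace (dirD b f) \<zeta> = - of_real (\<zeta> \<bullet> b) * laplace f \<zeta>"
proof -
  have sm: "smooth f" and f0: "\<And>x. norm x > R \<Longrightarrow> f x = 0"
    using f by (auto simp: csmooth_def)
  define c :: "'a \<Rightarrow> complex" where "c x = indicator (cball 0 (\<bar>R\<bar> + 1)) x *\<^sub>R of_real (exp (x \<bullet> \<zeta>))" for x
  have c: "integrable lborel c"
    unfolding c_def by (intro borel_integrable_compact continuous_intros) auto
  have A: "affine_family lborel c (\<lambda>x. x) (\<lambda>x (t::real). t *\<^sub>R b)"
    unfolding affine_family_def
  proof (intro conjI)
    show "\<exists>P. \<forall>x. c x \<noteq> 0 \<longrightarrow> norm x \<le> P"
      by (intro exI[of _ "\<bar>R\<bar> + 1"]) (auto simp: c_def indicator_def split: if_splits)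
  qed (use c b in \<open>auto intro!: linearI exI[of _ 1] simp: scaleR_add_left\<close>)
  let ?J = "\<lambda>t::real. LINT x|lborel. c x * f (x + t *\<^sub>R b)"
  have J: "?J t = of_real (exp (- t * (b \<bullet> \<zeta>))) * laplace f \<zeta>" if t: "\<bar>t\<bar> < 1" for t
  proof -
    have [measurable]: "f \<in> borel_measurable borel"
      by (rule borel_measurable_smooth[OF sm])
    have "?J t = (LINT x|lborel. of_real (exp (- t * (b \<bullet> \<zeta>))) * (f (t *\<^sub>R b + x) * of_real (exp ((t *\<^sub>R b + x) \<bullet> \<zeta>))))"
    proof (rule Bochner_Integration.integral_cong)
      fix x
      have e: "exp (x \<bullet> \<zeta>) = exp (- t * (b \<bullet> \<zeta>)) * exp ((t *\<^sub>R b + x) \<bullet> \<zeta>)"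
        by (simp add: exp_add[symmetric] inner_add_left)
      show "c x * f (x + t *\<^sub>R b) = of_real (exp (- t * (b \<bullet> \<zeta>))) * (f (t *\<^sub>R b + x) * of_real (exp ((t *\<^sub>R b + x) \<bullet> \<zeta>)))"
      proof (cases "norm (x + t *\<^sub>R b) > R")
        case True
        then show ?thesis
          using f0 by (simp add: add.commute)
      next
        case False
        have "norm x \<le> norm (x + t *\<^sub>R b) + norm (t *\<^sub>R b)"
          using norm_triangle_ineq4[of "x + t *\<^sub>R b" "t *\<^sub>R b"] by simp
        then have "norm x \<le> \<bar>R\<bar> + 1"
          using False t b by simp
        then have "c x = of_real (exp (x \<bullet> \<zeta>))"
          by (simp add: c_def)
        then show ?thesis
          by (simp only: e of_real_mult add.commute mult_ac)
      qed
    qed simp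
    also have "\<dots> = of_real (exp (- t * (b \<bullet> \<zeta>))) * (LINT x|lborel. f (t *\<^sub>R b + x) * of_real (exp ((t *\<^sub>R b + x) \<bullet> \<zeta>)))"
      by simp
    also have "(LINT x|lborel. f (t *\<^sub>R b + x) * of_real (exp ((t *\<^sub>R b + x) \<bullet> \<zeta>))) = laplace f \<zeta>"
      unfolding laplace_def by (rule integral_lborel_translate[of "\<lambda>y. f y * of_real (exp (y \<bullet> \<zeta>))"]) simp
    finally show ?thesis .
  qed
  have "dirD 1 ?J 0 = (\<Sum>b'\<in>Basis. LINT x|lborel. ((b \<bullet> b') *\<^sub>R c x) * dirD b' f x)"
    using affine_family_dirD[OF A sm, of 1 0] by simp
  also have "\<dots> = (\<Sum>b'\<in>Basis. (b \<bullet> b') *\<^sub>R (LINT x|lborel. c x * dirD b' f x))"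
    by simp
  also have "\<dots> = (LINT x|lborel. c x * dirD b f x)"
    by (simp only: sum_Basis_pick[OF b])
  also have "\<dots> = laplace (dirD b f) \<zeta>"
    unfolding laplace_def
  proof (rule Bochner_Integration.integral_cong)
    fix x
    show "c x * dirD b f x = dirD b f x * of_real (exp (x \<bullet> \<zeta>))"
      using dirD_support[of R f x b, OF f0] by (cases "norm x > R") (auto simp: c_def indicator_def)
  qed simp
  finally have 1: "dirD 1 ?J 0 = laplace (dirD b f) \<zeta>" .
  have "dirD 1 ?J 0 = dirD 1 (\<lambda>t::real. of_real (exp (- t * (b \<bullet> \<zeta>))) * laplace f \<zeta>) 0"
    by (rule dirD_local[of "ball 0 1"]) (use J in auto)
  also have "\<dots> = - of_real (\<zeta> \<bullet> b) * laplace f \<zeta>"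
  proof -
    have D: "((\<lambda>t::real. of_real (exp (- t * (b \<bullet> \<zeta>))) * laplace f \<zeta>) has_derivative
       (\<lambda>v::real. - of_real v * of_real (\<zeta> \<bullet> b) * laplace f \<zeta>)) (at 0)"
      by (auto intro!: derivative_eq_intros simp: inner_commute)
    show ?thesis
      using dirD_eqI[OF D, of 1] by simp
  qed
  finally show ?thesis
    using 1 by simp
qed

lemma laplace_cmult: "laplace (\<lambda>x. c * f x) \<zeta> = c * laplace f \<zeta>"
  by (simp add: laplace_def mult.assoc)

lemma continuous_laplace:
  fixes f :: "'a::euclidean_space \<Rightarrow> complex"
  assumes f: "csmooth R f"
  shows "continuous_on UNIV (laplace f)"
proof -
  have "affine_family lborel f (\<lambda>_. 0) (\<lambda>y \<zeta>. y \<bullet> \<zeta>)"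
    unfolding affine_family_def
  proof (intro conjI)
    show "integrable lborel f"
      using csmooth_integrable[OF f, of "\<lambda>_. 1"] by simp
    show "\<exists>l. \<forall>y (\<zeta>::'a). f y \<noteq> 0 \<longrightarrow> norm (y \<bullet> \<zeta>) \<le> l * norm \<zeta>"
    proof (intro exI[of _ R] allI impI)
      fix y \<zeta> :: 'a assume "f y \<noteq> 0"
      then have "norm y \<le> R"
        using f by (meson csmooth_def not_le)
      then show "norm (y \<bullet> \<zeta>) \<le> R * norm \<zeta>"
        using Cauchy_Schwarz_ineq2[of y \<zeta>] mult_right_mono[of "norm y" R "norm \<zeta>"] by simp
    qed
  qed (auto intro!: linearI simp: inner_add_right)
  from smooth_continuous_on[OF affine_family_smooth[OF this smooth_exp]]
  show ?thesis
    by (simp add: laplace_def[abs_def])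
qed

definition symbol :: "'n::finite polynomial \<Rightarrow> real^'n \<Rightarrow> complex" where
  "symbol P \<zeta> = (\<Sum>\<alpha>\<in>Poly_Mapping.keys P. Poly_Mapping.lookup P \<alpha> * (\<Prod>j\<in>UNIV. (\<i> * of_real (\<zeta> $ j)) ^ Poly_Mapping.lookup \<alpha> j))"

lemma index_list: "distinct (index_list :: 'n::finite list)" "set (index_list :: 'n list) = UNIV"
proof -
  have "\<exists>js :: 'n list. distinct js \<and> set js = UNIV"
    using finite_distinct_list[of "UNIV :: 'n set"] by auto
  from someI_ex[OF this] show "distinct (index_list :: 'n::finite list)" "set (index_list :: 'n list) = UNIV"
    unfolding index_list_def by auto
qed

lemma csmooth_D_fun: "csmooth R f \<Longrightarrow> csmooth R (D_fun j f)"
  using csmooth_dirD[of R f "axis j 1"] smooth_cmult[of _ "-\<i>"] by (auto simp: csmooth_def D_fun_def)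

lemma laplace_D_fun:
  assumes "csmooth R f"
  shows "laplace (D_fun j f) \<zeta> = (\<i> * of_real (\<zeta> $ j)) * laplace f \<zeta>"
  using laplace_dirD[OF assms, of "axis j 1" \<zeta>]
  by (simp only: D_fun_def laplace_cmult) (simp add: inner_axis)

lemma laplace_D_fun_pow:
  assumes "csmooth R f"
  shows "laplace (D_fun_pow \<alpha> f) \<zeta> = (\<Prod>j\<in>UNIV. (\<i> * of_real (\<zeta> $ j)) ^ Poly_Mapping.lookup \<alpha> j) * laplace f \<zeta>"
proof -
  have pow: "csmooth R ((D_fun j ^^ m) f) \<and> laplace ((D_fun j ^^ m) f) \<zeta> = (\<i> * of_real (\<zeta> $ j)) ^ m * laplace f \<zeta>"
    if "csmooth R f" for j m f
    by (induction m) (auto simp: that csmooth_D_fun laplace_D_fun simp del: of_real_power)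
  have "csmooth R (foldr (\<lambda>j. D_fun j ^^ Poly_Mapping.lookup \<alpha> j) js f) \<and>
    laplace (foldr (\<lambda>j. D_fun j ^^ Poly_Mapping.lookup \<alpha> j) js f) \<zeta>
      = (\<Prod>j\<leftarrow>js. (\<i> * of_real (\<zeta> $ j)) ^ Poly_Mapping.lookup \<alpha> j) * laplace f \<zeta>" for js
    by (induction js) (auto simp: assms pow)
  then show ?thesis
    using prod.distinct_set_conv_list[OF index_list(1), of "\<lambda>j. (\<i> * of_real (\<zeta> $ j)) ^ Poly_Mapping.lookup \<alpha> j"]
    by (simp add: D_fun_pow_def index_list(2))
qed

lemma laplace_diff_op_fun:
  assumes f: "csmooth R f"
  shows "laplace (diff_op_fun P f) \<zeta> = symbol P \<zeta> * laplace f \<zeta>"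
proof -
  have cs: "csmooth R (D_fun_pow \<alpha> f)" for \<alpha>
    by (rule D_fun_pow_invariant[where Q = "csmooth R", OF f csmooth_D_fun])
  have "laplace (diff_op_fun P f) \<zeta> = (LINT y|lborel. (\<Sum>\<alpha>\<in>Poly_Mapping.keys P.
      Poly_Mapping.lookup P \<alpha> * (D_fun_pow \<alpha> f y * of_real (exp (y \<bullet> \<zeta>)))))"
    by (simp add: laplace_def diff_op_fun_def sum_distrib_right mult.assoc)
  also have "\<dots> = (\<Sum>\<alpha>\<in>Poly_Mapping.keys P. Poly_Mapping.lookup P \<alpha> * laplace (D_fun_pow \<alpha> f) \<zeta>)"
    by (subst Bochner_Integration.integral_sum)
       (auto intro!: integrable_mult_right csmooth_integrable[OF cs] continuous_intros simp: laplace_def)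
  also have "\<dots> = symbol P \<zeta> * laplace f \<zeta>"
    by (simp add: laplace_D_fun_pow[OF f] symbol_def sum_distrib_right mult.assoc)
  finally show ?thesis .
qed

text \<open>Kronecker's substitution: with the powers of a number \<open>N\<close> exceeding all exponents as weights, the
weighted degree is an expansion in base \<open>N\<close> and determines the multi-index.\<close>

lemma separating_weights:
  fixes S :: "('n::finite \<Rightarrow>\<^sub>0 nat) set"
  assumes "finite S"
  obtains w :: "'n \<Rightarrow> nat" where "\<And>j. w j \<ge> 1"
    "inj_on (\<lambda>\<alpha>. \<Sum>j\<in>UNIV. Poly_Mapping.lookup \<alpha> j * w j) S"
proof -
  obtain e :: "'n \<Rightarrow> nat" where e: "inj e"
    using finite_imp_inj_to_nat_seg[of "UNIV :: 'n set"] by auto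
  define N where "N = Suc (\<Sum>\<alpha>\<in>S. \<Sum>j\<in>UNIV. Poly_Mapping.lookup \<alpha> j)"
  have N: "Poly_Mapping.lookup \<alpha> j < N" if "\<alpha> \<in> S" for \<alpha> j
  proof -
    have "Poly_Mapping.lookup \<alpha> j \<le> (\<Sum>j\<in>UNIV. Poly_Mapping.lookup \<alpha> j)"
      by (rule member_le_sum) auto
    also have "\<dots> \<le> (\<Sum>\<alpha>\<in>S. \<Sum>j\<in>UNIV. Poly_Mapping.lookup \<alpha> j)"
      using that assms by (intro member_le_sum) auto
    finally show ?thesis by (simp add: N_def)
  qed
  show ?thesis
  proof (rule that[of "\<lambda>j. N ^ e j"])
    show "N ^ e j \<ge> 1" for j
      by (simp add: N_def)
    show "inj_on (\<lambda>\<alpha>. \<Sum>j\<in>UNIV. Poly_Mapping.lookup \<alpha> j * N ^ e j) S"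
    proof (rule inj_onI, rule ccontr)
      fix \<alpha> \<beta> assume \<alpha>: "\<alpha> \<in> S" and \<beta>: "\<beta> \<in> S" and neq: "\<alpha> \<noteq> \<beta>"
        and eq: "(\<Sum>j\<in>UNIV. Poly_Mapping.lookup \<alpha> j * N ^ e j) = (\<Sum>j\<in>UNIV. Poly_Mapping.lookup \<beta> j * N ^ e j)"
      define d where "d j = int (Poly_Mapping.lookup \<alpha> j) - int (Poly_Mapping.lookup \<beta> j)" for j
      have "\<exists>j. d j \<noteq> 0"
        using neq by (auto simp: d_def poly_mapping_eq_iff fun_eq_iff)
      then obtain j where j: "d j \<noteq> 0" "\<And>i. d i \<noteq> 0 \<Longrightarrow> e j \<le> e i"
        using ex_has_least_nat[of "\<lambda>j. d j \<noteq> 0" _ e] by blast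
      have "int (\<Sum>j\<in>UNIV. Poly_Mapping.lookup \<alpha> j * N ^ e j) = int (\<Sum>j\<in>UNIV. Poly_Mapping.lookup \<beta> j * N ^ e j)"
        using eq by simp
      then have "(\<Sum>i\<in>UNIV. d i * int N ^ e i) = 0"
        by (simp add: d_def left_diff_distrib sum_subtractf)
      also have "(\<Sum>i\<in>UNIV. d i * int N ^ e i) = d j * int N ^ e j + (\<Sum>i\<in>UNIV - {j}. d i * int N ^ e i)"
        by (simp add: sum.remove[of UNIV j])
      finally have "d j * int N ^ e j = - (\<Sum>i\<in>UNIV - {j}. d i * int N ^ e i)"
        by simp
      moreover have "int N ^ Suc (e j) dvd (\<Sum>i\<in>UNIV - {j}. d i * int N ^ e i)"
      proof (rule dvd_sum)
        fix i assume i: "i \<in> UNIV - {j}"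
        show "int N ^ Suc (e j) dvd d i * int N ^ e i"
        proof (cases "d i = 0")
          case False
          then have "e j \<le> e i" by (rule j(2))
          moreover have "e i \<noteq> e j"
            using i e by (auto dest: injD)
          ultimately show ?thesis
            by (intro dvd_mult le_imp_power_dvd) simp
        qed simp
      qed
      ultimately have "int N * int N ^ e j dvd d j * int N ^ e j"
        by simp
      then have dvd: "int N dvd d j"
        using N[OF \<alpha>, of j] by (subst (asm) dvd_times_right_cancel_iff) auto
      moreover have "\<bar>d j\<bar> < int N"
        using N[OF \<alpha>, of j] N[OF \<beta>, of j] by (auto simp: d_def abs_if)
      ultimately show False
        using dvd_imp_le_int[OF j(1) dvd] by simp
    qed
  qed
qed

lemma sum_poly_distinct_degrees_nonzero:
  fixes c :: "'i \<Rightarrow> complex" and q :: "'i \<Rightarrow> complex poly"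
  assumes "finite S" "S \<noteq> {}" "inj_on (\<lambda>i. degree (q i)) S"
    and "\<And>i. i \<in> S \<Longrightarrow> c i \<noteq> 0" "\<And>i. i \<in> S \<Longrightarrow> q i \<noteq> 0"
  shows "(\<Sum>i\<in>S. smult (c i) (q i)) \<noteq> 0"
proof -
  obtain m where m: "m \<in> S" "\<And>i. i \<in> S \<Longrightarrow> degree (q i) \<le> degree (q m)"
  proof -
    have "Max ((\<lambda>i. degree (q i)) ` S) \<in> (\<lambda>i. degree (q i)) ` S"
      using assms(1,2) by (intro Max_in) auto
    then obtain m where "m \<in> S" "degree (q m) = Max ((\<lambda>i. degree (q i)) ` S)"
      by auto
    then show ?thesis
      using assms(1) by (intro that[of m]) auto
  qed
  have "coeff (\<Sum>i\<in>S. smult (c i) (q i)) (degree (q m)) = (\<Sum>i\<in>S. if i = m then c m * lead_coeff (q m) else 0)"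
    unfolding coeff_sum
  proof (rule sum.cong)
    fix i assume i: "i \<in> S"
    show "coeff (smult (c i) (q i)) (degree (q m)) = (if i = m then c m * lead_coeff (q m) else 0)"
    proof (cases "i = m")
      case False
      then have "degree (q i) < degree (q m)"
        using m i assms(3) by (metis inj_onD le_neq_implies_less)
      then show ?thesis
        using False by (simp add: coeff_eq_0)
    qed simp
  qed simp
  also have "\<dots> = c m * lead_coeff (q m)"
    using m(1) assms(1) by simp
  finally have eq: "coeff (\<Sum>i\<in>S. smult (c i) (q i)) (degree (q m)) = c m * lead_coeff (q m)" .
  show ?thesis
  proof
    assume "(\<Sum>i\<in>S. smult (c i) (q i)) = 0"
    with eq have "c m * lead_coeff (q m) = 0"
      by simp
    then show False
      unfolding mult_eq_0_iff leading_coeff_0_iff using assms(4,5)[OF m(1)] by blast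
  qed
qed

text \<open>The symbol is nonzero at points arbitrarily close to \<open>\<zeta>\<close>. Along the curve \<open>\<zeta> + (t\<^sup>w\<^sub>j)\<^sub>j\<close> distinct
monomials become polynomials in \<open>t\<close> of distinct degrees, even after expanding around \<open>\<zeta>\<close>, so their
combination is a nonzero polynomial and has finitely many roots.\<close>

lemma symbol_nonzero_on_curve:
  fixes P :: "'n::finite polynomial"
  assumes "P \<noteq> 0"
  obtains w :: "'n \<Rightarrow> nat" where "\<And>j. w j \<ge> 1"
    "\<And>\<zeta>. \<forall>\<^sub>F t::real in at 0. symbol P (\<zeta> + (\<chi> j. t ^ w j)) \<noteq> 0"
proof -
  obtain w :: "'n \<Rightarrow> nat" where w: "\<And>j. w j \<ge> 1"
    "inj_on (\<lambda>\<alpha>. \<Sum>j\<in>UNIV. Poly_Mapping.lookup \<alpha> j * w j) (Poly_Mapping.keys P)"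
    by (rule separating_weights[OF finite_keys[of P]]) blast
  show ?thesis
  proof (rule that[OF w(1)])
    fix \<zeta> :: "real^'n"
    define l where "l j = smult \<i> ([:complex_of_real (\<zeta> $ j):] + monom 1 (w j))" for j
    define q where "q \<alpha> = (\<Prod>j\<in>UNIV. l j ^ Poly_Mapping.lookup \<alpha> j)" for \<alpha>
    have deg: "degree (l j) = w j" for j
      using w(1)[of j] by (simp add: l_def degree_add_eq_right degree_monom_eq)
    then have l0: "l j \<noteq> 0" for j
      using w(1)[of j] by (metis degree_0 not_one_le_zero)
    have "degree (q \<alpha>) = (\<Sum>j\<in>UNIV. Poly_Mapping.lookup \<alpha> j * w j)" for \<alpha>
      unfolding q_def using l0 by (simp add: degree_prod_eq_sum_degree degree_power_eq deg)
    then have Q: "(\<Sum>\<alpha>\<in>Poly_Mapping.keys P. smult (Poly_Mapping.lookup P \<alpha>) (q \<alpha>)) \<noteq> 0" (is "?Q \<noteq> 0")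
      using w(2) assms l0
      by (intro sum_poly_distinct_degrees_nonzero) (auto simp: q_def in_keys_iff)
    have eval: "poly ?Q (of_real t) = symbol P (\<zeta> + (\<chi> j. t ^ w j))" for t
      by (simp add: symbol_def poly_sum q_def poly_prod l_def poly_monom)
    have "finite {t::real. poly ?Q (of_real t) = 0}"
      using finite_vimageI[OF poly_roots_finite[OF Q], of "of_real :: real \<Rightarrow> complex"]
      by (simp add: inj_of_real vimage_def)
    then have "open (- ({t::real. poly ?Q (of_real t) = 0} - {0}))"
      by (intro open_Compl finite_imp_closed) auto
    then have "\<forall>\<^sub>F t in at 0. t \<in> - ({t::real. poly ?Q (of_real t) = 0} - {0})"
      by (intro eventually_at_in_open') auto
    moreover have "\<forall>\<^sub>F t::real in at 0. t \<noteq> 0"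
      by (simp add: eventually_at_filter)
    ultimately show "\<forall>\<^sub>F t::real in at 0. symbol P (\<zeta> + (\<chi> j. t ^ w j)) \<noteq> 0"
      unfolding eval[symmetric] by eventually_elim auto
  qed
qed

text \<open>The linear span of the real exponentials.\<close>

inductive_set exp_sums :: "('a::euclidean_space \<Rightarrow> real) set" where
  monomial: "(\<lambda>y. c * exp (y \<bullet> \<zeta>)) \<in> exp_sums"
| add: "f \<in> exp_sums \<Longrightarrow> g \<in> exp_sums \<Longrightarrow> (\<lambda>y. f y + g y) \<in> exp_sums"

lemma exp_sums_mult:
  assumes f: "f \<in> exp_sums" and g: "g \<in> exp_sums"
  shows "(\<lambda>y. f y * g y) \<in> exp_sums"
  using f
proof induction
  case (monomial c \<zeta>)
  show ?case
    using g
  proof induction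
    case (monomial d \<eta>)
    show ?case
      using exp_sums.monomial[of "c * d" "\<zeta> + \<eta>"]
      by (simp add: inner_add_right exp_add mult_ac)
  next
    case (add g h)
    then show ?case
      using exp_sums.add[OF add.IH] by (simp add: distrib_left)
  qed
next
  case (add f h)
  then show ?case
    using exp_sums.add[OF add.IH] by (simp add: distrib_right)
qed

lemma exp_sums_continuous: "f \<in> exp_sums \<Longrightarrow> continuous_on S f"
  by (induction rule: exp_sums.induct) (auto intro!: continuous_intros)

lemma function_ring_exp_sums:
  assumes "compact K"
  shows "function_ring_on exp_sums K"
proof
  show "(\<lambda>_. c) \<in> exp_sums" for c
    using exp_sums.monomial[of c 0] by simp
  show "\<exists>f\<in>exp_sums. f x \<noteq> f y" if "x \<noteq> y" for x y :: 'a
  proof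
    show "(\<lambda>z. 1 * exp (z \<bullet> (x - y))) \<in> exp_sums"
      by (rule exp_sums.monomial)
    have "(x - y) \<bullet> (x - y) \<noteq> 0"
      using that by simp
    then show "1 * exp (x \<bullet> (x - y)) \<noteq> 1 * exp (y \<bullet> (x - y))"
      by (simp add: inner_diff_left)
  qed
qed (auto intro: assms exp_sums_continuous exp_sums.add exp_sums_mult)

text \<open>The transform of \<open>P(D) f\<close> is the product of the symbol and the transform of \<open>f\<close>. The latter vanishes where
the symbol does not, hence everywhere by continuity, and \<open>f\<close> is orthogonal to all exponentials.\<close>

theorem diff_op_fun_injective:
  fixes P :: "'n::finite polynomial"
  assumes P: "P \<noteq> 0" and f: "csmooth R f" and zero: "\<And>x. diff_op_fun P f x = 0"
  shows "f x = 0"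
proof -
  obtain w :: "'n \<Rightarrow> nat" where w: "\<And>j. w j \<ge> 1"
    "\<And>\<zeta>. \<forall>\<^sub>F t::real in at 0. symbol P (\<zeta> + (\<chi> j. t ^ w j)) \<noteq> 0"
    by (rule symbol_nonzero_on_curve[OF P]) blast
  have L: "laplace f \<zeta> = 0" for \<zeta>
  proof (rule tendsto_unique)
    have "symbol P \<eta> * laplace f \<eta> = 0" for \<eta>
      unfolding laplace_diff_op_fun[OF f, symmetric] by (simp add: laplace_def zero)
    then have "\<forall>\<^sub>F t::real in at 0. laplace f (\<zeta> + (\<chi> j. t ^ w j)) = 0"
      by (intro eventually_mono[OF w(2)[of \<zeta>]]) (metis mult_eq_0_iff)
    then show "((\<lambda>t::real. laplace f (\<zeta> + (\<chi> j. t ^ w j))) \<longlongrightarrow> 0) (at 0)"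
      by (rule tendsto_eventually)
    have "((\<lambda>t::real. \<chi> j. t ^ w j) \<longlongrightarrow> (\<chi> j. 0 ^ w j)) (at 0)"
      by (intro tendsto_vec_lambda tendsto_intros)
    moreover have "(\<chi> j. 0 ^ w j) = (0 :: real^'n)"
      using w(1) by (simp add: vec_eq_iff power_0_left Suc_le_eq)
    ultimately have "((\<lambda>t::real. \<zeta> + (\<chi> j. t ^ w j)) \<longlongrightarrow> \<zeta>) (at 0)"
      using tendsto_add[OF tendsto_const] by fastforce
    then show "((\<lambda>t::real. laplace f (\<zeta> + (\<chi> j. t ^ w j))) \<longlongrightarrow> laplace f \<zeta>) (at 0)"
      using continuous_on_tendsto_compose[OF continuous_laplace[OF f]] by simp
  qed simp
  show ?thesis
  proof (rule function_ring_orthogonal[where g = f, OF function_ring_exp_sums[OF compact_cball[of 0 R]]])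
    show "continuous_on UNIV f"
      using f by (simp add: csmooth_def smooth_continuous_on)
    show "f y = 0" if "y \<notin> cball 0 R" for y
      using f that by (simp add: csmooth_def)
    fix q :: "real^'n \<Rightarrow> real" assume "q \<in> exp_sums"
    then show "(LINT y|lborel. f y * of_real (q y)) = 0"
    proof induction
      case (monomial c \<zeta>)
      have "(LINT y|lborel. f y * of_real (c * exp (y \<bullet> \<zeta>))) = (LINT y|lborel. of_real c * (f y * of_real (exp (y \<bullet> \<zeta>))))"
        by (simp add: mult_ac)
      also have "\<dots> = of_real c * laplace f \<zeta>"
        by (simp add: laplace_def)
      finally show ?case by (simp add: L)
    next
      case (add g h)
      have "integrable lborel (\<lambda>y. f y * of_real (k y))" if "k \<in> exp_sums" for k
        by (intro csmooth_integrable[OF f] continuous_intros exp_sums_continuous that)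
      with add show ?case
        by (simp add: distrib_left)
    qed
  qed
qed

section \<open>Bump functions and localisation\<close>

text \<open>The functions \<open>p(1/t) exp(-1/t)\<close>, extended by zero, form a class closed under differentiation; this
yields the smoothness of \<open>exp(-1/t)\<close>.\<close>

definition flat_fun :: "real poly \<Rightarrow> real \<Rightarrow> complex" where
  "flat_fun p t = (if t > 0 then of_real (poly p (1 / t) * exp (- (1 / t))) else 0)"

lemma flat_fun_lim:
  "((\<lambda>t. poly p (1 / t) * exp (- (1 / t))) \<longlongrightarrow> 0) (at_right (0::real))"
proof -
  have "((\<lambda>x. poly p x * exp (- x)) \<longlongrightarrow> 0) at_top"
  proof -
    have "((\<lambda>x. \<Sum>i\<le>degree p. coeff p i * (x ^ i / exp x)) \<longlongrightarrow> (\<Sum>i\<le>degree p. coeff p i * 0)) at_top"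
      by (intro tendsto_sum tendsto_mult tendsto_const tendsto_power_div_exp_0)
    then show ?thesis
      by (simp add: poly_altdef sum_distrib_right exp_minus divide_inverse mult.assoc)
  qed
  moreover have "filterlim (\<lambda>t::real. 1 / t) at_top (at_right 0)"
    using filterlim_inverse_at_top_right by (simp add: divide_inverse)
  ultimately show ?thesis
    by (rule filterlim_compose)
qed

definition flat_step :: "real poly \<Rightarrow> real poly" where
  "flat_step p = [:0, 0, 1:] * (p - pderiv p)"

lemma flat_fun_derivative:
  "(flat_fun p has_vector_derivative flat_fun (flat_step p) t) (at t)"
proof -
  consider "t > 0" | "t < 0" | "t = 0" by linarith
  then show ?thesis
  proof cases
    case 1
    have "((\<lambda>t. poly p (1 / t) * exp (- (1 / t))) has_real_derivative
        poly (flat_step p) (1 / t) * exp (- (1 / t))) (at t)"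
      using 1 by (auto intro!: derivative_eq_intros DERIV_chain2[OF poly_DERIV] simp: flat_step_def field_simps power2_eq_square)
    then have "((\<lambda>t. complex_of_real (poly p (1 / t) * exp (- (1 / t)))) has_vector_derivative
        complex_of_real (poly (flat_step p) (1 / t) * exp (- (1 / t)))) (at t)"
      by (rule has_vector_derivative_of_real)
    then have "(flat_fun p has_vector_derivative
        complex_of_real (poly (flat_step p) (1 / t) * exp (- (1 / t)))) (at t)"
      by (rule has_vector_derivative_transform_within_open[of _ _ _ "{0<..}"]) (use 1 in \<open>auto simp: flat_fun_def\<close>)
    with 1 show ?thesis by (simp add: flat_fun_def)
  next
    case 2
    have "(flat_fun p has_vector_derivative 0) (at t)"
      by (rule has_vector_derivative_transform_within_open[OF has_vector_derivative_const open_lessThan[of 0]])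
         (use 2 in \<open>auto simp: flat_fun_def\<close>)
    with 2 show ?thesis by (simp add: flat_fun_def)
  next
    case 3
    have "((\<lambda>h. norm (flat_fun p (0 + h) - flat_fun p 0 - h *\<^sub>R 0) / norm h) \<longlongrightarrow> 0) (at 0)"
      unfolding filterlim_at_split
    proof
      show "((\<lambda>h. norm (flat_fun p (0 + h) - flat_fun p 0 - h *\<^sub>R 0) / norm h) \<longlongrightarrow> 0) (at_left 0)"
        by (rule tendsto_eventually) (auto simp: eventually_at_filter flat_fun_def)
      have "((\<lambda>h::real. \<bar>poly ([:0, 1:] * p) (1 / h) * exp (- (1 / h))\<bar>) \<longlongrightarrow> 0) (at_right 0)"
        by (intro tendsto_rabs_zero flat_fun_lim)
      moreover have "\<forall>\<^sub>F h::real in at_right 0. \<bar>poly ([:0, 1:] * p) (1 / h) * exp (- (1 / h))\<bar>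
          = norm (flat_fun p (0 + h) - flat_fun p 0 - h *\<^sub>R 0) / norm h"
        by (auto simp: eventually_at_filter flat_fun_def abs_mult norm_mult)
      ultimately show "((\<lambda>h. norm (flat_fun p (0 + h) - flat_fun p 0 - h *\<^sub>R 0) / norm h) \<longlongrightarrow> 0) (at_right 0)"
        by (rule Lim_transform_eventually)
    qed
    then have "(flat_fun p has_derivative (\<lambda>h. h *\<^sub>R 0)) (at 0)"
      unfolding has_derivative_at by simp
    with 3 show ?thesis
      by (simp add: has_vector_derivative_def flat_fun_def)
  qed
qed

lemma smooth_flat_fun: "smooth (flat_fun p)"
proof -
  have "Ck k (flat_fun p)" for k p
  proof (induction k arbitrary: p)
    case (Suc k)
    show ?case
      by (rule Ck_SucI[OF flat_fun_derivative[unfolded has_vector_derivative_def]])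
         (use Suc in simp)
  qed simp
  then show ?thesis
    by (simp add: smooth_iff_Ck)
qed

definition flat :: "real \<Rightarrow> real" where
  "flat t = (if t > 0 then exp (- (1 / t)) else 0)"

lemma smooth_flat: "smooth (\<lambda>t. complex_of_real (flat t))"
proof -
  have "(\<lambda>t. complex_of_real (flat t)) = flat_fun 1"
    by (auto simp: flat_def flat_fun_def fun_eq_iff)
  then show ?thesis
    using smooth_flat_fun by simp
qed

lemma flat_nonneg: "flat t \<ge> 0" and flat_pos_iff: "flat t > 0 \<longleftrightarrow> t > 0" and flat_eq_0: "t \<le> 0 \<Longrightarrow> flat t = 0"
  by (auto simp: flat_def)

lemma smooth_inverse:
  fixes g :: "'a::euclidean_space \<Rightarrow> complex"
  assumes g: "smooth g" "\<And>x. g x \<noteq> 0"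
  shows "smooth (\<lambda>x. inverse (g x))"
proof -
  have "Ck k (\<lambda>x. inverse (g x))" for k
  proof (induction k)
    case (Suc k)
    show ?case
    proof (rule Ck_SucI)
      show "((\<lambda>x. inverse (g x)) has_derivative (\<lambda>v. - (inverse (g x) * dirD v g x * inverse (g x)))) (at x)" for x
        using smooth_differentiable[OF g(1), of x] g(2)[of x]
        by (intro Deriv.has_derivative_inverse) (auto simp: dirD_def frechet_derivative_works)
      fix b :: 'a assume "b \<in> Basis"
      then have "Ck k (dirD b g)"
        by (intro smooth_imp_Ck smooth_dirD g)
      then have "Ck k (\<lambda>x. (- 1) * (inverse (g x) * dirD b g x * inverse (g x)))"
        by (intro Ck_mult Ck_const Suc)
      then show "Ck k (\<lambda>x. - (inverse (g x) * dirD b g x * inverse (g x)))"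
        by simp
    qed
  qed simp
  then show ?thesis
    by (simp add: smooth_iff_Ck)
qed

definition smooth_step :: "real \<Rightarrow> real" where
  "smooth_step t = flat t / (flat t + flat (1 - t))"

lemma smooth_step_denominator: "flat t + flat (1 - t) > 0"
  using flat_nonneg[of t] flat_nonneg[of "1 - t"] flat_pos_iff[of t] flat_pos_iff[of "1 - t"]
  by (cases "t > 0") auto

lemma smooth_smooth_step: "smooth (\<lambda>t. complex_of_real (smooth_step t))"
proof -
  have "smooth (\<lambda>t::real. complex_of_real (flat (1 - t)))"
    by (rule smooth_reflect[OF smooth_flat])
  moreover have "complex_of_real (flat t) + complex_of_real (flat (1 - t)) \<noteq> 0" for t
    using smooth_step_denominator[of t] unfolding of_real_add[symmetric] of_real_eq_0_iff by simp
  ultimately have "smooth (\<lambda>t. complex_of_real (flat t) * inverse (complex_of_real (flat t) + complex_of_real (flat (1 - t))))"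
    by (intro smooth_mult smooth_inverse smooth_add smooth_flat)
  then show ?thesis
    by (simp add: smooth_step_def divide_inverse)
qed

lemma smooth_step_0: "t \<le> 0 \<Longrightarrow> smooth_step t = 0" and smooth_step_1: "t \<ge> 1 \<Longrightarrow> smooth_step t = 1"
  using smooth_step_denominator[of t] by (auto simp: smooth_step_def flat_eq_0)

text \<open>A difference of two translated steps, so that sums of its integer translates telescope to one.\<close>

definition bump :: "real \<Rightarrow> real" where
  "bump t = smooth_step (t + 1) - smooth_step t"

lemma smooth_bump: "smooth (\<lambda>t. complex_of_real (bump t))"
proof -
  have "smooth (\<lambda>t::real. complex_of_real (smooth_step (1 + t)) - complex_of_real (smooth_step t))"
    by (intro smooth_diff smooth_translate[OF smooth_smooth_step] smooth_smooth_step)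
  then show ?thesis
    by (simp add: bump_def add.commute)
qed

lemma bump_eq_0: "\<bar>t\<bar> \<ge> 1 \<Longrightarrow> bump t = 0"
  by (cases "t \<ge> 1") (auto simp: bump_def smooth_step_0 smooth_step_1 abs_if split: if_splits)

lemma sum_bump_translates:
  assumes "\<bar>t\<bar> \<le> real N"
  shows "(\<Sum>k\<in>{- int N..int N}. bump (t - of_int k)) = 1"
proof -
  have "(\<Sum>k\<in>{- int N..int N}. bump (t - of_int k)) = smooth_step (t + real N + 1) - smooth_step (t - real N)"
  proof (induction N)
    case (Suc N)
    have "{- int (Suc N)..int (Suc N)} = insert (- int (Suc N)) (insert (int (Suc N)) {- int N..int N})"
      by auto
    then have "(\<Sum>k\<in>{- int (Suc N)..int (Suc N)}. bump (t - of_int k)) =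
       bump (t + real N + 1) + (bump (t - real N - 1) + (\<Sum>k\<in>{- int N..int N}. bump (t - of_int k)))"
      by (simp add: algebra_simps)
    then show ?case
      using Suc by (simp add: bump_def algebra_simps)
  qed (simp add: bump_def)
  then show ?thesis
    using assms by (simp add: smooth_step_0 smooth_step_1)
qed

text \<open>Values of \<open>conv u \<phi>\<close> are the values of \<open>u\<close> on all reflected translates of \<open>\<phi>\<close>, so \<open>u\<close> vanishes on every
smooth function with support in some ball of radius \<open>\<epsilon>\<close>. Products of bumps on a grid of mesh \<open>\<delta>\<close> split an
arbitrary \<open>f\<close> into finitely many such functions on the ball that \<open>u\<close> sees.\<close>

lemma compact_distribution_eq_0_if_conv_eq_0:
  fixes u :: "'a::euclidean_space functional"
  assumes u: "compact_distribution u" and \<epsilon>: "\<epsilon> > 0"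
    and conv0: "\<And>\<phi> x. smooth \<phi> \<Longrightarrow> (\<And>y. norm y > \<epsilon> \<Longrightarrow> \<phi> y = 0) \<Longrightarrow> conv u \<phi> x = 0"
    and f: "smooth f"
  shows "u f = 0"
proof -
  obtain R where R: "R > 0"
    "\<And>f g. smooth f \<Longrightarrow> smooth g \<Longrightarrow> (\<And>x. norm x < R \<Longrightarrow> f x = g x) \<Longrightarrow> u f = u g"
    by (rule compact_distribution_local[OF u]) blast
  \<comment> \<open>A cube of half side \<open>\<delta>\<close> lies in the ball of radius \<open>\<epsilon>\<close>.\<close>
  define \<delta> where "\<delta> = \<epsilon> / DIM('a)"
  have \<delta>: "\<delta> > 0" using \<epsilon> by (simp add: \<delta>_def)
  obtain N :: nat where N: "R / \<delta> \<le> real N"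
    using real_arch_simple by blast
  define I where "I = (\<Pi>\<^sub>E b\<in>(Basis::'a set). {- int N..int N})"
  have finI: "finite I"
    unfolding I_def by (intro finite_PiE) auto
  define \<psi> where "\<psi> k x = (\<Prod>b\<in>Basis. complex_of_real (bump ((x \<bullet> b) / \<delta> - of_int (k b))))" for k and x :: 'a
  have sm\<psi>: "smooth (\<psi> k)" for k
  proof -
    have "smooth (\<lambda>x::'a. complex_of_real (bump (- of_int (k b) + (x \<bullet> b) / \<delta>)))" if "b \<in> Basis" for b
      by (rule smooth_compose_affine[OF _ smooth_bump]) (auto intro!: linearI simp: inner_add_left add_divide_distrib)
    then show ?thesis
      unfolding \<psi>_def[abs_def] by (intro smooth_prod) (simp add: algebra_simps)
  qed
  have sum1: "(\<Sum>k\<in>I. \<psi> k x) = 1" if "norm x < R" for x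
  proof -
    have "(\<Sum>k\<in>I. \<psi> k x) = (\<Prod>b\<in>Basis. \<Sum>k\<in>{- int N..int N}. complex_of_real (bump ((x \<bullet> b) / \<delta> - of_int k)))"
      unfolding \<psi>_def I_def by (rule prod_sum_PiE[symmetric]) auto
    also have "\<dots> = (\<Prod>b\<in>(Basis::'a set). 1)"
    proof (rule prod.cong)
      fix b :: 'a assume b: "b \<in> Basis"
      have "\<bar>x \<bullet> b\<bar> \<le> R"
        using Basis_le_norm[OF b, of x] that by linarith
      then have "\<bar>(x \<bullet> b) / \<delta>\<bar> \<le> R / \<delta>"
        using \<delta> by (simp add: abs_divide divide_right_mono)
      then have "(\<Sum>k\<in>{- int N..int N}. bump ((x \<bullet> b) / \<delta> - of_int k)) = 1"
        using N by (intro sum_bump_translates) linarith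
      then show "(\<Sum>k\<in>{- int N..int N}. complex_of_real (bump ((x \<bullet> b) / \<delta> - of_int k))) = 1"
        by (metis of_real_1 of_real_sum)
    qed simp
    finally show ?thesis by simp
  qed
  have piece: "u (\<lambda>x. \<psi> k x * f x) = 0" for k
  proof -
    define c :: 'a where "c = (\<Sum>b\<in>Basis. (\<delta> * of_int (k b)) *\<^sub>R b)"
    let ?\<phi> = "\<lambda>y. \<psi> k (c - y) * f (c - y)"
    have "conv u ?\<phi> c = 0"
    proof (rule conv0)
      show "smooth ?\<phi>"
        by (intro smooth_mult smooth_reflect sm\<psi> f)
      fix y :: 'a assume y: "norm y > \<epsilon>"
      have "\<exists>b\<in>Basis. \<bar>y \<bullet> b\<bar> > \<delta>"
      proof (rule ccontr)
        assume "\<not> (\<exists>b\<in>Basis. \<bar>y \<bullet> b\<bar> > \<delta>)"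
        then have "(\<Sum>b\<in>Basis. \<bar>y \<bullet> b\<bar>) \<le> (\<Sum>b\<in>(Basis::'a set). \<delta>)"
          by (intro sum_mono) (auto simp: not_less)
        then show False
          using norm_le_l1[of y] y by (simp add: \<delta>_def)
      qed
      then obtain b where b: "b \<in> Basis" "\<bar>y \<bullet> b\<bar> > \<delta>" by blast
      have "((c - y) \<bullet> b) / \<delta> - of_int (k b) = - (y \<bullet> b) / \<delta>"
        using b(1) \<delta> by (simp add: c_def inner_diff_left inner_sum_left inner_Basis if_distrib diff_divide_distrib cong: if_cong)
      moreover have "\<bar>- (y \<bullet> b) / \<delta>\<bar> \<ge> 1"
        using b(2) \<delta> by (simp add: abs_divide)
      ultimately have "bump (((c - y) \<bullet> b) / \<delta> - of_int (k b)) = 0"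
        by (simp only: bump_eq_0)
      then have "\<psi> k (c - y) = 0"
        unfolding \<psi>_def using b(1) by (intro prod_zero) auto
      then show "?\<phi> y = 0" by simp
    qed
    then show ?thesis
      by (simp add: conv_def)
  qed
  have "u f = u (\<lambda>x. \<Sum>k\<in>I. \<psi> k x * f x)"
  proof (rule R(2)[OF f])
    show "smooth (\<lambda>x. \<Sum>k\<in>I. \<psi> k x * f x)"
      by (intro smooth_sum smooth_mult sm\<psi> f)
    show "f x = (\<Sum>k\<in>I. \<psi> k x * f x)" if "norm x < R" for x
      using sum1[OF that] by (simp add: sum_distrib_right[symmetric])
  qed
  also have "\<dots> = (\<Sum>k\<in>I. u (\<lambda>x. \<psi> k x * f x))"
    by (rule compact_distribution_sum[OF u]) (intro smooth_mult sm\<psi> f)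
  finally show ?thesis
    by (simp add: piece)
qed

section \<open>Closed compactly supported one-forms are exact\<close>

text \<open>\<open>shrink e t\<close> multiplies the coordinate along \<open>e\<close> by \<open>t\<close>, and \<open>primitive e f\<close> is the primitive of \<open>f\<close> along \<open>e\<close>
that vanishes where this coordinate is zero. Writing it as an integral over the fixed interval
\<open>[0, 1]\<close> makes it a parameter integral.\<close>

definition shrink :: "'a::euclidean_space \<Rightarrow> real \<Rightarrow> 'a \<Rightarrow> 'a" where
  "shrink e t x = x + ((t - 1) * (x \<bullet> e)) *\<^sub>R e"

definition primitive :: "'a::euclidean_space \<Rightarrow> ('a \<Rightarrow> complex) \<Rightarrow> 'a \<Rightarrow> complex" where
  "primitive e f x = (x \<bullet> e) *\<^sub>R (LINT t|lborel. indicator {0..1} t * f (shrink e t x))"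

lemma norm_shrink_le:
  fixes x :: "'a::euclidean_space"
  assumes e: "e \<in> Basis" and t: "t \<in> {0..1}"
  shows "norm (shrink e t x) \<le> norm x"
proof -
  have "norm (x - (x \<bullet> e) *\<^sub>R e) \<le> norm x"
  proof (rule power2_le_imp_le)
    have "(norm (x - (x \<bullet> e) *\<^sub>R e))\<^sup>2 = (norm x)\<^sup>2 - (x \<bullet> e)\<^sup>2"
      unfolding power2_norm_eq_inner using e by (simp add: algebra_simps inner_commute power2_eq_square)
    then show "(norm (x - (x \<bullet> e) *\<^sub>R e))\<^sup>2 \<le> (norm x)\<^sup>2" by simp
  qed simp
  then have "(1 - t) * norm (x - (x \<bullet> e) *\<^sub>R e) \<le> (1 - t) * norm x"
    using t by (intro mult_left_mono) auto
  moreover have "shrink e t x = t *\<^sub>R x + (1 - t) *\<^sub>R (x - (x \<bullet> e) *\<^sub>R e)"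
    by (simp add: shrink_def algebra_simps)
  then have "norm (shrink e t x) \<le> t * norm x + (1 - t) * norm (x - (x \<bullet> e) *\<^sub>R e)"
    using t norm_triangle_ineq[of "t *\<^sub>R x" "(1 - t) *\<^sub>R (x - (x \<bullet> e) *\<^sub>R e)"] by simp
  ultimately show ?thesis
    by (simp add: algebra_simps)
qed

lemma shrink_family:
  assumes "e \<in> Basis"
  shows "affine_family lborel (indicator {0..1}) (\<lambda>_. 0) (shrink e)"
  unfolding affine_family_def
proof (intro conjI)
  show "integrable lborel (indicator {0..1} :: real \<Rightarrow> complex)"
    by (rule integrable_Icc_indicator)
  show "\<exists>l. \<forall>t v. indicator {0..1} t \<noteq> (0::complex) \<longrightarrow> norm (shrink e t v) \<le> l * norm v"
    using norm_shrink_le[OF assms] by (intro exI[of _ 1]) (auto simp: indicator_def split: if_splits)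
  show "\<forall>t. linear (shrink e t)"
    by (auto intro!: linearI simp: shrink_def algebra_simps)
qed (auto simp: shrink_def)

lemma smooth_primitive:
  assumes "e \<in> Basis" "smooth f"
  shows "smooth (primitive e f)"
  unfolding primitive_def[abs_def]
  using smooth_inner_scaleR[OF affine_family_smooth[OF shrink_family[OF assms(1)] assms(2)], of e] by simp

lemma dirD_primitive_other:
  assumes e: "e \<in> Basis" and f: "smooth f" and b: "b \<in> Basis" "b \<noteq> e"
  shows "dirD b (primitive e f) = primitive e (dirD b f)"
proof
  fix x
  let ?Q = "\<lambda>f x. LINT t|lborel. indicator {0..1} t * f (0 + shrink e t x)"
  have be: "b \<bullet> e = 0"
    using b e by (simp add: inner_Basis)
  have "dirD b (?Q f) x = (\<Sum>b'\<in>Basis. (b \<bullet> b') *\<^sub>R ?Q (dirD b' f) x)"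
    using affine_family_dirD[OF shrink_family[OF e] f, of b x] by (simp add: shrink_def be)
  then have "dirD b (?Q f) x = ?Q (dirD b f) x"
    by (simp only: sum_Basis_pick[OF b(1)])
  then show "dirD b (primitive e f) x = primitive e (dirD b f) x"
    using dirD_inner_scaleR[OF affine_family_smooth[OF shrink_family[OF e] f], of b e x]
    by (simp add: primitive_def[abs_def] be)
qed

lemma dirD_primitive_same:
  assumes e: "e \<in> Basis" and f: "smooth f"
  shows "dirD e (primitive e f) = f"
proof
  fix x
  let ?Q = "\<lambda>f x. LINT t|lborel. indicator {0..1} t * f (0 + shrink e t x)"
  define g where "g t = dirD e f (shrink e t x)" for t
  have ee: "shrink e t e = t *\<^sub>R e" for t
    using e by (simp add: shrink_def algebra_simps)
  have line: "shrink e t x = (x - (x \<bullet> e) *\<^sub>R e) + t *\<^sub>R ((x \<bullet> e) *\<^sub>R e)" for t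
    by (simp add: shrink_def algebra_simps)
  have cont: "continuous_on S (\<lambda>t. h (shrink e t x))" if "smooth h" for h S
    unfolding line
    by (intro continuous_on_compose2[OF smooth_continuous_on[OF that, of UNIV]] continuous_intros) auto
  have "dirD e (?Q f) x = (\<Sum>b'\<in>Basis. (e \<bullet> b') *\<^sub>R (LINT t|lborel. indicator {0..1} t * (of_real t * dirD b' f (shrink e t x))))"
    using affine_family_dirD[OF shrink_family[OF e] f, of e x]
    by (simp add: ee) (simp add: scaleR_conv_of_real mult_ac flip: integral_mult_right_zero)
  then have Q: "dirD e (?Q f) x = (LINT t|lborel. indicator {0..1} t * (of_real t * g t))"
    by (simp only: sum_Basis_pick[OF e] g_def)
  have der: "((\<lambda>t. f (shrink e t x)) has_vector_derivative ((x \<bullet> e) *\<^sub>R g t)) (at t within S)" for t S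
    using smooth_line_has_vector_derivative[OF f, of "x - (x \<bullet> e) *\<^sub>R e" "(x \<bullet> e) *\<^sub>R e" t S]
      sum_Basis_pick[OF e, of "\<lambda>b. dirD b f (shrink e t x)"]
    by (simp add: line[symmetric] g_def flip: scaleR_scaleR scaleR_sum_right)
  have der2: "((\<lambda>t. t *\<^sub>R f (shrink e t x)) has_vector_derivative (t *\<^sub>R ((x \<bullet> e) *\<^sub>R g t) + 1 *\<^sub>R f (shrink e t x))) (at t within S)" for t S
    by (rule has_vector_derivative_scaleR[OF _ der]) (auto intro!: derivative_eq_intros)
  have gc: "continuous_on {0..1} g"
    unfolding g_def by (rule cont[OF smooth_dirD[OF f e]])
  have i1: "integrable lborel (\<lambda>t. indicator {0..1} t * (of_real t * g t))"
    by (intro integrable_indicator_cbox_continuous continuous_intros gc)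
  have i2: "integrable lborel (\<lambda>t. indicator {0..1} t * f (shrink e t x))"
    by (intro integrable_indicator_cbox_continuous cont f)
  have FTC: "(LINT t|lborel. indicator {0..1} t * (t *\<^sub>R ((x \<bullet> e) *\<^sub>R g t) + 1 *\<^sub>R f (shrink e t x)))
     = 1 *\<^sub>R f (shrink e 1 x) - 0 *\<^sub>R f (shrink e 0 x)"
    by (intro integral_FTC_complex der2 continuous_intros gc cont f) auto
  have "f x = 1 *\<^sub>R f (shrink e 1 x) - 0 *\<^sub>R f (shrink e 0 x)"
    by (simp add: shrink_def)
  also note FTC[symmetric]
  also have "(LINT t|lborel. indicator {0..1} t * (t *\<^sub>R ((x \<bullet> e) *\<^sub>R g t) + 1 *\<^sub>R f (shrink e t x)))
     = (LINT t|lborel. (x \<bullet> e) *\<^sub>R (indicator {0..1} t * (of_real t * g t)) + indicator {0..1} t * f (shrink e t x))"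
    by (intro Bochner_Integration.integral_cong) (auto simp: scaleR_conv_of_real algebra_simps)
  also have "\<dots> = (x \<bullet> e) *\<^sub>R (LINT t|lborel. indicator {0..1} t * (of_real t * g t)) + ?Q f x"
    using i1 i2 by simp
  also have "\<dots> = dirD e (primitive e f) x"
    using dirD_inner_scaleR[OF affine_family_smooth[OF shrink_family[OF e] f], of e e x] Q e
    by (simp add: primitive_def[abs_def])
  finally show "dirD e (primitive e f) x = f x" ..
qed

text \<open>Derivatives along other axes pass through the primitive, and the first derivative along \<open>e\<close> undoes it.
Hence \<open>primitive e\<close> loses no derivatives, which gives its continuity.\<close>

lemma iter_deriv_primitive:
  assumes e: "e \<in> Basis"
  shows "smooth f \<Longrightarrow> set vs \<subseteq> Basis \<Longrightarrow> iter_deriv vs (primitive e f) = primitive e (iter_deriv vs f) \<or>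
    (\<exists>ws. set ws \<subseteq> Basis \<and> length ws \<le> length vs \<and> iter_deriv vs (primitive e f) = iter_deriv ws f)"
proof (induction vs arbitrary: f rule: rev_induct)
  case (snoc v vs)
  then have v: "v \<in> Basis" "set vs \<subseteq> Basis" by auto
  show ?case
  proof (cases "v = e")
    case True
    with snoc.prems v show ?thesis
      by (intro disjI2 exI[of _ vs]) (simp add: iter_deriv_append dirD_primitive_same[OF e])
  next
    case False
    have eq: "iter_deriv (vs @ [v]) (primitive e f) = iter_deriv vs (primitive e (dirD v f))"
      by (simp add: iter_deriv_append dirD_primitive_other[OF e snoc.prems(1) v(1) False])
    from snoc.IH[OF smooth_dirD[OF snoc.prems(1) v(1)] v(2)] show ?thesis
    proof (elim disjE exE conjE)
      assume "iter_deriv vs (primitive e (dirD v f)) = primitive e (iter_deriv vs (dirD v f))"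
      with eq show ?thesis
        by (simp add: iter_deriv_append)
    next
      fix ws
      assume "set ws \<subseteq> Basis" "length ws \<le> length vs"
        "iter_deriv vs (primitive e (dirD v f)) = iter_deriv ws (dirD v f)"
      with eq v(1) show ?thesis
        by (intro disjI2 exI[of _ "ws @ [v]"]) (simp add: iter_deriv_append)
    qed
  qed
qed simp

lemma norm_primitive_le:
  assumes e: "e \<in> Basis" and f: "smooth f" and x: "norm x \<le> k"
    and B: "\<And>y. norm y \<le> k \<Longrightarrow> norm (f y) \<le> B"
  shows "norm (primitive e f x) \<le> k * B"
proof -
  have i1: "integrable lborel (\<lambda>t. indicator {0..1} t * f (shrink e t x))"
    using affine_family_integrable[OF shrink_family[OF e] f, of x] by simp
  have i2: "integrable lborel (\<lambda>t::real. indicator {0..1} t * B)"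
    using integrable_real_indicator[of "{0..1::real}" lborel] by (intro integrable_mult_left) simp
  have "norm (LINT t|lborel. indicator {0..1} t * f (shrink e t x)) \<le> (LINT t::real|lborel. indicator {0..1} t * B)"
  proof -
    have "norm (LINT t|lborel. indicator {0..1} t * f (shrink e t x))
      \<le> (LINT t|lborel. norm (indicator {0..1} t * f (shrink e t x)))"
      by (rule integral_norm_bound)
    also have "\<dots> \<le> (LINT t::real|lborel. indicator {0..1} t * B)"
    proof (rule integral_mono)
      show "integrable lborel (\<lambda>t. norm (indicator {0..1} t * f (shrink e t x)))"
        by (rule integrable_norm[OF i1])
      show "integrable lborel (\<lambda>t::real. indicator {0..1} t * B)"
        by (rule i2)
      fix t :: real
      show "norm (indicator {0..1} t * f (shrink e t x)) \<le> indicator {0..1} t * B"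
        using B[of "shrink e t x"] norm_shrink_le[OF e, of t x] x by (auto simp: indicator_def)
    qed
    finally show ?thesis .
  qed
  then have "norm (LINT t|lborel. indicator {0..1} t * f (shrink e t x)) \<le> B"
    by simp
  moreover have "\<bar>x \<bullet> e\<bar> \<le> k"
    using Basis_le_norm[OF e, of x] x by linarith
  ultimately show ?thesis
    unfolding primitive_def norm_scaleR by (intro mult_mono) auto
qed

lemma
  assumes e: "e \<in> Basis" and f: "smooth f"
  shows primitive_add: "smooth g \<Longrightarrow> primitive e (\<lambda>x. f x + g x) = (\<lambda>x. primitive e f x + primitive e g x)"
    and primitive_cmult: "primitive e (\<lambda>x. c * f x) = (\<lambda>x. c * primitive e f x)"
proof -
  have int: "integrable lborel (\<lambda>t. indicator {0..1} t * h (shrink e t x))" if "smooth h" for h x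
    using affine_family_integrable[OF shrink_family[OF e] that, of x] by simp
  show "primitive e (\<lambda>x. f x + g x) = (\<lambda>x. primitive e f x + primitive e g x)" if "smooth g"
    using int[OF f] int[OF that] by (simp add: primitive_def fun_eq_iff distrib_left scaleR_add_right)
  show "primitive e (\<lambda>x. c * f x) = (\<lambda>x. c * primitive e f x)"
    by (simp add: primitive_def fun_eq_iff mult.left_commute)
qed

lemma compact_distribution_primitive:
  fixes u :: "'a::euclidean_space functional"
  assumes u: "compact_distribution u" and e: "e \<in> Basis"
  shows "compact_distribution (\<lambda>f. - u (primitive e f))"
proof -
  obtain k C where kC: "distribution_bound u k C"
    by (rule compact_distribution_estimate[OF u])
  have "norm (- u (primitive e f)) \<le> (C * (real k + 1)) * smooth_seminorm k f" if f: "smooth f" for f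
  proof -
    have sem: "norm (iter_deriv vs f x) \<le> smooth_seminorm k f" if "norm x \<le> k" "set vs \<subseteq> Basis" "length vs \<le> k" for x vs
      by (rule smooth_seminorm_upper[OF f that])
    have sem0: "smooth_seminorm k f \<ge> 0"
      by (rule order.trans[OF norm_ge_zero sem[of 0 "[]"]]) auto
    have "norm (u (primitive e f)) \<le> C * ((real k + 1) * smooth_seminorm k f)"
    proof (rule distribution_boundD[OF kC smooth_primitive[OF e f]])
      fix x :: 'a and vs :: "'a list"
      assume x: "norm x \<le> real k" and vs: "set vs \<subseteq> Basis" "length vs \<le> k"
      consider "iter_deriv vs (primitive e f) = primitive e (iter_deriv vs f)"
        | ws where "set ws \<subseteq> Basis" "length ws \<le> length vs" "iter_deriv vs (primitive e f) = iter_deriv ws f"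
        using iter_deriv_primitive[OF e f vs(1)] by blast
      then show "norm (iter_deriv vs (primitive e f) x) \<le> (real k + 1) * smooth_seminorm k f"
      proof cases
        case 1
        have "norm (primitive e (iter_deriv vs f) x) \<le> real k * smooth_seminorm k f"
          by (rule norm_primitive_le[OF e smooth_iter_deriv[OF f vs(1)] x sem[OF _ vs]])
        with 1 sem0 show ?thesis by (simp add: distrib_right)
      next
        case 2
        have "norm (iter_deriv ws f x) \<le> smooth_seminorm k f"
          using sem[OF x 2(1)] 2(2) vs(2) by simp
        also have "\<dots> \<le> (real k + 1) * smooth_seminorm k f"
          using sem0 by (simp add: distrib_right)
        finally show ?thesis using 2(3) by simp
      qed
    qed
    then show ?thesis by (simp add: mult.assoc)
  qed
  moreover have "linear_functional_on {f. smooth f} (\<lambda>f. - u (primitive e f))"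
    unfolding linear_functional_on_def
    by (auto simp: primitive_add[OF e] primitive_cmult[OF e] compact_distribution_add[OF u] compact_distribution_cmult[OF u]
        smooth_primitive[OF e])
  ultimately show ?thesis
    unfolding compact_distribution_def by blast
qed

text \<open>As distributions in \<open>\<E>'\<close> accept arbitrary smooth functions, one may put \<open>\<phi>(f) = - F\<^sub>a(primitive f)\<close> with the
primitive along one fixed axis \<open>a\<close>, and \<open>\<phi>\<close> is again in \<open>\<E>'\<close>. For \<open>i \<noteq> a\<close> closedness gives \<open>\<partial>\<^sub>i \<phi> = F\<^sub>i\<close> at once.
For \<open>i = a\<close> one also needs that \<open>F\<^sub>a\<close> annihilates functions \<open>h\<close> that do not depend on the coordinate \<open>a\<close>.
Write \<open>h\<close> as a derivative along a second axis \<open>b\<close> of a function that does not depend on the coordinate \<open>a\<close>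
either, and use closedness.\<close>

theorem compact_distribution_Poincare:
  fixes F :: "'n::finite \<Rightarrow> (real^'n) functional"
  assumes card: "CARD('n) \<ge> 2" and F: "\<And>i. compact_distribution (F i)"
    and curl: "\<And>i j f. smooth f \<Longrightarrow> dist_curl F i j f = 0"
  shows "\<exists>\<phi>. compact_distribution \<phi> \<and> (\<forall>i. eq_compact_distribution (F i) (dist_partial i \<phi>))"
proof -
  obtain a b :: 'n where ab: "a \<noteq> b"
    using card card_le_Suc0_iff_eq[of "UNIV :: 'n set"] by auto
  define e where "e i = (axis i 1 :: real^'n)" for i
  have e: "e i \<in> Basis" for i
    by (simp add: e_def)
  have e_neq: "i \<noteq> j \<Longrightarrow> e i \<noteq> e j" for i j
    by (simp add: e_def axis_eq_axis)
  have sym: "F j (dirD (e i) f) = F i (dirD (e j) f)" if "smooth f" for i j f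
    using curl[OF that, of i j] by (simp add: dist_curl_def dist_partial_def partial_eq_dirD e_def)
  let ?\<phi> = "\<lambda>f. - F a (primitive (e a) f)"
  have "F i f = dist_partial i ?\<phi> f" if f: "smooth f" for i f
  proof (cases "i = a")
    case False
    have "dist_partial i ?\<phi> f = F a (primitive (e a) (dirD (e i) f))"
      by (simp add: dist_partial_def partial_eq_dirD e_def)
    also have "\<dots> = F a (dirD (e i) (primitive (e a) f))"
      using dirD_primitive_other[OF e f e e_neq[OF False]] by simp
    also have "\<dots> = F i (dirD (e a) (primitive (e a) f))"
      by (rule sym[OF smooth_primitive[OF e f]])
    finally show ?thesis
      by (simp add: dirD_primitive_same[OF e f])
  next
    case True
    define h where "h x = f x - primitive (e a) (dirD (e a) f) x" for x
    have sh: "smooth h"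
      unfolding h_def[abs_def] by (intro smooth_diff f smooth_primitive smooth_dirD e)
    have dh: "dirD (e a) h = (\<lambda>x. 0)"
      unfolding h_def[abs_def]
      by (simp add: dirD_diff f smooth_primitive smooth_dirD e dirD_primitive_same)
    have "F a h = F a (dirD (e b) (primitive (e b) h))"
      by (simp add: dirD_primitive_same[OF e sh])
    also have "\<dots> = F b (dirD (e a) (primitive (e b) h))"
      by (rule sym[OF smooth_primitive[OF e sh]])
    also have "dirD (e a) (primitive (e b) h) = (\<lambda>x. 0)"
      using dirD_primitive_other[OF e sh e e_neq[OF ab]] by (simp add: dh primitive_def fun_eq_iff)
    finally have "F a h = 0"
      by (simp add: compact_distribution_0[OF F])
    then have "F a f = F a (primitive (e a) (dirD (e a) f))"
      unfolding h_def[abs_def]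
      by (simp add: compact_distribution_diff[OF F] f smooth_primitive smooth_dirD e)
    with True show ?thesis
      by (simp add: dist_partial_def partial_eq_dirD e_def)
  qed
  then show ?thesis
    using compact_distribution_primitive[OF F e]
    by (intro exI[of _ ?\<phi>]) (auto simp: eq_compact_distribution_def)
qed

section \<open>The surface measure of the sphere\<close>

lemma sets_sphere_measure [measurable_cong]: "sets (sphere_measure :: 'a::euclidean_space measure) = sets borel"
  by (simp add: sphere_measure_def sets_scale_measure)

lemma space_sphere_measure: "space (sphere_measure :: 'a::euclidean_space measure) = UNIV"
  by (simp add: sphere_measure_def space_scale_measure)

lemma measurable_radial: "(\<lambda>x::'a::euclidean_space. x /\<^sub>R norm x) \<in> borel_measurable borel"
  by measurable

lemma emeasure_sphere_measure:
  fixes A :: "'a::euclidean_space set"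
  assumes "A \<in> sets borel"
  shows "emeasure sphere_measure A = of_nat DIM('a) * emeasure lborel {x \<in> cball 0 1. x /\<^sub>R norm x \<in> A}"
proof -
  have m: "(\<lambda>x::'a. x /\<^sub>R norm x) \<in> measurable (restrict_space lborel (cball 0 1)) borel"
    by (intro measurable_restrict_space1) (use measurable_radial in simp)
  have "(\<lambda>x. x /\<^sub>R norm x) -` A \<inter> space (restrict_space lborel (cball 0 1)) = {x \<in> cball 0 1. x /\<^sub>R norm x \<in> A}"
    by (auto simp: space_restrict_space)
  then show ?thesis
    unfolding sphere_measure_def emeasure_scale_measure
    by (subst emeasure_distr[OF m assms], simp only:) (subst emeasure_restrict_space, auto)
qed

lemma finite_measure_sphere_measure: "finite_measure (sphere_measure :: 'a::euclidean_space measure)"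
proof
  have "emeasure (sphere_measure :: 'a measure) UNIV = of_nat DIM('a) * emeasure lborel (cball (0::'a) 1)"
    by (subst emeasure_sphere_measure) (auto simp: cball_def)
  also have "\<dots> < top"
    using emeasure_bounded_finite[of "cball (0::'a) 1"] by (simp add: ennreal_mult_less_top of_nat_less_top)
  finally show "emeasure (sphere_measure :: 'a measure) (space sphere_measure) \<noteq> \<infinity>"
    by (simp add: space_sphere_measure)
qed

text \<open>The cone over a relatively open part of the sphere contains a nonempty open set.\<close>

lemma emeasure_sphere_measure_pos:
  fixes U :: "'a::euclidean_space set"
  assumes U: "open U" and \<theta>: "\<theta> \<in> U" "norm \<theta> = 1"
  shows "emeasure sphere_measure (sphere 0 1 \<inter> U) > 0"
proof -
  let ?O = "{x::'a. 0 < norm x \<and> norm x < 1 \<and> x /\<^sub>R norm x \<in> U}"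
  have op: "open ?O"
  proof -
    have "?O = (ball 0 1 - {0}) \<inter> (\<lambda>x. x /\<^sub>R norm x) -` U"
      by auto
    moreover have "open ((ball 0 1 - {0::'a}) \<inter> (\<lambda>x. x /\<^sub>R norm x) -` U)"
      by (intro continuous_open_preimage continuous_intros U) auto
    ultimately show ?thesis by simp
  qed
  have "(1/2) *\<^sub>R \<theta> \<in> ?O"
    using \<theta> by (simp, metis norm_zero zero_neq_one)
  then have "?O \<noteq> {}"
    by (metis empty_iff)
  then have "?O \<notin> null_sets lborel"
    using open_not_negligible[OF op] negligible_iff_null_sets null_sets_completionI by blast
  then have "emeasure lborel ?O > 0"
    using op by (auto simp: null_sets_def zero_less_iff_neq_zero borel_open)
  also have "emeasure lborel ?O \<le> emeasure lborel {x \<in> cball 0 1. x /\<^sub>R norm x \<in> sphere 0 1 \<inter> U}"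
  proof (rule emeasure_mono)
    have "{x \<in> cball 0 1. x /\<^sub>R norm x \<in> sphere 0 1 \<inter> U} = cball 0 1 \<inter> ((\<lambda>x. x /\<^sub>R norm x) -` (sphere 0 1 \<inter> U) \<inter> space borel)"
      by auto
    also have "\<dots> \<in> sets lborel"
      using measurable_sets[OF measurable_radial, of "sphere 0 1 \<inter> U"] U by auto
    finally show "{x \<in> cball 0 1. x /\<^sub>R norm x \<in> sphere 0 1 \<inter> U} \<in> sets lborel" .
  qed auto
  finally show ?thesis
    using U by (subst emeasure_sphere_measure) (auto simp: ennreal_zero_less_mult_iff)
qed

text \<open>If \<open>G \<theta>0 \<noteq> 0\<close>, test with a bump \<open>h\<close> supported where \<open>G\<close> makes an acute angle with \<open>G \<theta>0\<close>: the real part of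
\<open>h G cnj (G \<theta>0)\<close> is nonnegative and positive near \<open>\<theta>0\<close>, so its integral is not zero.\<close>

lemma sphere_orthogonal_imp_zero:
  fixes G :: "'a::euclidean_space \<Rightarrow> complex"
  assumes G: "continuous_on UNIV G"
    and orth: "\<And>h :: 'a \<Rightarrow> real. smooth (\<lambda>\<theta>. complex_of_real (h \<theta>)) \<Longrightarrow>
       (LINT \<theta>|sphere_measure. indicator (sphere 0 1) \<theta> * of_real (h \<theta>) * G \<theta>) = 0"
    and \<theta>0: "norm \<theta>0 = 1"
  shows "G \<theta>0 = 0"
proof (rule ccontr)
  assume nz: "G \<theta>0 \<noteq> 0"
  interpret finite_measure "sphere_measure :: 'a measure"
    by (rule finite_measure_sphere_measure)
  define g where "g \<theta> = Re (G \<theta> * cnj (G \<theta>0))" for \<theta>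
  have g_cont: "continuous_on UNIV g"
    unfolding g_def by (intro continuous_intros G)
  have "g \<theta>0 > 0"
    using nz by (simp add: g_def complex_mult_cnj complex_neq_0)
  then have "open {\<theta>. g \<theta> > 0}" "\<theta>0 \<in> {\<theta>. g \<theta> > 0}"
    by (auto intro!: open_Collect_less g_cont continuous_intros)
  then obtain r where r: "r > 0" "ball \<theta>0 r \<subseteq> {\<theta>. g \<theta> > 0}"
    by (meson open_contains_ball)
  define \<delta> where "\<delta> = r / (2 * DIM('a))"
  have \<delta>: "\<delta> > 0" using r by (simp add: \<delta>_def)
  define h where "h \<theta> = (\<Prod>b\<in>Basis. flat (\<delta> - (\<theta> - \<theta>0) \<bullet> b) * flat (\<delta> + (\<theta> - \<theta>0) \<bullet> b))" for \<theta>
  have h_smooth: "smooth (\<lambda>\<theta>. complex_of_real (h \<theta>))"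
  proof -
    have "smooth (\<lambda>\<theta>::'a. complex_of_real (flat ((\<delta> + \<theta>0 \<bullet> b) + - (\<theta> \<bullet> b))))"
      "smooth (\<lambda>\<theta>::'a. complex_of_real (flat ((\<delta> - \<theta>0 \<bullet> b) + \<theta> \<bullet> b)))" for b
      by (rule smooth_compose_affine[OF _ smooth_flat]; auto intro!: linearI simp: inner_add_left)+
    then have "smooth (\<lambda>\<theta>. \<Prod>b\<in>Basis. complex_of_real (flat ((\<delta> + \<theta>0 \<bullet> b) + - (\<theta> \<bullet> b))) * complex_of_real (flat ((\<delta> - \<theta>0 \<bullet> b) + \<theta> \<bullet> b)))"
      by (intro smooth_prod smooth_mult)
    moreover have "(\<lambda>\<theta>. complex_of_real (h \<theta>)) = (\<lambda>\<theta>. \<Prod>b\<in>Basis. complex_of_real (flat ((\<delta> + \<theta>0 \<bullet> b) + - (\<theta> \<bullet> b))) * complex_of_real (flat ((\<delta> - \<theta>0 \<bullet> b) + \<theta> \<bullet> b)))"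
      by (simp add: h_def fun_eq_iff inner_diff_left algebra_simps)
    ultimately show ?thesis by simp
  qed
  have h_nonneg: "h \<theta> \<ge> 0" for \<theta>
    unfolding h_def by (intro prod_nonneg) (simp add: flat_nonneg)
  have h_cont: "continuous_on UNIV h"
  proof -
    have "continuous_on UNIV (\<lambda>\<theta>. Re (complex_of_real (h \<theta>)))"
      by (intro continuous_intros smooth_continuous_on[OF h_smooth])
    then show ?thesis by simp
  qed
  have h_supp: "\<theta> \<in> ball \<theta>0 r" if "h \<theta> \<noteq> 0" for \<theta>
  proof -
    have "\<bar>(\<theta> - \<theta>0) \<bullet> b\<bar> \<le> \<delta>" if "b \<in> Basis" for b
    proof -
      have "flat (\<delta> - (\<theta> - \<theta>0) \<bullet> b) \<noteq> 0" "flat (\<delta> + (\<theta> - \<theta>0) \<bullet> b) \<noteq> 0"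
        using \<open>h \<theta> \<noteq> 0\<close> that unfolding h_def by (auto simp: prod_zero_iff)
      then have "\<delta> - (\<theta> - \<theta>0) \<bullet> b > 0" "\<delta> + (\<theta> - \<theta>0) \<bullet> b > 0"
        using flat_eq_0 by (meson not_le)+
      then show ?thesis by (simp add: abs_le_iff)
    qed
    then have "norm (\<theta> - \<theta>0) \<le> (\<Sum>b\<in>(Basis::'a set). \<delta>)"
      by (intro order.trans[OF norm_le_l1] sum_mono)
    also have "\<dots> < r"
      using r by (simp add: \<delta>_def)
    finally show ?thesis
      by (simp add: dist_norm norm_minus_commute)
  qed
  define k where "k \<theta> = indicator (sphere 0 1) \<theta> * (h \<theta> * g \<theta>)" for \<theta>
  have k_nonneg: "k \<theta> \<ge> 0" for \<theta>
  proof (cases "h \<theta> = 0")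
    case False
    then have "g \<theta> > 0" using h_supp r by blast
    then show ?thesis using h_nonneg[of \<theta>] by (simp add: k_def)
  qed (simp add: k_def)
  have [measurable]: "G \<in> borel_measurable borel" "h \<in> borel_measurable borel"
    using G h_cont by (auto intro: borel_measurable_continuous_onI)
  have "bounded ((\<lambda>\<theta>. of_real (h \<theta>) * G \<theta>) ` sphere 0 1)"
    by (intro compact_imp_bounded compact_continuous_image continuous_intros continuous_on_subset[OF G] continuous_on_subset[OF h_cont]) auto
  then obtain B where "\<forall>\<theta>\<in>sphere 0 1. norm (of_real (h \<theta>) * G \<theta>) \<le> B"
    unfolding bounded_iff by auto
  then have B: "norm (of_real (h \<theta>) * G \<theta>) \<le> B" if "norm \<theta> = 1" for \<theta>
    using that by simp
  have int: "integrable sphere_measure (\<lambda>\<theta>. indicator (sphere 0 1) \<theta> * of_real (h \<theta>) * G \<theta>)"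
  proof (rule integrable_const_bound[where B = "\<bar>B\<bar>"])
    show "AE \<theta> in sphere_measure. norm (indicator (sphere 0 1) \<theta> * of_real (h \<theta>) * G \<theta>) \<le> \<bar>B\<bar>"
      using B by (intro AE_I2) (force simp: indicator_def)
    have [measurable]: "sphere (0::'a) 1 \<in> sets borel"
      by simp
    have "(\<lambda>\<theta>. indicator (sphere 0 1) \<theta> * of_real (h \<theta>) * G \<theta>) \<in> borel_measurable borel"
      by measurable
    then show "(\<lambda>\<theta>. indicator (sphere 0 1) \<theta> * of_real (h \<theta>) * G \<theta>) \<in> borel_measurable sphere_measure"
      by (simp add: measurable_cong_sets[OF sets_sphere_measure refl])
  qed
  have k_eq: "k \<theta> = Re (cnj (G \<theta>0) * (indicator (sphere 0 1) \<theta> * of_real (h \<theta>) * G \<theta>))" for \<theta>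
    by (auto simp: k_def g_def indicator_def algebra_simps)
  have k_int: "integrable sphere_measure k"
    unfolding k_eq[abs_def] by (intro integrable_Re integrable_mult_right int)
  have "(LINT \<theta>|sphere_measure. k \<theta>) = Re (LINT \<theta>|sphere_measure. cnj (G \<theta>0) * (indicator (sphere 0 1) \<theta> * of_real (h \<theta>) * G \<theta>))"
    unfolding k_eq by (rule integral_Re) (intro integrable_mult_right int)
  also have "\<dots> = 0"
    using orth[OF h_smooth] by simp
  finally have "AE \<theta> in sphere_measure. k \<theta> = 0"
    using integral_nonneg_eq_0_iff_AE[OF k_int] k_nonneg by simp
  moreover have [measurable]: "k \<in> borel_measurable sphere_measure"
    by (rule borel_measurable_integrable[OF k_int])
  moreover have "{\<theta> \<in> space sphere_measure. k \<theta> \<noteq> 0} \<in> sets sphere_measure"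
    by measurable
  ultimately have 0: "emeasure sphere_measure {\<theta>. k \<theta> \<noteq> 0} = 0"
    by (subst (asm) AE_iff_measurable[of "{\<theta>. k \<theta> \<noteq> 0}"]) (auto simp: space_sphere_measure)
  have "sphere 0 1 \<inter> {\<theta>. h \<theta> > 0} \<subseteq> {\<theta>. k \<theta> \<noteq> 0}"
  proof
    fix \<theta> assume \<theta>: "\<theta> \<in> sphere 0 1 \<inter> {\<theta>. h \<theta> > 0}"
    then have "h \<theta> \<noteq> 0" by simp
    from h_supp[OF this] r(2) have "g \<theta> > 0" by blast
    with \<theta> show "\<theta> \<in> {\<theta>. k \<theta> \<noteq> 0}" by (simp add: k_def)
  qed
  then have "emeasure sphere_measure (sphere 0 1 \<inter> {\<theta>. h \<theta> > 0}) \<le> emeasure sphere_measure {\<theta>. k \<theta> \<noteq> 0}"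
    using \<open>{\<theta> \<in> space sphere_measure. k \<theta> \<noteq> 0} \<in> sets sphere_measure\<close>
    by (intro emeasure_mono) (auto simp: space_sphere_measure)
  moreover have "emeasure sphere_measure (sphere 0 1 \<inter> {\<theta>. h \<theta> > 0}) > 0"
  proof (rule emeasure_sphere_measure_pos[OF _ _ \<theta>0])
    show "open {\<theta>. h \<theta> > 0}"
      by (intro open_Collect_less h_cont continuous_intros)
    show "\<theta>0 \<in> {\<theta>. h \<theta> > 0}"
      using \<delta> by (auto simp: h_def flat_pos_iff intro!: prod_pos)
  qed
  ultimately show False
    using 0 by simp
qed

section \<open>The X-ray transform tested against functions on lines\<close>

lemma integrable_sphere_segment:
  fixes g :: "'a::euclidean_space \<Rightarrow> complex"
  assumes g: "continuous_on UNIV g"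
  shows "integrable (sphere_measure \<Otimes>\<^sub>M lborel)
    (\<lambda>q. indicator (sphere 0 1) (fst q) * g (fst q) * indicator {-T..T} (snd q :: real))"
proof -
  interpret finite_measure "sphere_measure :: 'a measure"
    by (rule finite_measure_sphere_measure)
  have [measurable]: "g \<in> borel_measurable borel"
    by (rule borel_measurable_continuous_onI[OF g])
  have [measurable]: "sphere (0::'a) 1 \<in> sets borel"
    by simp
  have "bounded (g ` sphere 0 1)"
    by (intro compact_imp_bounded compact_continuous_image continuous_on_subset[OF g]) auto
  then obtain B where "\<forall>\<theta>\<in>sphere 0 1. norm (g \<theta>) \<le> B"
    unfolding bounded_iff by auto
  then have B: "norm (g \<theta>) \<le> B" if "norm \<theta> = 1" for \<theta>
    using that by simp
  let ?A = "UNIV \<times> {-T..T} :: ('a \<times> real) set"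
  have A: "?A \<in> sets (sphere_measure \<Otimes>\<^sub>M lborel)"
    by (intro pair_measureI) (auto simp: sets_sphere_measure)
  have "emeasure (sphere_measure \<Otimes>\<^sub>M lborel) ?A < \<infinity>"
    by (subst lborel.emeasure_pair_measure_Times)
       (auto simp: sets_sphere_measure ennreal_mult_less_top emeasure_eq_measure emeasure_lborel_Icc_eq)
  then have "integrable (sphere_measure \<Otimes>\<^sub>M lborel) (\<lambda>q. \<bar>B\<bar> * indicator ?A q)"
    using A by (intro integrable_mult_right integrable_real_indicator)
  then show ?thesis
  proof (rule Bochner_Integration.integrable_bound)
    show "(\<lambda>q. indicator (sphere 0 1) (fst q) * g (fst q) * indicator {-T..T} (snd q :: real))
      \<in> borel_measurable (sphere_measure \<Otimes>\<^sub>M lborel)"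
    proof -
      have "(\<lambda>q. indicator (sphere 0 1) (fst q) * g (fst q) * indicator {-T..T} (snd q :: real))
        \<in> borel_measurable (borel \<Otimes>\<^sub>M lborel)"
        by measurable
      then show ?thesis
        by (simp add: measurable_cong_sets[OF sets_pair_measure_cong[OF sets_sphere_measure refl] refl])
    qed
    show "AE q in sphere_measure \<Otimes>\<^sub>M lborel. norm (indicator (sphere 0 1) (fst q) * g (fst q) * indicator {-T..T} (snd q))
      \<le> norm (\<bar>B\<bar> * indicator ?A q)"
    proof (rule AE_I2)
      fix q :: "'a \<times> real"
      show "norm (indicator (sphere 0 1) (fst q) * g (fst q) * indicator {-T..T} (snd q)) \<le> norm (\<bar>B\<bar> * indicator ?A q)"
        using B[of "fst q"] by (cases q) (auto simp: indicator_def)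
    qed
  qed
qed

lemma sphere_segment_family:
  fixes x :: "'a::euclidean_space"
  assumes g: "continuous_on UNIV g"
  shows "affine_family (sphere_measure \<Otimes>\<^sub>M lborel)
    (\<lambda>q. indicator (sphere 0 1) (fst q) * g (fst q) * indicator {-T..T} (snd q :: real))
    (\<lambda>q. x + snd q *\<^sub>R fst q) (\<lambda>_. uminus)"
  unfolding affine_family_def
proof (intro conjI)
  have "(\<lambda>q::'a \<times> real. x + snd q *\<^sub>R fst q) \<in> borel_measurable (borel \<Otimes>\<^sub>M lborel)"
    by measurable
  then show "(\<lambda>q. x + snd q *\<^sub>R fst q) \<in> borel_measurable (sphere_measure \<Otimes>\<^sub>M lborel)"
    by (simp add: measurable_cong_sets[OF sets_pair_measure_cong[OF sets_sphere_measure refl] refl])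
  show "\<exists>P. \<forall>q. indicator (sphere 0 1) (fst q) * g (fst q) * indicator {-T..T} (snd q) \<noteq> 0 \<longrightarrow>
      norm (x + snd q *\<^sub>R fst q) \<le> P"
  proof (intro exI[of _ "norm x + T"] allI impI)
    fix q :: "'a \<times> real"
    assume "indicator (sphere 0 1) (fst q) * g (fst q) * indicator {-T..T} (snd q) \<noteq> 0"
    then have "norm (fst q) = 1" "\<bar>snd q\<bar> \<le> T"
      by (auto simp: indicator_def split: if_splits)
    then show "norm (x + snd q *\<^sub>R fst q) \<le> norm x + T"
      using norm_triangle_ineq[of x "snd q *\<^sub>R fst q"] by simp
  qed
qed (auto simp: linear_uminus intro: exI[of _ 1] integrable_sphere_segment[OF g])

lemma sphere_segment_Fubini:
  fixes x :: "'a::euclidean_space"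
  assumes g: "continuous_on UNIV g" and \<phi>: "smooth \<phi>"
  shows "(LINT q|(sphere_measure \<Otimes>\<^sub>M lborel).
      (indicator (sphere 0 1) (fst q) * g (fst q) * indicator {-T..T} (snd q)) * \<phi> (x + snd q *\<^sub>R fst q))
    = (LINT \<theta>|sphere_measure. indicator (sphere 0 1) \<theta> * g \<theta> *
        (LINT s|lborel. indicator {-T..T} s * \<phi> (x + s *\<^sub>R \<theta>)))"
    and "integrable sphere_measure (\<lambda>\<theta>. indicator (sphere 0 1) \<theta> * g \<theta> *
        (LINT s|lborel. indicator {-T..T} s * \<phi> (x + s *\<^sub>R \<theta>)))"
proof -
  interpret finite_measure "sphere_measure :: 'a measure"
    by (rule finite_measure_sphere_measure)
  interpret P: pair_sigma_finite "sphere_measure :: 'a measure" "lborel :: real measure" ..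
  let ?f = "\<lambda>q. (indicator (sphere 0 1) (fst q) * g (fst q) * indicator {-T..T} (snd q)) * \<phi> (x + snd q *\<^sub>R fst q)"
  have int: "integrable (sphere_measure \<Otimes>\<^sub>M lborel) ?f"
    using affine_family_integrable[OF sphere_segment_family[OF g, where x = x and T = T] \<phi>, of 0] by simp
  show "(LINT q|(sphere_measure \<Otimes>\<^sub>M lborel). ?f q)
    = (LINT \<theta>|sphere_measure. indicator (sphere 0 1) \<theta> * g \<theta> *
        (LINT s|lborel. indicator {-T..T} s * \<phi> (x + s *\<^sub>R \<theta>)))"
    using P.integral_fst'[OF int] by (simp add: mult.assoc)
  show "integrable sphere_measure (\<lambda>\<theta>. indicator (sphere 0 1) \<theta> * g \<theta> *
        (LINT s|lborel. indicator {-T..T} s * \<phi> (x + s *\<^sub>R \<theta>)))"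
    using P.integrable_fst'[OF int] by (simp add: mult.assoc)
qed

text \<open>The test function on lines: \<open>h\<close> of the direction times the integral of \<open>\<phi>(x - \<cdot>)\<close> over the line. On
the manifold of lines the truncation at \<open>T = norm x + \<epsilon>\<close> has no effect, because the base point is orthogonal
to the direction (see \<open>xray_adjoint_line_test\<close>); it makes the function smooth on the whole product space.\<close>

definition line_test :: "('a::euclidean_space \<Rightarrow> real) \<Rightarrow> ('a \<Rightarrow> complex) \<Rightarrow> 'a \<Rightarrow> real \<Rightarrow> 'a \<times> 'a \<Rightarrow> complex" where
  "line_test h \<phi> x T p = of_real (h (snd p)) * (LINT s|lborel. indicator {-T..T} s * \<phi> (x - fst p + s *\<^sub>R snd p))"

lemma smooth_line_test:
  fixes x :: "'a::euclidean_space"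
  assumes h: "smooth (\<lambda>\<theta>. complex_of_real (h \<theta>))" and \<phi>: "smooth \<phi>"
  shows "smooth (line_test h \<phi> x T)"
proof -
  have "affine_family lborel (indicator {-T..T}) (\<lambda>_. x) (\<lambda>s (p::'a \<times> 'a). - fst p + s *\<^sub>R snd p)"
    unfolding affine_family_def
  proof (intro conjI)
    show "\<exists>l. \<forall>s (p::'a \<times> 'a). indicator {-T..T} s \<noteq> (0::complex) \<longrightarrow> norm (- fst p + s *\<^sub>R snd p) \<le> l * norm p"
    proof (intro exI[of _ "1 + T"] allI impI)
      fix s and p :: "'a \<times> 'a" assume "indicator {-T..T} s \<noteq> (0::complex)"
      then have s: "\<bar>s\<bar> \<le> T"
        by (auto simp: indicator_def split: if_splits)
      have "norm (- fst p + s *\<^sub>R snd p) \<le> norm (fst p) + \<bar>s\<bar> * norm (snd p)"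
        using norm_triangle_ineq[of "- fst p" "s *\<^sub>R snd p"] by simp
      also have "\<dots> \<le> norm p + T * norm p"
        using s norm_fst_le[of "fst p" "snd p"] norm_snd_le[of "snd p" "fst p"]
        by (intro add_mono mult_mono) auto
      finally show "norm (- fst p + s *\<^sub>R snd p) \<le> (1 + T) * norm p"
        by (simp add: distrib_right)
    qed
  qed (auto intro!: linearI integrable_Icc_indicator simp: algebra_simps)
  from affine_family_smooth[OF this \<phi>]
  have "smooth (\<lambda>p. LINT s|lborel. indicator {-T..T} s * \<phi> (x - fst p + s *\<^sub>R snd p))"
    by (simp add: algebra_simps)
  moreover have "smooth (\<lambda>p::'a \<times> 'a. complex_of_real (h (0 + snd p)))"
    by (rule smooth_compose_affine[OF linear_snd h])
  ultimately show ?thesis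
    unfolding line_test_def[abs_def] by (intro smooth_mult) simp_all
qed

text \<open>The lines in question meet the closed ball of radius \<open>\<epsilon>\<close> around \<open>x\<close>. They form a compact set, as the
projection of a compact set of lines with a marked point.\<close>

lemma line_test_support:
  fixes x :: "'a::euclidean_space"
  assumes \<phi>: "\<And>y. norm y > \<epsilon> \<Longrightarrow> \<phi> y = 0" and V: "cball x \<epsilon> \<subseteq> V"
  shows "compact (closure (support_on lines (line_test h \<phi> x T)))"
    and "closure (support_on lines (line_test h \<phi> x T)) \<subseteq> lines_meeting V"
proof -
  define C where "C = {q::('a \<times> 'a) \<times> real. norm (snd (fst q)) = 1 \<and> fst (fst q) \<bullet> snd (fst q) = 0 \<and>
      norm (x - fst (fst q) + snd q *\<^sub>R snd (fst q)) \<le> \<epsilon>}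
    \<inter> (cball 0 (norm x + \<bar>\<epsilon>\<bar> + \<bar>T\<bar>) \<times> cball 0 1) \<times> {-T..T}"
  have "compact C"
    unfolding C_def
    by (intro closed_Int_compact compact_Times closed_Collect_conj closed_Collect_eq closed_Collect_le continuous_intros) auto
  then have K: "compact (fst ` C)"
    by (intro compact_continuous_image continuous_intros)
  have sub: "support_on lines (line_test h \<phi> x T) \<subseteq> fst ` C"
  proof
    fix p assume p: "p \<in> support_on lines (line_test h \<phi> x T)"
    then have pl: "norm (snd p) = 1" "fst p \<bullet> snd p = 0" and nz: "line_test h \<phi> x T p \<noteq> 0"
      by (auto simp: support_on_def lines_def)
    have "\<exists>s\<in>{-T..T}. norm (x - fst p + s *\<^sub>R snd p) \<le> \<epsilon>"
    proof (rule ccontr)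
      assume "\<not> ?thesis"
      then have "indicator {-T..T} s * \<phi> (x - fst p + s *\<^sub>R snd p) = 0" for s
        using \<phi> by (cases "s \<in> {-T..T}") (auto simp: not_le)
      then have "(\<lambda>s. indicator {-T..T} s * \<phi> (x - fst p + s *\<^sub>R snd p)) = (\<lambda>s. 0)"
        by (rule ext)
      then show False
        using nz unfolding line_test_def by (simp only: integral_zero mult_zero_right)
    qed
    then obtain s where s: "s \<in> {-T..T}" "norm (x - fst p + s *\<^sub>R snd p) \<le> \<epsilon>" by blast
    have "fst p = x - ((x - fst p + s *\<^sub>R snd p) - s *\<^sub>R snd p)"
      by simp
    then have "norm (fst p) \<le> norm x + (norm (x - fst p + s *\<^sub>R snd p) + norm (s *\<^sub>R snd p))"
      by (metis add_left_mono norm_triangle_ineq4 order.trans)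
    then have "norm (fst p) \<le> norm x + \<bar>\<epsilon>\<bar> + \<bar>T\<bar>"
      using s pl by auto
    with s pl have "(p, s) \<in> C"
      by (auto simp: C_def mem_Times_iff)
    then show "p \<in> fst ` C"
      by force
  qed
  then have cl: "closure (support_on lines (line_test h \<phi> x T)) \<subseteq> fst ` C"
    by (intro closure_minimal compact_imp_closed K)
  show "compact (closure (support_on lines (line_test h \<phi> x T)))"
    using cl K by (meson bounded_subset closed_closure compact_eq_bounded_closed)
  have "fst ` C \<subseteq> lines_meeting V"
  proof (rule subsetI, erule imageE)
    fix p q assume q: "p = fst q" "q \<in> C"
    then have "norm (x - (fst p + (- snd q) *\<^sub>R snd p)) \<le> \<epsilon>"
      by (simp add: C_def algebra_simps)
    then have "fst p + (- snd q) *\<^sub>R snd p \<in> V"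
      using V by (auto simp: dist_norm)
    then have "\<exists>s. fst p + s *\<^sub>R snd p \<in> V"
      by blast
    moreover have "p \<in> lines"
      using q by (auto simp: lines_def C_def)
    ultimately show "p \<in> lines_meeting V"
      by (auto simp: lines_meeting_def)
  qed
  with cl show "closure (support_on lines (line_test h \<phi> x T)) \<subseteq> lines_meeting V"
    by blast
qed

text \<open>Substituting the projection of \<open>y\<close> onto the complement of \<open>\<theta>\<close> amounts to a shift of the parameter
\<open>s\<close> along the line. For \<open>y\<close> in a fixed ball this leaves an average of translates of \<open>\<phi>\<close> over a compact set of
directions and parameters, to which distributions can be applied under the integral sign.\<close>

lemma xray_adjoint_line_test:
  fixes x :: "real^'n::finite"
  assumes \<phi>: "smooth \<phi>" "\<And>y. norm y > \<epsilon> \<Longrightarrow> \<phi> y = 0" and h: "continuous_on UNIV h"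
    and T: "T = norm x + \<epsilon>" and y: "norm x + \<epsilon> + norm y \<le> T'"
  shows "xray_adjoint (line_test h \<phi> x T) i y =
    (LINT q|(sphere_measure \<Otimes>\<^sub>M lborel).
      (indicator (sphere 0 1) (fst q) * (of_real (fst q $ i * h (fst q))) * indicator {-T'..T'} (snd q)) * \<phi> (x + snd q *\<^sub>R fst q - y))"
proof -
  have g: "continuous_on UNIV (\<lambda>\<theta>::real^'n. complex_of_real (\<theta> $ i * h \<theta>))"
    by (intro continuous_intros h)
  have sm: "smooth (\<lambda>z. \<phi> (- y + z))"
    by (rule smooth_translate[OF \<phi>(1)])
  have "(LINT s|lborel. indicator {-T..T} s * \<phi> (x - (y - (y \<bullet> \<theta>) *\<^sub>R \<theta>) + s *\<^sub>R \<theta>))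
      = (LINT s|lborel. indicator {-T'..T'} s * \<phi> (x + s *\<^sub>R \<theta> - y))" if \<theta>: "norm \<theta> = 1" for \<theta>
  proof -
    have tt: "\<theta> \<bullet> \<theta> = 1"
      using \<theta> by (simp add: norm_eq_1)
    have "(LINT s|lborel. indicator {-T..T} s * \<phi> (x - (y - (y \<bullet> \<theta>) *\<^sub>R \<theta>) + s *\<^sub>R \<theta>))
      = (LINT s|lborel. \<phi> (x - (y - (y \<bullet> \<theta>) *\<^sub>R \<theta>) + s *\<^sub>R \<theta>))"
    proof (rule Bochner_Integration.integral_cong)
      fix s
      show "indicator {-T..T} s * \<phi> (x - (y - (y \<bullet> \<theta>) *\<^sub>R \<theta>) + s *\<^sub>R \<theta>) = \<phi> (x - (y - (y \<bullet> \<theta>) *\<^sub>R \<theta>) + s *\<^sub>R \<theta>)"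
      proof (cases "s \<in> {-T..T}")
        case False
        then have "T < \<bar>s\<bar>" by auto
        have "(x - (y - (y \<bullet> \<theta>) *\<^sub>R \<theta>) + s *\<^sub>R \<theta>) \<bullet> \<theta> = x \<bullet> \<theta> + s"
          by (simp add: inner_add_left inner_diff_left tt)
        then have "\<bar>x \<bullet> \<theta> + s\<bar> \<le> norm (x - (y - (y \<bullet> \<theta>) *\<^sub>R \<theta>) + s *\<^sub>R \<theta>)"
          using Cauchy_Schwarz_ineq2[of "x - (y - (y \<bullet> \<theta>) *\<^sub>R \<theta>) + s *\<^sub>R \<theta>" \<theta>] \<theta> by simp
        moreover have "\<bar>x \<bullet> \<theta>\<bar> \<le> norm x"
          using Cauchy_Schwarz_ineq2[of x \<theta>] \<theta> by simp
        ultimately have "\<epsilon> < norm (x - (y - (y \<bullet> \<theta>) *\<^sub>R \<theta>) + s *\<^sub>R \<theta>)"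
          using \<open>T < \<bar>s\<bar>\<close> T by linarith
        then show ?thesis
          using \<phi>(2) by simp
      qed simp
    qed simp
    also have "\<dots> = (LINT s|lborel. \<phi> (x - (y - (y \<bullet> \<theta>) *\<^sub>R \<theta>) + (- (y \<bullet> \<theta>) + 1 * s) *\<^sub>R \<theta>))"
      by (subst lborel_integral_real_affine[of 1 _ "- (y \<bullet> \<theta>)"]) simp_all
    also have "\<dots> = (LINT s|lborel. \<phi> (x + s *\<^sub>R \<theta> - y))"
      by (simp add: algebra_simps)
    also have "\<dots> = (LINT s|lborel. indicator {-T'..T'} s * \<phi> (x + s *\<^sub>R \<theta> - y))"
    proof (rule Bochner_Integration.integral_cong)
      fix s
      show "\<phi> (x + s *\<^sub>R \<theta> - y) = indicator {-T'..T'} s * \<phi> (x + s *\<^sub>R \<theta> - y)"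
      proof (cases "s \<in> {-T'..T'}")
        case False
        then have "T' < \<bar>s\<bar>" by auto
        moreover have "\<bar>s\<bar> = norm ((x + s *\<^sub>R \<theta> - y) - (x - y))"
          using \<theta> by simp
        then have "\<bar>s\<bar> \<le> norm (x + s *\<^sub>R \<theta> - y) + (norm x + norm y)"
          using norm_triangle_ineq4[of "x + s *\<^sub>R \<theta> - y" "x - y"] norm_triangle_ineq4[of x y] by linarith
        ultimately have "\<epsilon> < norm (x + s *\<^sub>R \<theta> - y)"
          using y by linarith
        then show ?thesis
          using \<phi>(2) by simp
      qed simp
    qed simp
    finally show ?thesis .
  qed
  note inner = this
  have "xray_adjoint (line_test h \<phi> x T) i y = (LINT \<theta>|sphere_measure. indicator (sphere 0 1) \<theta> * of_real (\<theta> $ i * h \<theta>) *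
        (LINT s|lborel. indicator {-T'..T'} s * \<phi> (- y + (x + s *\<^sub>R \<theta>))))"
    unfolding xray_adjoint_def set_lebesgue_integral_def
  proof (rule Bochner_Integration.integral_cong)
    fix \<theta> :: "real^'n"
    show "indicator (sphere 0 1) \<theta> *\<^sub>R (of_real (\<theta> $ i) * line_test h \<phi> x T (y - (y \<bullet> \<theta>) *\<^sub>R \<theta>, \<theta>)) =
      indicator (sphere 0 1) \<theta> * of_real (\<theta> $ i * h \<theta>) *
        (LINT s|lborel. indicator {-T'..T'} s * \<phi> (- y + (x + s *\<^sub>R \<theta>)))"
      using inner[of \<theta>] by (cases "norm \<theta> = 1") (auto simp: line_test_def indicator_def)
  qed simp
  also have "\<dots> = (LINT q|(sphere_measure \<Otimes>\<^sub>M lborel).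
      (indicator (sphere 0 1) (fst q) * (of_real (fst q $ i * h (fst q))) * indicator {-T'..T'} (snd q)) * \<phi> (- y + (x + snd q *\<^sub>R fst q)))"
    by (rule sphere_segment_Fubini(1)[OF g sm, symmetric])
  finally show ?thesis
    by simp
qed

text \<open>Applying \<open>F\<close> under the integral sign turns \<open>\<langle>X\<^sub>1F, \<psi>\<rangle> = 0\<close>, for the test functions \<open>\<psi>\<close> above, into the
statement that the line integrals of \<open>F * \<phi>\<close> through \<open>x\<close>, as functions of the direction, are orthogonal to
every smooth \<open>h\<close> on the sphere.\<close>

theorem xray_vanishing_pointwise:
  fixes F :: "'n::finite \<Rightarrow> (real^'n) functional"
  assumes F: "\<And>i. compact_distribution (F i)" and xray: "xray_vanishes_on_lines_meeting F V"
    and \<phi>: "smooth \<phi>" "\<And>y. norm y > \<epsilon> \<Longrightarrow> \<phi> y = 0" and V: "cball x \<epsilon> \<subseteq> V"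
    and \<theta>: "\<theta> \<noteq> 0"
  shows "(LINT s|lborel. (\<Sum>i\<in>UNIV. (\<theta> $ i) *\<^sub>R conv (F i) \<phi> (x + s *\<^sub>R \<theta>))) = 0"
proof -
  have "\<exists>R>0. \<forall>f g. smooth f \<longrightarrow> smooth g \<longrightarrow> (\<forall>x. norm x < R \<longrightarrow> f x = g x) \<longrightarrow> F i f = F i g" for i
    by (rule compact_distribution_local[OF F[of i]]) blast
  then obtain Y0 where Y0: "\<And>i. Y0 i > 0"
    "\<And>i f g. smooth f \<Longrightarrow> smooth g \<Longrightarrow> (\<And>x. norm x < Y0 i \<Longrightarrow> f x = g x) \<Longrightarrow> F i f = F i g"
    by metis
  obtain R where R0: "R \<ge> 0" and "\<forall>i x. norm x > R \<longrightarrow> conv (F i) \<phi> x = 0"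
    using conv_family_support[of F \<phi> \<epsilon>, OF F \<phi>] by blast
  then have R: "conv (F i) \<phi> x = 0" if "norm x > R" for i x
    using that by blast
  define Y where "Y = (\<Sum>i\<in>UNIV. Y0 i)"
  have Y0_le: "Y0 i \<le> Y" for i
    unfolding Y_def using Y0(1) by (intro member_le_sum) (auto intro: less_imp_le)
  have smA: "smooth (conv (F i) \<phi>)" for i
    by (rule smooth_conv[OF F \<phi>(1)])
  define T where "T = norm x + \<epsilon>"
  \<comment> \<open>Large enough both for the arguments \<open>y\<close> that the distributions see and for the supports of the
    convolutions.\<close>
  define T' where "T' = norm x + \<bar>\<epsilon>\<bar> + Y + R"
  define G where "G \<theta> = (\<Sum>i\<in>UNIV. of_real (\<theta> $ i) * (LINT s|lborel. indicator {-T'..T'} s * conv (F i) \<phi> (x + s *\<^sub>R \<theta>)))"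
    for \<theta>
  have fam: "affine_family lborel (indicator {-T'..T'}) (\<lambda>_. x) (\<lambda>s (\<theta>::real^'n). s *\<^sub>R \<theta>)"
    unfolding affine_family_def
  proof (intro conjI)
    show "\<exists>P. \<forall>s::real. indicator {-T'..T'} s \<noteq> (0::complex) \<longrightarrow> norm x \<le> P"
      by (intro exI[of _ "norm x"]) simp
    show "\<exists>l. \<forall>s (v::real^'n). indicator {-T'..T'} s \<noteq> (0::complex) \<longrightarrow> norm (s *\<^sub>R v) \<le> l * norm v"
      by (intro exI[of _ T']) (auto intro!: mult_right_mono simp: indicator_def split: if_splits)
  qed (auto intro!: linearI integrable_Icc_indicator simp: algebra_simps)
  have contI: "continuous_on UNIV (\<lambda>\<theta>. LINT s|lborel. indicator {-T'..T'} s * conv (F i) \<phi> (x + s *\<^sub>R \<theta>))" for i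
    by (rule smooth_continuous_on[OF affine_family_smooth[OF fam smA]])
  have G_cont: "continuous_on UNIV G"
    unfolding G_def[abs_def] by (intro continuous_intros contI)
  have G_zero: "G \<theta>0 = 0" if "norm \<theta>0 = 1" for \<theta>0
  proof (rule sphere_orthogonal_imp_zero[OF G_cont _ that])
    fix h :: "real^'n \<Rightarrow> real"
    assume h: "smooth (\<lambda>\<theta>. complex_of_real (h \<theta>))"
    have h_cont: "continuous_on UNIV h"
    proof -
      have "continuous_on UNIV (\<lambda>\<theta>. Re (complex_of_real (h \<theta>)))"
        by (intro continuous_intros smooth_continuous_on[OF h])
      then show ?thesis by simp
    qed
    define \<psi> where "\<psi> = line_test h \<phi> x T"
    define w where "w i \<theta> = complex_of_real (\<theta> $ i * h \<theta>)" for i and \<theta> :: "real^'n"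
    have w: "continuous_on UNIV (w i)" for i
      unfolding w_def[abs_def] by (intro continuous_intros h_cont)
    define c where "c T' i q = indicator (sphere 0 1) (fst q) * w i (fst q) * indicator {-T'..T'} (snd q)"
      for T' :: real and i and q :: "(real^'n) \<times> real"
    have fam2: "affine_family (sphere_measure \<Otimes>\<^sub>M lborel) (c T' i) (\<lambda>q. x + snd q *\<^sub>R fst q) (\<lambda>_. uminus)" for T' i
      using sphere_segment_family[OF w] by (simp add: c_def[abs_def])
    have sm_g: "smooth (\<lambda>y. LINT q|(sphere_measure \<Otimes>\<^sub>M lborel). c T' i q * \<phi> (x + snd q *\<^sub>R fst q - y))" for T' i
      using affine_family_smooth[OF fam2 \<phi>(1)] by simp
    have adj: "xray_adjoint \<psi> i y = (LINT q|(sphere_measure \<Otimes>\<^sub>M lborel). c T' i q * \<phi> (x + snd q *\<^sub>R fst q - y))"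
      if "norm x + \<epsilon> + norm y \<le> T'" for T' i y
      unfolding \<psi>_def c_def w_def by (rule xray_adjoint_line_test[OF \<phi> h_cont T_def that])
    have sm_adj: "smooth (xray_adjoint \<psi> i)" for i
    proof (rule smooth_local)
      fix r :: real
      show "\<exists>g. smooth g \<and> (\<forall>y\<in>ball 0 r. xray_adjoint \<psi> i y = g y)"
        by (rule exI[of _ "\<lambda>y. LINT q|(sphere_measure \<Otimes>\<^sub>M lborel). c (norm x + \<epsilon> + r) i q * \<phi> (x + snd q *\<^sub>R fst q - y)"])
           (auto simp: adj sm_g)
    qed
    have Fi: "F i (xray_adjoint \<psi> i) = (LINT \<theta>|sphere_measure. indicator (sphere 0 1) \<theta> * w i \<theta> *
        (LINT s|lborel. indicator {-T'..T'} s * conv (F i) \<phi> (x + s *\<^sub>R \<theta>)))" for i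
    proof -
      have "F i (xray_adjoint \<psi> i) = F i (\<lambda>y. LINT q|(sphere_measure \<Otimes>\<^sub>M lborel). c T' i q * \<phi> (x + snd q *\<^sub>R fst q - y))"
      proof (rule Y0(2)[OF sm_adj sm_g adj])
        fix y :: "real^'n" assume "norm y < Y0 i"
        then show "norm x + \<epsilon> + norm y \<le> T'"
          using Y0_le[of i] R0 unfolding T'_def by linarith
      qed
      also have "\<dots> = (LINT q|(sphere_measure \<Otimes>\<^sub>M lborel). c T' i q * conv (F i) \<phi> (x + snd q *\<^sub>R fst q))"
        by (rule compact_distribution_integral[OF F \<phi>(1) fam2])
      also have "\<dots> = (LINT \<theta>|sphere_measure. indicator (sphere 0 1) \<theta> * w i \<theta> *
        (LINT s|lborel. indicator {-T'..T'} s * conv (F i) \<phi> (x + s *\<^sub>R \<theta>)))"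
        unfolding c_def by (rule sphere_segment_Fubini(1)[OF w smA])
      finally show ?thesis .
    qed
    have "smooth_on_subset lines \<psi>"
      unfolding smooth_on_subset_def \<psi>_def
      using smooth_line_test[OF h \<phi>(1), of x T] by blast
    then have "xray F \<psi> = 0"
      using xray line_test_support[where \<phi> = \<phi> and h = h and T = T, OF \<phi>(2) V] unfolding xray_vanishes_on_lines_meeting_def \<psi>_def by blast
    then have "0 = (\<Sum>i\<in>UNIV. LINT \<theta>|sphere_measure. indicator (sphere 0 1) \<theta> * w i \<theta> *
        (LINT s|lborel. indicator {-T'..T'} s * conv (F i) \<phi> (x + s *\<^sub>R \<theta>)))"
      by (simp add: xray_def Fi)
    also have "\<dots> = (LINT \<theta>|sphere_measure. (\<Sum>i\<in>UNIV. indicator (sphere 0 1) \<theta> * w i \<theta> *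
        (LINT s|lborel. indicator {-T'..T'} s * conv (F i) \<phi> (x + s *\<^sub>R \<theta>))))"
      by (rule Bochner_Integration.integral_sum[symmetric]) (rule sphere_segment_Fubini(2)[OF w smA])
    also have "\<dots> = (LINT \<theta>|sphere_measure. indicator (sphere 0 1) \<theta> * of_real (h \<theta>) * G \<theta>)"
      by (simp add: G_def w_def sum_distrib_left mult_ac)
    finally show "(LINT \<theta>|sphere_measure. indicator (sphere 0 1) \<theta> * of_real (h \<theta>) * G \<theta>) = 0" ..
  qed
  define \<theta>1 where "\<theta>1 = \<theta> /\<^sub>R norm \<theta>"
  have \<theta>1: "norm \<theta>1 = 1" "\<theta> = norm \<theta> *\<^sub>R \<theta>1"
    using \<theta> by (simp_all add: \<theta>1_def)
  have \<theta>1_nz: "\<theta>1 \<noteq> 0"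
    using \<theta>1(1) by auto
  have "Y \<ge> 0"
    using Y0(1) unfolding Y_def by (intro sum_nonneg) (auto intro: less_imp_le)
  then have "R + norm x \<le> T' * norm \<theta>1"
    by (simp add: T'_def \<theta>1)
  then have trunc: "(LINT s|lborel. conv (F i) \<phi> (x + s *\<^sub>R \<theta>1)) = (LINT s|lborel. indicator {-T'..T'} s * conv (F i) \<phi> (x + s *\<^sub>R \<theta>1))" for i
    using integral_ray_truncate[of R "conv (F i) \<phi>" x T' \<theta>1 "\<lambda>_. 1"] R \<theta>1_nz by simp
  have int: "integrable lborel (\<lambda>s. conv (F i) \<phi> (x + s *\<^sub>R \<theta>))" if "\<theta> \<noteq> 0" for i \<theta>
    by (rule compactly_supported_ray_integrable[OF smA R that])
  have scale: "(LINT s|lborel. conv (F i) \<phi> (x + s *\<^sub>R \<theta>1)) = norm \<theta> *\<^sub>R (LINT s|lborel. conv (F i) \<phi> (x + s *\<^sub>R \<theta>))" for i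
  proof -
    have "(norm \<theta> * s) *\<^sub>R \<theta>1 = s *\<^sub>R \<theta>" for s
      using \<theta> by (simp add: \<theta>1_def)
    then show ?thesis
      using \<theta> by (subst lborel_integral_real_affine[of "norm \<theta>" _ 0]) auto
  qed
  have "(LINT s|lborel. (\<Sum>i\<in>UNIV. (\<theta> $ i) *\<^sub>R conv (F i) \<phi> (x + s *\<^sub>R \<theta>)))
    = (\<Sum>i\<in>UNIV. (\<theta> $ i) *\<^sub>R (LINT s|lborel. conv (F i) \<phi> (x + s *\<^sub>R \<theta>)))"
    using int[OF \<theta>] by (simp add: Bochner_Integration.integral_sum)
  also have "\<dots> = (\<Sum>i\<in>UNIV. (\<theta>1 $ i) *\<^sub>R (LINT s|lborel. conv (F i) \<phi> (x + s *\<^sub>R \<theta>1)))"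
  proof (rule sum.cong)
    fix i
    have "\<theta> $ i = norm \<theta> * \<theta>1 $ i"
      by (subst \<theta>1(2)) simp
    then show "(\<theta> $ i) *\<^sub>R (LINT s|lborel. conv (F i) \<phi> (x + s *\<^sub>R \<theta>)) = (\<theta>1 $ i) *\<^sub>R (LINT s|lborel. conv (F i) \<phi> (x + s *\<^sub>R \<theta>1))"
      by (simp add: scale mult.commute)
  qed simp
  also have "\<dots> = G \<theta>1"
    unfolding trunc by (simp add: G_def scaleR_conv_of_real[where 'a = complex])
  finally show ?thesis
    using G_zero[OF \<theta>1(1)] by simp
qed

section \<open>The partial data theorem\<close>

lemma sum_Basis_axis:
  fixes g :: "real^'n::finite \<Rightarrow> 'b::comm_monoid_add"
  shows "(\<Sum>b\<in>Basis. g b) = (\<Sum>i\<in>UNIV. g (axis i 1))"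
proof -
  have "(Basis :: (real^'n) set) = (\<lambda>i. axis i 1) ` UNIV"
    by (auto simp: Basis_vec_def)
  moreover have "inj (\<lambda>i::'n. axis i (1::real))"
    by (auto intro: injI simp: axis_eq_axis)
  ultimately show ?thesis
    using sum.reindex[of "\<lambda>i. axis i 1" UNIV g] by (simp add: o_def)
qed

theorem dist_curl_eq_0:
  fixes F :: "'n::finite \<Rightarrow> (real^'n) functional"
  assumes card: "CARD('n) \<ge> 2" and V: "open V" "V \<noteq> {}"
    and F: "\<And>i. compact_distribution (F i)"
    and P: "P \<noteq> 0" "restriction_zero V (diff_op P (dist_curl F k l))"
    and xray: "xray_vanishes_on_lines_meeting F V"
    and f: "smooth f"
  shows "dist_curl F k l f = 0"
proof -
  obtain x0 where "x0 \<in> V" using V(2) by blast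
  then obtain e where e: "e > 0" "cball x0 e \<subseteq> V"
    using V(1) open_contains_cball by blast
  \<comment> \<open>Half of the ball is the region where the convolutions are studied, the other half accommodates the
    support of \<open>\<phi>\<close>.\<close>
  define \<epsilon> where "\<epsilon> = e / 2"
  have \<epsilon>: "\<epsilon> > 0" using e by (simp add: \<epsilon>_def)
  have ball_sub: "cball x \<epsilon> \<subseteq> V" if "x \<in> ball x0 \<epsilon>" for x
  proof
    fix y assume "y \<in> cball x \<epsilon>"
    then have "dist x0 y \<le> e"
      using that dist_triangle[of x0 y x] by (simp add: \<epsilon>_def)
    with e(2) show "y \<in> V" by auto
  qed
  have curl: "compact_distribution (dist_curl F k l)"
    by (rule compact_distribution_dist_curl[OF F F])
  show ?thesis
  proof (rule compact_distribution_eq_0_if_conv_eq_0[OF curl \<epsilon> _ f])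
    fix \<phi> :: "real^'n \<Rightarrow> complex" and x
    assume \<phi>: "smooth \<phi>" "\<And>y. norm y > \<epsilon> \<Longrightarrow> \<phi> y = 0"
    obtain R where "\<forall>i x. norm x > R \<longrightarrow> conv (F i) \<phi> x = 0"
      using conv_family_support[of F \<phi> \<epsilon>, OF F \<phi>] by blast
    then have R: "conv (F i) \<phi> x = 0" if "norm x > R" for i x
      using that by blast
    have smA: "smooth (conv (F i) \<phi>)" for i
      by (rule smooth_conv[OF F \<phi>(1)])
    define idx where "idx b = (THE i::'n. b = axis i (1::real))" for b :: "real^'n"
    have idx: "idx (axis i 1) = i" for i
      unfolding idx_def by (rule the_equality) (auto simp: axis_eq_axis)
    define A where "A b = conv (F (idx b)) \<phi>" for b
    define g where "g x = dirD (axis k 1) (A (axis l 1)) x - dirD (axis l 1) (A (axis k 1)) x" for x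
    have ax: "axis i 1 \<in> (Basis :: (real^'n) set)" for i
      by simp
    have "dist_partial i (F j) (\<lambda>y. \<phi> (x - y)) = dirD (axis i 1) (conv (F j) \<phi>) x" for i j x
      using fun_cong[OF conv_dist_partial[OF F \<phi>(1), of i j], of x]
      by (simp add: conv_def[of "dist_partial i (F j)"] partial_eq_dirD)
    then have conv_g: "conv (dist_curl F k l) \<phi> = g"
      by (simp only: fun_eq_iff conv_def[of "dist_curl F k l"]) (simp add: dist_curl_def g_def A_def idx)
    have smg: "smooth g"
      unfolding g_def[abs_def] A_def by (intro smooth_diff smooth_dirD smA ax)
    have supp: "g x = 0" if "norm x > R" for x
      using dirD_support[of R "A (axis l 1)" x "axis k 1"] dirD_support[of R "A (axis k 1)" x "axis l 1"] R that
      by (simp add: g_def A_def)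
    have ray: "(LINT s|lborel. g (y + s *\<^sub>R \<theta>)) = 0" if "y \<in> ball x0 \<epsilon>" "\<theta> \<noteq> 0" for y \<theta>
      unfolding g_def
    proof (rule curl_line_integral_zero[OF _ _ open_ball that(1) that(2) ax ax])
      show "smooth (A b)" for b
        unfolding A_def by (rule smA)
      show "A b z = 0" if "norm z > R" for b z
        unfolding A_def by (rule R[OF that])
      show "(LINT s|lborel. (\<Sum>b\<in>Basis. (\<theta> \<bullet> b) *\<^sub>R A b (z + s *\<^sub>R \<theta>))) = 0" if "z \<in> ball x0 \<epsilon>" "\<theta> \<noteq> 0" for z \<theta>
        using xray_vanishing_pointwise[OF F xray \<phi> ball_sub[OF that(1)] that(2)]
        by (simp add: sum_Basis_axis A_def idx inner_axis)
    qed
    have free: "ray_free (ball x0 \<epsilon>) R (diff_op_fun P g)"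
      by (rule ray_free_diff_op_fun) (use smg supp ray in \<open>auto simp: ray_free_def\<close>)
    have loc: "diff_op_fun P g y = 0" if "y \<in> ball x0 \<epsilon>" for y
    proof -
      have "test_function_on V (\<lambda>z. \<phi> (y - z))"
        unfolding test_function_on_def
      proof (intro conjI)
        show "smooth (\<lambda>z. \<phi> (y - z))"
          by (rule smooth_reflect[OF \<phi>(1)])
        have "support_on UNIV (\<lambda>z. \<phi> (y - z)) \<subseteq> cball y \<epsilon>"
          using \<phi>(2) by (force simp: support_on_def dist_norm not_le)
        then have "closure (support_on UNIV (\<lambda>z. \<phi> (y - z))) \<subseteq> cball y \<epsilon>"
          by (rule closure_minimal) simp
        then show "closure (support_on UNIV (\<lambda>z. \<phi> (y - z))) \<subseteq> V"
          "compact (closure (support_on UNIV (\<lambda>z. \<phi> (y - z))))"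
          using ball_sub[OF that] by (auto intro: bounded_subset simp: compact_eq_bounded_closed)
      qed
      then have "conv (diff_op P (dist_curl F k l)) \<phi> y = 0"
        using P(2) by (simp add: conv_def restriction_zero_def)
      then show ?thesis
        by (simp add: conv_diff_op[OF curl \<phi>(1)] conv_g)
    qed
    have "diff_op_fun P g y = 0" for y
    proof (rule line_integrals_determine_function[where f = "diff_op_fun P g" and R = R and r = \<epsilon> and ?x0.0 = x0])
      show "DIM(real^'n) \<ge> 2"
        using card by simp
    qed (use free loc \<epsilon> in \<open>auto simp: ray_free_def\<close>)
    then have "g x = 0"
      by (rule diff_op_fun_injective[OF P(1), rotated]) (use smg supp in \<open>auto simp: csmooth_def\<close>)
    then show "conv (dist_curl F k l) \<phi> x = 0"
      by (simp add: conv_g)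
  qed
qed

theorem theorem1p8:
  fixes V :: "(real^'n::finite) set" and F :: "'n \<Rightarrow> (real^'n) functional"
  assumes "CARD('n) \<ge> 2"
    and "open V" and "V \<noteq> {}"
    and "\<And>i. compact_distribution (F i)"
    and "\<And>i j. dist_curl F i j \<in> admissible V"
    and "xray_vanishes_on_lines_meeting F V"
  shows "\<exists>\<phi>. compact_distribution \<phi> \<and> (\<forall>i. eq_compact_distribution (F i) (dist_partial i \<phi>))"
proof (rule compact_distribution_Poincare[OF assms(1,4)])
  fix i j and f :: "real^'n \<Rightarrow> complex"
  assume f: "smooth f"
  obtain P where "P \<noteq> 0" "restriction_zero V (diff_op P (dist_curl F i j))"
    using assms(5)[of i j] by (auto simp: admissible_def)
  then show "dist_curl F i j f = 0"
    using dist_curl_eq_0[OF assms(1-4) _ _ assms(6) f] by blast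
qed

end
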